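(* Let $R$ be a commutative noetherian ring. Then the following hold. (i) The weak torsion pairs in $\operatorname{mod}R$ are exactly the torsion pairs in $\operatorname{mod}R$, and there is a bijection between the set of torsion pairs in $\operatorname{mod}R$ and the set of specialization-closed subsets of $\operatorname{Spec}R$. (ii) There is a bijection between the set of basic torsion pairs in $\operatorname{mod}R$ and the set of pairs $(C,C')$ of closed subsets $C,C'$ of $\operatorname{Spec}R$ with $C\sqcup C'=\operatorname{Spec}R$. (iii) The weak torsion pairs in $\operatorname{S}_1(R)$, the torsion pairs in $\operatorname{S}_1(R)$ and the basic torsion pairs in $\operatorname{S}_1(R)$ all coincide, and there is a bijection between the set of these pairs and the set of all subsets of $\operatorname{Min}R$.
   Context: $\operatorname{mod} R$ is the category of finitely generated $R$-modules. All subcategories are full and closed under isomorphisms. $\operatorname{Min} R$ is the set of minimal prime ideals of $R$. $\operatorname{S}_1(R)$ is the subcategory of $\operatorname{mod}R$ of modules $M$ satisfying Serre's condition $(\mathrm S_1)$, i.e. $\operatorname{depth}_{R_{\mathfrak p}}M_{\mathfrak p}\ge\min\{1,\dim R_{\mathfrak p}\}$ for all prime ideals $\mathfrak p$ of $R$ (the zero module has depth $\infty$). $\operatorname{Spec}R$ has the Zariski topology; a subset $Z$ of it is specialization-closed if the closure of $\{z\}$ is contained in $Z$ for every $z\in Z$. $C\sqcup C'$ denotes disjoint union. Let $\mathcal X$ be a subcategory of $\operatorname{mod}R$ and $(\mathcal T,\mathcal F)$ a pair of subcategories of $\mathcal X$. - $(\mathcal T,\mathcal F)$ is a weak torsion pair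 in $\mathcal X$ if $\mathcal T=\{X\in\mathcal X\mid\operatorname{Hom}_R(X,F)=0\ \forall F\in\mathcal F\}$ and $\mathcal F=\{X\in\mathcal X\mid\operatorname{Hom}_R(T,X)=0\ \forall T\in\mathcal T\}$. - If $\mathcal X$ is closed under extensions in $\operatorname{mod}R$, $(\mathcal T,\mathcal F)$ is a torsion pair in $\mathcal X$ if $\operatorname{Hom}_R(T,F)=0$ for all $T\in\mathcal T$, $F\in\mathcal F$, and every $X\in\mathcal X$ admits a short exact sequence $0\to T\to X\to F\to0$ in $\operatorname{mod}R$ with $T\in\mathcal T$ and $F\in\mathcal F$. - $(\mathcal T,\mathcal F)$ is a basic torsion pair in $\mathcal X$ if it is a torsion pair in $\mathcal X$ and there are ideals $I,J$ of $R$ with $\mathcal T=\{X\in\mathcal X\mid IX=0\}$ and $\mathcal F=\{X\in\mathcal X\mid JX=0\}$. *)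

theory Defs
  imports
    "HOL-Algebra.Module"
    "HOL-Algebra.Ring_Divisibility"
    "HOL-Analysis.Abstract_Topology"
    "HOL-Library.Extended_Nat"
begin

section \<open>The prime spectrum\<close>

definition Spec :: "('a, 'm) ring_scheme \<Rightarrow> 'a set set" where
  "Spec R = {P. primeideal P R}"

definition Min_Spec :: "('a, 'm) ring_scheme \<Rightarrow> 'a set set" where
  "Min_Spec R = {P \<in> Spec R. \<forall>Q \<in> Spec R. Q \<subseteq> P \<longrightarrow> Q = P}"

definition zariski_topology :: "('a, 'm) ring_scheme \<Rightarrow> 'a set topology" where
  "zariski_topology R = topology (\<lambda>U. \<exists>I. ideal I R \<and> U = Spec R - {P \<in> Spec R. I \<subseteq> P})"

definition specialization_closed :: "('a, 'm) ring_scheme \<Rightarrow> 'a set set \<Rightarrow> bool" where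
  "specialization_closed R Z \<longleftrightarrow>
     Z \<subseteq> Spec R \<and> (\<forall>P \<in> Z. zariski_topology R closure_of {P} \<subseteq> Z)"

lemma istopology_zariski:
  assumes "cring R"
  shows "istopology (\<lambda>U. \<exists>I. ideal I R \<and> U = Spec R - {P \<in> Spec R. I \<subseteq> P})"
proof -
  interpret cring R by fact
  have int: "\<exists>K. ideal K R \<and> (Spec R - {P \<in> Spec R. I \<subseteq> P}) \<inter> (Spec R - {P \<in> Spec R. J \<subseteq> P})
      = Spec R - {P \<in> Spec R. K \<subseteq> P}" if I: "ideal I R" and J: "ideal J R" for I J
  proof (intro exI conjI)
    show "ideal (I \<inter> J) R" using i_intersect[OF I J] .
    have "I \<subseteq> P \<or> J \<subseteq> P" if P: "P \<in> Spec R" and sub: "I \<inter> J \<subseteq> P" for P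
    proof (rule ccontr)
      assume "\<not> (I \<subseteq> P \<or> J \<subseteq> P)"
      then obtain a b where ab: "a \<in> I" "a \<notin> P" "b \<in> J" "b \<notin> P" by blast
      have car: "a \<in> carrier R" "b \<in> carrier R"
        using ab ideal.Icarr[OF I] ideal.Icarr[OF J] by auto
      have "a \<otimes>\<^bsub>R\<^esub> b \<in> I" "a \<otimes>\<^bsub>R\<^esub> b \<in> J"
        using ab car ideal.I_r_closed[OF I] ideal.I_l_closed[OF J] by auto
      then show False
        using sub P ab car primeideal.I_prime[of P R a b] by (auto simp: Spec_def)
    qed
    then show "(Spec R - {P \<in> Spec R. I \<subseteq> P}) \<inter> (Spec R - {P \<in> Spec R. J \<subseteq> P})
      = Spec R - {P \<in> Spec R. I \<inter> J \<subseteq> P}" by blast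
  qed
  have un: "\<exists>K. ideal K R \<and> \<Union>\<U> = Spec R - {P \<in> Spec R. K \<subseteq> P}"
    if opn: "\<forall>U\<in>\<U>. \<exists>I. ideal I R \<and> U = Spec R - {P \<in> Spec R. I \<subseteq> P}" for \<U>
  proof -
    obtain f where f: "\<forall>U\<in>\<U>. ideal (f U) R \<and> U = Spec R - {P \<in> Spec R. f U \<subseteq> P}"
      using bchoice[OF opn] by blast
    have sub: "\<Union>(f ` \<U>) \<subseteq> carrier R"
    proof (intro UN_least subsetI)
      fix U x assume "U \<in> \<U>" "x \<in> f U"
      moreover from this f have "ideal (f U) R" by blast
      ultimately show "x \<in> carrier R" by (simp add: ideal.Icarr)
    qed
    have "Idl\<^bsub>R\<^esub> (\<Union>(f ` \<U>)) \<subseteq> P \<longleftrightarrow> \<Union>(f ` \<U>) \<subseteq> P" if "P \<in> Spec R" for P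
    proof -
      have "ideal P R" using that by (simp add: Spec_def primeideal_def)
      then show ?thesis using genideal_minimal[of P] genideal_self[OF sub] by (meson subset_trans)
    qed
    then have eq: "{P \<in> Spec R. Idl\<^bsub>R\<^esub> (\<Union>(f ` \<U>)) \<subseteq> P} = {P \<in> Spec R. \<Union>(f ` \<U>) \<subseteq> P}"
      by (intro Collect_cong conj_cong refl)
    have "\<Union>\<U> = (\<Union>U\<in>\<U>. Spec R - {P \<in> Spec R. f U \<subseteq> P})" using f by blast
    then have "\<Union>\<U> = Spec R - {P \<in> Spec R. Idl\<^bsub>R\<^esub> (\<Union>(f ` \<U>)) \<subseteq> P}"
      unfolding eq by blast
    with genideal_ideal[OF sub] show ?thesis by (intro exI conjI)
  qed
  show ?thesis unfolding istopology_def
  proof (intro conjI allI impI)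
    fix U V
    assume U: "\<exists>I. ideal I R \<and> U = Spec R - {P \<in> Spec R. I \<subseteq> P}"
      and V: "\<exists>I. ideal I R \<and> V = Spec R - {P \<in> Spec R. I \<subseteq> P}"
    from U obtain I where I: "ideal I R" "U = Spec R - {P \<in> Spec R. I \<subseteq> P}"
      by (elim exE conjE)
    from V obtain J where J: "ideal J R" "V = Spec R - {P \<in> Spec R. J \<subseteq> P}"
      by (elim exE conjE)
    show "\<exists>I. ideal I R \<and> U \<inter> V = Spec R - {P \<in> Spec R. I \<subseteq> P}"
      unfolding I(2) J(2) by (rule int[OF I(1) J(1)])
  next
    fix \<U>
    assume "\<forall>U\<in>\<U>. \<exists>I. ideal I R \<and> U = Spec R - {P \<in> Spec R. I \<subseteq> P}"
    then show "\<exists>I. ideal I R \<and> \<Union>\<U> = Spec R - {P \<in> Spec R. I \<subseteq> P}" by (rule un)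
  qed
qed

lemma topspace_zariski:
  assumes "cring R" shows "topspace (zariski_topology R) = Spec R"
proof -
  interpret cring R by fact
  have "Spec R - {P \<in> Spec R. carrier R \<subseteq> P} = Spec R"
    by (auto simp: Spec_def primeideal_def primeideal_axioms_def
        dest: additive_subgroup.a_subset[OF ideal.axioms(1)])
  then have "openin (zariski_topology R) (Spec R)"
    using oneideal
    by (auto simp: zariski_topology_def topology_inverse'[OF istopology_zariski[OF assms]])
  moreover have "U \<subseteq> Spec R" if "openin (zariski_topology R) U" for U
    using that
    by (auto simp: zariski_topology_def topology_inverse'[OF istopology_zariski[OF assms]])
  ultimately show ?thesis by (auto simp: topspace_def)
qed

lemma closedin_zariski:
  assumes "cring R"
  shows "closedin (zariski_topology R) C \<longleftrightarrow> (\<exists>I. ideal I R \<and> C = {P \<in> Spec R. I \<subseteq> P})"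
proof -
  have op: "openin (zariski_topology R) U \<longleftrightarrow>
      (\<exists>I. ideal I R \<and> U = Spec R - {P \<in> Spec R. I \<subseteq> P})" for U
    by (simp add: zariski_topology_def topology_inverse'[OF istopology_zariski[OF assms]])
  have compl: "C \<subseteq> Spec R \<and> Spec R - C = Spec R - {P \<in> Spec R. I \<subseteq> P} \<longleftrightarrow>
      C = {P \<in> Spec R. I \<subseteq> P}" for I
  proof -
    have "C \<subseteq> S \<and> S - C = S - D \<longleftrightarrow> C = D" if "D \<subseteq> S" for S D :: "'a set set"
      using that by blast
    then show ?thesis by simp
  qed
  show ?thesis
    unfolding closedin_def topspace_zariski[OF assms] op compl[symmetric]
    by (rule iffI; elim conjE exE; intro exI conjI; assumption)
qed

section \<open>Finitely generated modules\<close>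

text \<open>The fields \<open>mult\<close> and \<open>one\<close> that a module record inherits from rings carry no
  information and are ignored by all notions below.\<close>

definition fg_module :: "('a, 'm) ring_scheme \<Rightarrow> ('a, 'b, 'k) module_scheme \<Rightarrow> bool" where
  "fg_module R M \<longleftrightarrow> module R M \<and>
     (\<exists>S \<subseteq> carrier M. finite S \<and>
        (\<forall>x \<in> carrier M. \<exists>c \<in> S \<rightarrow> carrier R. x = (\<Oplus>\<^bsub>M\<^esub>s\<in>S. c s \<odot>\<^bsub>M\<^esub> s)))"

definition module_hom ::
  "('a, 'm) ring_scheme \<Rightarrow> ('a, 'b, 'k) module_scheme \<Rightarrow> ('a, 'c, 'l) module_scheme \<Rightarrow> ('b \<Rightarrow> 'c) set"
  where
  "module_hom R M N = {f \<in> carrier M \<rightarrow> carrier N.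
     (\<forall>x \<in> carrier M. \<forall>y \<in> carrier M. f (x \<oplus>\<^bsub>M\<^esub> y) = f x \<oplus>\<^bsub>N\<^esub> f y) \<and>
     (\<forall>a \<in> carrier R. \<forall>x \<in> carrier M. f (a \<odot>\<^bsub>M\<^esub> x) = a \<odot>\<^bsub>N\<^esub> f x)}"

definition module_isomorphic ::
  "('a, 'm) ring_scheme \<Rightarrow> ('a, 'b, 'k) module_scheme \<Rightarrow> ('a, 'c, 'l) module_scheme \<Rightarrow> bool" where
  "module_isomorphic R M N \<longleftrightarrow> (\<exists>f \<in> module_hom R M N. bij_betw f (carrier M) (carrier N))"

text \<open>Homomorphisms are not required to be extensional, so ``\<open>Hom\<^sub>R(M, N) = 0\<close>'' means that
  every homomorphism vanishes on the carrier of \<open>M\<close>.\<close>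

definition Hom_zero ::
  "('a, 'm) ring_scheme \<Rightarrow> ('a, 'b, 'k) module_scheme \<Rightarrow> ('a, 'c, 'l) module_scheme \<Rightarrow> bool" where
  "Hom_zero R M N \<longleftrightarrow> (\<forall>f \<in> module_hom R M N. \<forall>x \<in> carrier M. f x = \<zero>\<^bsub>N\<^esub>)"

definition short_exact ::
  "('a, 'm) ring_scheme \<Rightarrow> ('a, 'b, 'k) module_scheme \<Rightarrow> ('b \<Rightarrow> 'c) \<Rightarrow> ('a, 'c, 'l) module_scheme \<Rightarrow>
   ('c \<Rightarrow> 'd) \<Rightarrow> ('a, 'd, 'n) module_scheme \<Rightarrow> bool" where
  "short_exact R L f M g N \<longleftrightarrow>
     f \<in> module_hom R L M \<and> g \<in> module_hom R M N \<and>
     inj_on f (carrier L) \<and> f ` carrier L = {x \<in> carrier M. g x = \<zero>\<^bsub>N\<^esub>} \<and>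
     g ` carrier M = carrier N"

text \<open>The category of finitely generated modules is realised on a carrier type that contains
  an isomorphic copy of every finitely generated module (see \<open>mod_cat_universal\<close>).
  Subcategories are closed under isomorphism, so they and the statements about them
  do not depend on this choice.\<close>

type_synonym 'a fgmod = "('a, 'a list set) module"

definition mod_cat :: "('a, 'm) ring_scheme \<Rightarrow> 'a fgmod set" where
  "mod_cat R = {M. fg_module R M}"

lemma mod_cat_universal:
  fixes R :: "('a, 'm) ring_scheme" and M :: "('a, 'b, 'k) module_scheme"
  assumes "fg_module R M"
  shows "\<exists>N \<in> mod_cat R. module_isomorphic R M N"
proof -
  interpret module R M using assms by (simp add: fg_module_def)
  have "\<exists>S\<subseteq>carrier M. finite S \<and>
      (\<forall>x \<in> carrier M. \<exists>c \<in> S \<rightarrow> carrier R. x = (\<Oplus>\<^bsub>M\<^esub>s\<in>S. c s \<odot>\<^bsub>M\<^esub> s))"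
    using assms unfolding fg_module_def by (rule conjunct2)
  then obtain S where S: "S \<subseteq> carrier M" "finite S"
    and gen: "\<forall>x \<in> carrier M. \<exists>c \<in> S \<rightarrow> carrier R. x = (\<Oplus>\<^bsub>M\<^esub>s\<in>S. c s \<odot>\<^bsub>M\<^esub> s)"
    by (elim exE conjE)
  obtain ss where ss: "set ss = S" using finite_list[OF S(2)] by blast
  define \<phi> where "\<phi> x = {map c ss | c. c \<in> S \<rightarrow> carrier R \<and> x = (\<Oplus>\<^bsub>M\<^esub>s\<in>S. c s \<odot>\<^bsub>M\<^esub> s)}" for x
  have inj: "inj_on \<phi> (carrier M)"
  proof (rule inj_onI)
    fix x y assume x: "x \<in> carrier M" and eq: "\<phi> x = \<phi> y"
    obtain c where c: "c \<in> S \<rightarrow> carrier R" "x = (\<Oplus>\<^bsub>M\<^esub>s\<in>S. c s \<odot>\<^bsub>M\<^esub> s)" using bspec[OF gen x] by blast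
    then have "map c ss \<in> \<phi> x" unfolding \<phi>_def by blast
    then have "map c ss \<in> \<phi> y" using eq by simp
    then obtain d where d: "d \<in> S \<rightarrow> carrier R" "y = (\<Oplus>\<^bsub>M\<^esub>s\<in>S. d s \<odot>\<^bsub>M\<^esub> s)" "map c ss = map d ss"
      by (auto simp: \<phi>_def)
    have "c s = d s" if "s \<in> S" for s using d(3) that ss by auto
    then have "(\<Oplus>\<^bsub>M\<^esub>s\<in>S. c s \<odot>\<^bsub>M\<^esub> s) = (\<Oplus>\<^bsub>M\<^esub>s\<in>S. d s \<odot>\<^bsub>M\<^esub> s)"
      using d S by (intro M.finsum_cong') auto
    then show "x = y" using c d by simp
  qed
  define \<psi> where "\<psi> = inv_into (carrier M) \<phi>"
  have \<psi>[simp]: "\<psi> (\<phi> x) = x" if "x \<in> carrier M" for x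
    using that inj by (simp add: \<psi>_def)
  define N :: "'a fgmod" where "N = \<lparr>carrier = \<phi> ` carrier M, mult = undefined, one = undefined,
    zero = \<phi> \<zero>\<^bsub>M\<^esub>, add = (\<lambda>X Y. \<phi> (\<psi> X \<oplus>\<^bsub>M\<^esub> \<psi> Y)), smult = (\<lambda>a X. \<phi> (a \<odot>\<^bsub>M\<^esub> \<psi> X))\<rparr>"
  have carN: "carrier N = \<phi> ` carrier M" by (simp add: N_def)
  have zeroN: "\<zero>\<^bsub>N\<^esub> = \<phi> \<zero>\<^bsub>M\<^esub>" by (simp add: N_def)
  have addN: "\<phi> x \<oplus>\<^bsub>N\<^esub> \<phi> y = \<phi> (x \<oplus>\<^bsub>M\<^esub> y)" if "x \<in> carrier M" "y \<in> carrier M" for x y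
    using that by (simp add: N_def)
  have smultN: "a \<odot>\<^bsub>N\<^esub> \<phi> x = \<phi> (a \<odot>\<^bsub>M\<^esub> x)" if "x \<in> carrier M" for a x
    using that by (simp add: N_def)
  have abN: "abelian_group N"
  proof (rule abelian_groupI)
    fix x assume "x \<in> carrier N"
    then obtain y where y: "y \<in> carrier M" "x = \<phi> y" by (auto simp: carN)
    have "\<phi> (\<ominus>\<^bsub>M\<^esub> y) \<oplus>\<^bsub>N\<^esub> x = \<zero>\<^bsub>N\<^esub>" using y by (simp add: addN zeroN M.l_neg)
    then show "\<exists>y\<in>carrier N. y \<oplus>\<^bsub>N\<^esub> x = \<zero>\<^bsub>N\<^esub>" using y by (auto simp: carN)
  qed (auto simp: carN addN zeroN M.a_ac)
  interpret N: module R N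
    by (rule moduleI)
      (auto simp: abN R.is_cring carN addN smultN smult_l_distr smult_r_distr smult_assoc1)
  have hom: "\<phi> \<in> module_hom R M N" by (auto simp: module_hom_def carN addN smultN)
  have sumN: "\<phi> (\<Oplus>\<^bsub>M\<^esub>i\<in>A. f i) = (\<Oplus>\<^bsub>N\<^esub>i\<in>A. \<phi> (f i))"
    if "finite A" "f \<in> A \<rightarrow> carrier M" for A f
    using that
  proof (induction A)
    case empty then show ?case by (simp add: zeroN)
  next
    case (insert a A)
    then have "(\<lambda>i. \<phi> (f i)) \<in> A \<rightarrow> carrier N" by (auto simp: carN)
    with insert show ?case by (simp add: carN addN[symmetric] Pi_def)
  qed
  have "\<exists>c \<in> \<phi> ` S \<rightarrow> carrier R. X = (\<Oplus>\<^bsub>N\<^esub>t\<in>\<phi> ` S. c t \<odot>\<^bsub>N\<^esub> t)" if X: "X \<in> carrier N" for X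
  proof -
    obtain x where x: "x \<in> carrier M" "X = \<phi> x" using X by (auto simp: carN)
    obtain c where c: "c \<in> S \<rightarrow> carrier R" "x = (\<Oplus>\<^bsub>M\<^esub>s\<in>S. c s \<odot>\<^bsub>M\<^esub> s)" using bspec[OF gen x(1)] by blast
    have "X = (\<Oplus>\<^bsub>N\<^esub>s\<in>S. \<phi> (c s \<odot>\<^bsub>M\<^esub> s))"
      unfolding x(2) c(2) using c S by (intro sumN) auto
    also have "\<dots> = (\<Oplus>\<^bsub>N\<^esub>s\<in>S. c (\<psi> (\<phi> s)) \<odot>\<^bsub>N\<^esub> \<phi> s)"
      using c S by (intro N.M.finsum_cong') (auto simp: smultN carN Pi_def subset_iff)
    also have "\<dots> = (\<Oplus>\<^bsub>N\<^esub>t\<in>\<phi> ` S. c (\<psi> t) \<odot>\<^bsub>N\<^esub> t)"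
      using c S inj_on_subset[OF inj S(1)]
      by (intro N.M.finsum_reindex[symmetric]) (auto simp: smultN carN Pi_def subset_iff)
    finally show ?thesis
      using c S by (intro bexI[of _ "\<lambda>t. c (\<psi> t)"]) (auto simp: subset_iff)
  qed
  then have "fg_module R N"
    using S N.module_axioms unfolding fg_module_def
    by (auto intro!: exI[of _ "\<phi> ` S"] simp: carN)
  moreover have "module_isomorphic R M N"
    using hom inj by (auto simp: module_isomorphic_def bij_betw_def carN)
  ultimately show ?thesis by (auto simp: mod_cat_def)
qed

definition is_subcategory :: "('a, 'm) ring_scheme \<Rightarrow> 'a fgmod set \<Rightarrow> bool" where
  "is_subcategory R \<C> \<longleftrightarrow> \<C> \<subseteq> mod_cat R \<and>
     (\<forall>M \<in> \<C>. \<forall>N \<in> mod_cat R. module_isomorphic R M N \<longrightarrow> N \<in> \<C>)"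

definition extension_closed :: "('a, 'm) ring_scheme \<Rightarrow> 'a fgmod set \<Rightarrow> bool" where
  "extension_closed R \<C> \<longleftrightarrow>
     (\<forall>L \<in> \<C>. \<forall>N \<in> \<C>. \<forall>M \<in> mod_cat R. (\<exists>f g. short_exact R L f M g N) \<longrightarrow> M \<in> \<C>)"

section \<open>Torsion pairs\<close>

definition subcategory_pairs ::
  "('a, 'm) ring_scheme \<Rightarrow> 'a fgmod set \<Rightarrow> ('a fgmod set \<times> 'a fgmod set) set" where
  "subcategory_pairs R \<C> =
     {(\<T>, \<F>). is_subcategory R \<T> \<and> is_subcategory R \<F> \<and> \<T> \<subseteq> \<C> \<and> \<F> \<subseteq> \<C>}"

definition weak_torsion_pairs ::
  "('a, 'm) ring_scheme \<Rightarrow> 'a fgmod set \<Rightarrow> ('a fgmod set \<times> 'a fgmod set) set" where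
  "weak_torsion_pairs R \<C> = {(\<T>, \<F>) \<in> subcategory_pairs R \<C>.
     \<T> = {X \<in> \<C>. \<forall>F \<in> \<F>. Hom_zero R X F} \<and>
     \<F> = {X \<in> \<C>. \<forall>T \<in> \<T>. Hom_zero R T X}}"

text \<open>Torsion pairs are only defined in extension-closed subcategories, hence the condition on \<open>\<C>\<close>.\<close>

definition torsion_pairs ::
  "('a, 'm) ring_scheme \<Rightarrow> 'a fgmod set \<Rightarrow> ('a fgmod set \<times> 'a fgmod set) set" where
  "torsion_pairs R \<C> = {(\<T>, \<F>) \<in> subcategory_pairs R \<C>.
     extension_closed R \<C> \<and>
     (\<forall>T \<in> \<T>. \<forall>F \<in> \<F>. Hom_zero R T F) \<and>
     (\<forall>X \<in> \<C>. \<exists>T \<in> \<T>. \<exists>F \<in> \<F>. \<exists>f g. short_exact R T f X g F)}"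

definition annihilated_by :: "'a fgmod set \<Rightarrow> 'a set \<Rightarrow> 'a fgmod set" where
  "annihilated_by \<C> I = {X \<in> \<C>. \<forall>a \<in> I. \<forall>x \<in> carrier X. a \<odot>\<^bsub>X\<^esub> x = \<zero>\<^bsub>X\<^esub>}"

definition basic_torsion_pairs ::
  "('a, 'm) ring_scheme \<Rightarrow> 'a fgmod set \<Rightarrow> ('a fgmod set \<times> 'a fgmod set) set" where
  "basic_torsion_pairs R \<C> = {(\<T>, \<F>) \<in> torsion_pairs R \<C>.
     \<exists>I J. ideal I R \<and> ideal J R \<and> \<T> = annihilated_by \<C> I \<and> \<F> = annihilated_by \<C> J}"

section \<open>Localization\<close>

definition self_module :: "('a, 'm) ring_scheme \<Rightarrow> ('a, 'a) module" where
  "self_module R = \<lparr>carrier = carrier R, mult = mult R, one = \<one>\<^bsub>R\<^esub>,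
     zero = \<zero>\<^bsub>R\<^esub>, add = add R, smult = mult R\<rparr>"

text \<open>The fraction \<open>m/s\<close>, as an equivalence class of pairs; \<open>S\<close> is a multiplicative subset.\<close>

definition fraction :: "'a set \<Rightarrow> ('a, 'b, 'k) module_scheme \<Rightarrow> 'b \<Rightarrow> 'a \<Rightarrow> ('b \<times> 'a) set" where
  "fraction S M m s = {(n, t) \<in> carrier M \<times> S. \<exists>u \<in> S. u \<odot>\<^bsub>M\<^esub> (t \<odot>\<^bsub>M\<^esub> m) = u \<odot>\<^bsub>M\<^esub> (s \<odot>\<^bsub>M\<^esub> n)}"

text \<open>Operations on fractions are defined on all representatives at once; the unions below are
  unions of a single class.\<close>

definition loc_ring :: "('a, 'm) ring_scheme \<Rightarrow> 'a set \<Rightarrow> ('a \<times> 'a) set ring" where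
  "loc_ring R S = (let q = fraction S (self_module R) in
     \<lparr>carrier = {q a s | a s. a \<in> carrier R \<and> s \<in> S},
      mult = (\<lambda>X Y. \<Union>(a, s) \<in> X. \<Union>(b, t) \<in> Y. q (a \<otimes>\<^bsub>R\<^esub> b) (s \<otimes>\<^bsub>R\<^esub> t)),
      one = q \<one>\<^bsub>R\<^esub> \<one>\<^bsub>R\<^esub>,
      zero = q \<zero>\<^bsub>R\<^esub> \<one>\<^bsub>R\<^esub>,
      add = (\<lambda>X Y. \<Union>(a, s) \<in> X. \<Union>(b, t) \<in> Y. q (t \<otimes>\<^bsub>R\<^esub> a \<oplus>\<^bsub>R\<^esub> s \<otimes>\<^bsub>R\<^esub> b) (s \<otimes>\<^bsub>R\<^esub> t))\<rparr>)"

definition loc_module ::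
  "('a, 'm) ring_scheme \<Rightarrow> 'a set \<Rightarrow> ('a, 'b, 'k) module_scheme \<Rightarrow>
   (('a \<times> 'a) set, ('b \<times> 'a) set) module" where
  "loc_module R S M = (let q = fraction S M in
     \<lparr>carrier = {q m s | m s. m \<in> carrier M \<and> s \<in> S},
      mult = undefined,
      one = undefined,
      zero = q \<zero>\<^bsub>M\<^esub> \<one>\<^bsub>R\<^esub>,
      add = (\<lambda>X Y. \<Union>(m, s) \<in> X. \<Union>(n, t) \<in> Y. q (t \<odot>\<^bsub>M\<^esub> m \<oplus>\<^bsub>M\<^esub> s \<odot>\<^bsub>M\<^esub> n) (s \<otimes>\<^bsub>R\<^esub> t)),
      smult = (\<lambda>X Y. \<Union>(a, s) \<in> X. \<Union>(n, t) \<in> Y. q (a \<odot>\<^bsub>M\<^esub> n) (s \<otimes>\<^bsub>R\<^esub> t))\<rparr>)"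

section \<open>Dimension, depth and Serre's condition\<close>

definition krull_dim :: "('a, 'm) ring_scheme \<Rightarrow> enat" where
  "krull_dim R = Sup {enat n | n. \<exists>P. (\<forall>i \<le> n. P i \<in> Spec R) \<and> (\<forall>i < n. P i \<subset> P (Suc i))}"

text \<open>The submodule \<open>(x\<^sub>1, \<dots>, x\<^sub>k) M\<close>.\<close>

definition seq_mult :: "('a, 'b, 'k) module_scheme \<Rightarrow> 'a list \<Rightarrow> 'b set" where
  "seq_mult M xs = {(\<Oplus>\<^bsub>M\<^esub>i\<in>{..<length xs}. (xs ! i) \<odot>\<^bsub>M\<^esub> m i) | m. m \<in> {..<length xs} \<rightarrow> carrier M}"

text \<open>Each \<open>x\<^sub>i\<close> is a nonzerodivisor on \<open>M / (x\<^sub>1, \<dots>, x\<^sub>i\<^sub>-\<^sub>1) M\<close>, and \<open>M \<noteq> (x\<^sub>1, \<dots>, x\<^sub>k) M\<close>.\<close>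

definition regular_sequence ::
  "('a, 'm) ring_scheme \<Rightarrow> ('a, 'b, 'k) module_scheme \<Rightarrow> 'a list \<Rightarrow> bool" where
  "regular_sequence R M xs \<longleftrightarrow> set xs \<subseteq> carrier R \<and>
     (\<forall>i < length xs. \<forall>m \<in> carrier M.
        (xs ! i) \<odot>\<^bsub>M\<^esub> m \<in> seq_mult M (take i xs) \<longrightarrow> m \<in> seq_mult M (take i xs)) \<and>
     seq_mult M xs \<noteq> carrier M"

text \<open>Depth of a finitely generated module over a noetherian local ring \<open>R\<close>.\<close>

definition depth :: "('a, 'm) ring_scheme \<Rightarrow> ('a, 'b, 'k) module_scheme \<Rightarrow> enat" where
  "depth R M = (if carrier M = {\<zero>\<^bsub>M\<^esub>} then \<infinity> else
     Sup {enat (length xs) | xs. regular_sequence R M xs \<and> set xs \<subseteq> (THE \<mm>. maximalideal \<mm> R)})"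

definition S1_cat :: "('a, 'm) ring_scheme \<Rightarrow> 'a fgmod set" where
  "S1_cat R = {M \<in> mod_cat R. \<forall>P \<in> Spec R.
     depth (loc_ring R (carrier R - P)) (loc_module R (carrier R - P) M)
       \<ge> min 1 (krull_dim (loc_ring R (carrier R - P)))}"

end

theory Submission
  imports Defs
begin

text \<open>
  Over a noetherian ring, homomorphisms out of a finitely generated module \<open>M\<close> are controlled by prime ideals: by
  \<open>Hom_zero_iff\<close>, \<open>Hom(M, N) = 0\<close> holds if and only if no associated prime of \<open>N\<close> lies in the support of \<open>M\<close>.
  Let \<open>(T, F)\<close> be a weak torsion pair in a subcategory \<open>C\<close>, and let \<open>Z\<close> be the set of the primes that are contained
  in no associated prime of a module in \<open>F\<close>.  It follows that \<open>T\<close> consists of the modules in \<open>C\<close> with support in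
  \<open>Z\<close> (\<open>weak_torsion_class_supported\<close>), and \<open>T\<close> determines \<open>F\<close>.

  Conversely, let \<open>Z\<close> be closed under specialization.  Every finitely generated module \<open>X\<close> has a largest submodule supported in
  \<open>Z\<close>, and the quotient has no associated prime in \<open>Z\<close> (\<open>torsion_sequence\<close>).  If these constructions stay in
  \<open>C\<close>, then the modules supported in \<open>Z\<close> and the modules without associated primes in \<open>Z\<close> form a torsion pair
  (\<open>torsion_pairI\<close>).  Every torsion pair is a weak torsion pair for formal reasons, so these descriptions agree.
  For all finitely generated modules this gives the first claim; the modules \<open>R/P\<close> recover \<open>Z\<close> from the pair.

  If both classes are defined by annihilating ideals, testing with \<open>R/P\<close> shows that \<open>Z\<close> and its complement are zero
  sets of these ideals.  Suitable ideals, if there are any, are the kernels of the localization maps from \<open>R\<close> to the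
  product of the \<open>R\<^sub>P\<close>, where \<open>P\<close> runs through \<open>Z\<close> for the torsion class and through the complement for the torsionfree
  class (\<open>annihilated_by_loc_kernel\<close>).  If \<open>Z\<close> is open and closed, these kernels are large enough because \<open>R\<close>
  decomposes accordingly, up to nilpotent elements (\<open>loc_kernel_clopen\<close>).

  A module satisfies \<open>(S\<^sub>1)\<close> if and only if its associated primes are minimal (\<open>S1_cat_eq\<close>), by prime avoidance and
  Nakayama's lemma.  Hence \<open>Z\<close> is the complement of a set \<open>B\<close> of minimal primes, which may be arbitrary.  The kernels for
  \<open>B\<close> and for the other minimal primes again separate, because there are only finitely many minimal primes \<open>Q\<close>, and
  the elements of \<open>Q\<close> are nilpotent in \<open>R\<^sub>Q\<close> (\<open>loc_kernel_Min\<close>).  So here every torsion pair is basic.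
\<close>

section \<open>Submodules and finite generation\<close>

context module begin

lemma submodule_iff:
  "submodule N R M \<longleftrightarrow> N \<subseteq> carrier M \<and> \<zero>\<^bsub>M\<^esub> \<in> N \<and> (\<forall>x\<in>N. \<forall>y\<in>N. x \<oplus>\<^bsub>M\<^esub> y \<in> N) \<and>
     (\<forall>a\<in>carrier R. \<forall>x\<in>N. a \<odot>\<^bsub>M\<^esub> x \<in> N)" (is "_ \<longleftrightarrow> ?r")
proof
  assume N: "submodule N R M"
  show ?r
    using submoduleE[OF N] subgroup.one_closed[OF submodule.axioms(1)[OF N]] by auto
next
  assume r: ?r
  show "submodule N R M"
  proof (rule submoduleI)
    fix x assume "x \<in> N"
    then have "(\<ominus> \<one>) \<odot>\<^bsub>M\<^esub> x \<in> N" "x \<in> carrier M" using r by auto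
    then show "\<ominus>\<^bsub>M\<^esub> x \<in> N" by (simp add: smult_l_minus)
  qed (use r in auto)
qed

lemma submodule_minus_closed:
  assumes "submodule N R M" "x \<in> N" "y \<in> N"
  shows "x \<ominus>\<^bsub>M\<^esub> y \<in> N"
  using submoduleE[OF assms(1)] assms by (simp add: M.minus_eq)

lemma submodule_cancel:
  assumes N: "submodule N R M" and "x \<oplus>\<^bsub>M\<^esub> y \<in> N" "y \<in> N" "x \<in> carrier M"
  shows "x \<in> N"
proof -
  have y: "y \<in> carrier M" using submoduleE(1)[OF N] assms by auto
  have "(x \<oplus>\<^bsub>M\<^esub> y) \<ominus>\<^bsub>M\<^esub> y \<in> N" using assms submodule_minus_closed by blast
  also have "(x \<oplus>\<^bsub>M\<^esub> y) \<ominus>\<^bsub>M\<^esub> y = x"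
    using y assms(4) by (simp add: M.minus_eq M.a_assoc M.r_neg)
  finally show ?thesis .
qed

lemma submodule_Int:
  "submodule N R M \<Longrightarrow> submodule L R M \<Longrightarrow> submodule (N \<inter> L) R M"
  unfolding submodule_iff by auto

lemma smult_lcomm:
  "a \<in> carrier R \<Longrightarrow> b \<in> carrier R \<Longrightarrow> x \<in> carrier M \<Longrightarrow> a \<odot>\<^bsub>M\<^esub> (b \<odot>\<^bsub>M\<^esub> x) = b \<odot>\<^bsub>M\<^esub> (a \<odot>\<^bsub>M\<^esub> x)"
  by (metis smult_assoc1 m_comm)

lemmas module_simps = smult_r_distr smult_l_distr smult_assoc1 smult_lcomm M.a_ac

lemma smult_finsum_mem:
  assumes N: "submodule N R M" and "finite S" "S \<subseteq> N" "c \<in> S \<rightarrow> carrier R"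
  shows "(\<Oplus>\<^bsub>M\<^esub>s\<in>S. c s \<odot>\<^bsub>M\<^esub> s) \<in> N"
  using assms(2-)
proof (induction S)
  case empty
  then show ?case using N by (simp add: submodule_iff)
next
  case (insert s S)
  have "N \<subseteq> carrier M" using N by (simp add: submodule_iff)
  then have "(\<Oplus>\<^bsub>M\<^esub>s\<in>insert s S. c s \<odot>\<^bsub>M\<^esub> s) = c s \<odot>\<^bsub>M\<^esub> s \<oplus>\<^bsub>M\<^esub> (\<Oplus>\<^bsub>M\<^esub>s\<in>S. c s \<odot>\<^bsub>M\<^esub> s)"
    using insert by (intro M.finsum_insert) auto
  then show ?case using insert N by (auto simp: submodule_iff)
qed

lemma submodule_combinations:
  assumes S: "finite S" "S \<subseteq> carrier M"
  shows "submodule {\<Oplus>\<^bsub>M\<^esub>s\<in>S. c s \<odot>\<^bsub>M\<^esub> s | c. c \<in> S \<rightarrow> carrier R} R M" (is "submodule ?N R M")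
    and "S \<subseteq> {\<Oplus>\<^bsub>M\<^esub>s\<in>S. c s \<odot>\<^bsub>M\<^esub> s | c. c \<in> S \<rightarrow> carrier R}"
proof -
  have S': "s \<in> S \<Longrightarrow> s \<in> carrier M" for s using S by auto
  show "submodule ?N R M" unfolding submodule_iff
  proof (intro conjI ballI)
    show "?N \<subseteq> carrier M" using S' by (auto intro!: M.finsum_closed)
    have "(\<Oplus>\<^bsub>M\<^esub>s\<in>S. \<zero> \<odot>\<^bsub>M\<^esub> s) = \<zero>\<^bsub>M\<^esub>" using S' by (simp add: M.add.finprod_one_eqI)
    then show "\<zero>\<^bsub>M\<^esub> \<in> ?N" by (auto intro!: exI[of _ "\<lambda>_. \<zero>"])
  next
    fix x y assume "x \<in> ?N" "y \<in> ?N"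
    then obtain c d where c: "c \<in> S \<rightarrow> carrier R" "x = (\<Oplus>\<^bsub>M\<^esub>s\<in>S. c s \<odot>\<^bsub>M\<^esub> s)"
      and d: "d \<in> S \<rightarrow> carrier R" "y = (\<Oplus>\<^bsub>M\<^esub>s\<in>S. d s \<odot>\<^bsub>M\<^esub> s)" by blast
    have "x \<oplus>\<^bsub>M\<^esub> y = (\<Oplus>\<^bsub>M\<^esub>s\<in>S. c s \<odot>\<^bsub>M\<^esub> s \<oplus>\<^bsub>M\<^esub> d s \<odot>\<^bsub>M\<^esub> s)"
      unfolding c d using c d S' by (intro M.finsum_addf[symmetric]) auto
    also have "\<dots> = (\<Oplus>\<^bsub>M\<^esub>s\<in>S. (c s \<oplus> d s) \<odot>\<^bsub>M\<^esub> s)"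
      using c d S' by (intro M.finsum_cong') (auto simp: smult_l_distr Pi_def)
    finally show "x \<oplus>\<^bsub>M\<^esub> y \<in> ?N" using c d by (auto intro!: exI[of _ "\<lambda>s. c s \<oplus> d s"])
  next
    fix a x assume a: "a \<in> carrier R" and "x \<in> ?N"
    then obtain c where c: "c \<in> S \<rightarrow> carrier R" "x = (\<Oplus>\<^bsub>M\<^esub>s\<in>S. c s \<odot>\<^bsub>M\<^esub> s)" by blast
    have "a \<odot>\<^bsub>M\<^esub> x = (\<Oplus>\<^bsub>M\<^esub>s\<in>S. a \<odot>\<^bsub>M\<^esub> (c s \<odot>\<^bsub>M\<^esub> s))"
      unfolding c using c S S' a by (intro finsum_smult_ldistr) auto
    also have "\<dots> = (\<Oplus>\<^bsub>M\<^esub>s\<in>S. (a \<otimes> c s) \<odot>\<^bsub>M\<^esub> s)"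
      using c a S' by (intro M.finsum_cong') (auto simp: smult_assoc1 Pi_def)
    finally show "a \<odot>\<^bsub>M\<^esub> x \<in> ?N" using c a by (auto intro!: exI[of _ "\<lambda>s. a \<otimes> c s"])
  qed
  show "S \<subseteq> ?N"
  proof
    fix t assume t: "t \<in> S"
    have "(\<Oplus>\<^bsub>M\<^esub>s\<in>S. (if s = t then \<one> else \<zero>) \<odot>\<^bsub>M\<^esub> s) = (\<Oplus>\<^bsub>M\<^esub>s\<in>S. if t = s then s else \<zero>\<^bsub>M\<^esub>)"
      using S' by (intro M.finsum_cong') auto
    also have "\<dots> = t" using t S S' by (intro M.finsum_singleton) auto
    finally show "t \<in> ?N" by (auto intro!: exI[of _ "\<lambda>s. if s = t then \<one> else \<zero>"])
  qed
qed

text \<open>This form of finite generation avoids sums: a property that defines a submodule holds everywhere as soon as it holds for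
  the generators.  The combinations of \<open>S\<close> form the smallest submodule containing \<open>S\<close>.\<close>

lemma fg_module_iff:
  "fg_module R M \<longleftrightarrow> (\<exists>S \<subseteq> carrier M. finite S \<and> (\<forall>N. submodule N R M \<longrightarrow> S \<subseteq> N \<longrightarrow> N = carrier M))"
proof
  assume "fg_module R M"
  then obtain S where S: "S \<subseteq> carrier M" "finite S"
    and gen: "\<forall>x \<in> carrier M. \<exists>c \<in> S \<rightarrow> carrier R. x = (\<Oplus>\<^bsub>M\<^esub>s\<in>S. c s \<odot>\<^bsub>M\<^esub> s)"
    unfolding fg_module_def by blast
  have "N = carrier M" if N: "submodule N R M" "S \<subseteq> N" for N
    using gen smult_finsum_mem[OF N(1) S(2) N(2)] submoduleE(1)[OF N(1)] by fastforce
  then show "\<exists>S \<subseteq> carrier M. finite S \<and> (\<forall>N. submodule N R M \<longrightarrow> S \<subseteq> N \<longrightarrow> N = carrier M)"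
    using S by blast
next
  assume "\<exists>S \<subseteq> carrier M. finite S \<and> (\<forall>N. submodule N R M \<longrightarrow> S \<subseteq> N \<longrightarrow> N = carrier M)"
  then obtain S where S: "S \<subseteq> carrier M" "finite S"
    and gen: "\<forall>N. submodule N R M \<longrightarrow> S \<subseteq> N \<longrightarrow> N = carrier M" by blast
  have "{\<Oplus>\<^bsub>M\<^esub>s\<in>S. c s \<odot>\<^bsub>M\<^esub> s | c. c \<in> S \<rightarrow> carrier R} = carrier M"
    using gen submodule_combinations[OF S(2,1)] by blast
  then have "\<forall>x \<in> carrier M. \<exists>c \<in> S \<rightarrow> carrier R. x = (\<Oplus>\<^bsub>M\<^esub>s\<in>S. c s \<odot>\<^bsub>M\<^esub> s)" by blast
  then show "fg_module R M" using S module_axioms unfolding fg_module_def by blast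
qed

end

locale noetherian_cring = cring R + noetherian_ring R for R (structure)

context cring begin

lemma ideal_iff:
  "ideal I R \<longleftrightarrow> I \<subseteq> carrier R \<and> \<zero> \<in> I \<and> (\<forall>x\<in>I. \<forall>y\<in>I. x \<oplus> y \<in> I) \<and> (\<forall>a\<in>carrier R. \<forall>x\<in>I. a \<otimes> x \<in> I)"
  (is "_ \<longleftrightarrow> ?r")
proof
  assume "ideal I R"
  then interpret I: ideal I R .
  show ?r using I.a_subset I.I_l_closed by auto
next
  assume r: ?r
  show "ideal I R"
  proof (rule idealI[OF ring_axioms])
    show "subgroup I (add_monoid R)"
    proof (rule add.subgroupI)
      fix x assume x: "x \<in> I"
      then have "(\<ominus> \<one>) \<otimes> x \<in> I" "x \<in> carrier R" using r by auto
      then show "\<ominus> x \<in> I" by (simp add: l_minus)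
    qed (use r in auto)
    show "a \<in> I \<Longrightarrow> x \<in> carrier R \<Longrightarrow> a \<otimes> x \<in> I" for a x using r by (metis m_comm subsetD)
  qed (use r in auto)
qed

end

context noetherian_cring begin

lemma maximal_ideal_in_family:
  assumes "F \<noteq> {}" "\<And>I. I \<in> F \<Longrightarrow> ideal I R"
  shows "\<exists>I\<in>F. \<forall>J\<in>F. I \<subseteq> J \<longrightarrow> J = I"
proof (rule subset_Zorn_nonempty[OF assms(1)])
  fix C assume C: "C \<noteq> {}" "subset.chain F C"
  then have "subset.chain {I. ideal I R} C" using assms(2) by (auto simp: subset.chain_def)
  from ideal_chain_is_trivial[OF C(1) this] C(2) show "\<Union>C \<in> F" by (auto simp: subset.chain_def)
qed

lemma fg_ideal:
  assumes "ideal I R"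
  obtains A where "finite A" "A \<subseteq> I" "\<And>J. ideal J R \<Longrightarrow> A \<subseteq> J \<Longrightarrow> I \<subseteq> J"
proof -
  obtain A where A: "A \<subseteq> carrier R" "finite A" "I = Idl A" using finetely_gen[OF assms] by blast
  show thesis
  proof (rule that)
    show "A \<subseteq> I" using A genideal_self by blast
    show "\<And>J. ideal J R \<Longrightarrow> A \<subseteq> J \<Longrightarrow> I \<subseteq> J" using A genideal_minimal by blast
  qed fact
qed

text \<open>A submodule of a finitely generated module is finitely generated.  Induction on the number of
  generators: the coefficients at a new generator \<open>s\<close> of elements of the submodule \<open>N\<close> form an ideal.
  Lift finitely many generators of this ideal to \<open>N\<close>, and add generators of the part of \<open>N\<close> that
  does not involve \<open>s\<close>.  The span of \<open>S\<close> appears only through the submodules containing \<open>S\<close>.\<close>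

lemma submodule_of_span_fg:
  assumes "module R M" "finite S" "S \<subseteq> carrier M" "submodule N R M"
    and "\<And>L. submodule L R M \<Longrightarrow> S \<subseteq> L \<Longrightarrow> N \<subseteq> L"
  shows "\<exists>G. finite G \<and> G \<subseteq> N \<and> (\<forall>L. submodule L R M \<longrightarrow> G \<subseteq> L \<longrightarrow> N \<subseteq> L)"
  using assms(2-)
proof (induction S arbitrary: N)
  interpret module R M by fact
  case empty
  have "submodule {\<zero>\<^bsub>M\<^esub>} R M" by (auto simp: submodule_iff)
  with empty have "N \<subseteq> {\<zero>\<^bsub>M\<^esub>}" by auto
  then have "N \<subseteq> L" if "submodule L R M" for L using that by (auto simp: submodule_iff)
  then show ?case by (intro exI[of _ "{}"]) auto
next
  interpret module R M by fact
  case (insert s S)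
  define T where "T = \<Inter>{L. submodule L R M \<and> S \<subseteq> L}"
  have T: "submodule T R M"
    using carrier_is_submodule insert.prems(1) by (auto simp: submodule_iff T_def)
  have s: "s \<in> carrier M" using insert by auto
  have Tc: "T \<subseteq> carrier M" using T by (simp add: submodule_iff)
  have ST: "S \<subseteq> T" by (auto simp: T_def)
  have Nc: "N \<subseteq> carrier M" using insert.prems by (simp add: submodule_iff)
  have sub: "submodule {a \<odot>\<^bsub>M\<^esub> s \<oplus>\<^bsub>M\<^esub> t | a t. a \<in> carrier R \<and> t \<in> T} R M" (is "submodule ?L R M")
    unfolding submodule_iff
  proof (intro conjI ballI)
    show "?L \<subseteq> carrier M" using s Tc by auto
    have "\<zero>\<^bsub>M\<^esub> = \<zero> \<odot>\<^bsub>M\<^esub> s \<oplus>\<^bsub>M\<^esub> \<zero>\<^bsub>M\<^esub>" using s by simp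
    then show "\<zero>\<^bsub>M\<^esub> \<in> ?L" using T by (auto simp: submodule_iff)
  next
    fix x y assume "x \<in> ?L" "y \<in> ?L"
    then obtain a t b u where *: "a \<in> carrier R" "t \<in> T" "x = a \<odot>\<^bsub>M\<^esub> s \<oplus>\<^bsub>M\<^esub> t"
      "b \<in> carrier R" "u \<in> T" "y = b \<odot>\<^bsub>M\<^esub> s \<oplus>\<^bsub>M\<^esub> u" by blast
    then have c: "t \<in> carrier M" "u \<in> carrier M" using Tc by auto
    have "x \<oplus>\<^bsub>M\<^esub> y = (a \<oplus> b) \<odot>\<^bsub>M\<^esub> s \<oplus>\<^bsub>M\<^esub> (t \<oplus>\<^bsub>M\<^esub> u)"
      using * c s by (simp add: module_simps)
    moreover have "t \<oplus>\<^bsub>M\<^esub> u \<in> T" using * T by (simp add: submodule_iff)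
    ultimately show "x \<oplus>\<^bsub>M\<^esub> y \<in> ?L" using * by blast
  next
    fix b x assume b: "b \<in> carrier R" and "x \<in> ?L"
    then obtain a t where *: "a \<in> carrier R" "t \<in> T" "x = a \<odot>\<^bsub>M\<^esub> s \<oplus>\<^bsub>M\<^esub> t" by blast
    then have "b \<odot>\<^bsub>M\<^esub> x = (b \<otimes> a) \<odot>\<^bsub>M\<^esub> s \<oplus>\<^bsub>M\<^esub> b \<odot>\<^bsub>M\<^esub> t"
      using b s Tc by (simp add: module_simps subset_iff)
    moreover have "b \<odot>\<^bsub>M\<^esub> t \<in> T" using * b T by (simp add: submodule_iff)
    ultimately show "b \<odot>\<^bsub>M\<^esub> x \<in> ?L" using * b by blast
  qed
  have "t = \<zero> \<odot>\<^bsub>M\<^esub> s \<oplus>\<^bsub>M\<^esub> t" if "t \<in> T" for t using that Tc s by auto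
  then have "T \<subseteq> ?L" by blast
  moreover have "s = \<one> \<odot>\<^bsub>M\<^esub> s \<oplus>\<^bsub>M\<^esub> \<zero>\<^bsub>M\<^esub>" "\<zero>\<^bsub>M\<^esub> \<in> T" using s T by (auto simp: submodule_iff)
  then have "s \<in> ?L" by blast
  ultimately have NL: "N \<subseteq> ?L" using insert.prems(3)[OF sub] ST by auto
  define I where "I L = {a \<in> carrier R. \<exists>t\<in>T. a \<odot>\<^bsub>M\<^esub> s \<oplus>\<^bsub>M\<^esub> t \<in> L}" for L
  have I: "ideal (I L) R" if L: "submodule L R M" for L
    unfolding ideal_iff
  proof (intro conjI ballI)
    show "I L \<subseteq> carrier R" by (auto simp: I_def)
    have "\<zero> \<odot>\<^bsub>M\<^esub> s \<oplus>\<^bsub>M\<^esub> \<zero>\<^bsub>M\<^esub> \<in> L" using L s by (simp add: submodule_iff)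
    then show "\<zero> \<in> I L" using T by (auto simp: I_def submodule_iff)
  next
    fix a b assume "a \<in> I L" "b \<in> I L"
    then obtain t u where *: "a \<in> carrier R" "t \<in> T" "a \<odot>\<^bsub>M\<^esub> s \<oplus>\<^bsub>M\<^esub> t \<in> L"
      "b \<in> carrier R" "u \<in> T" "b \<odot>\<^bsub>M\<^esub> s \<oplus>\<^bsub>M\<^esub> u \<in> L" by (auto simp: I_def)
    then have c: "t \<in> carrier M" "u \<in> carrier M" using Tc by auto
    have "(a \<oplus> b) \<odot>\<^bsub>M\<^esub> s \<oplus>\<^bsub>M\<^esub> (t \<oplus>\<^bsub>M\<^esub> u) = (a \<odot>\<^bsub>M\<^esub> s \<oplus>\<^bsub>M\<^esub> t) \<oplus>\<^bsub>M\<^esub> (b \<odot>\<^bsub>M\<^esub> s \<oplus>\<^bsub>M\<^esub> u)"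
      using * c s by (simp add: module_simps)
    also have "\<dots> \<in> L" using * L by (simp add: submodule_iff)
    finally show "a \<oplus> b \<in> I L" using * T by (auto simp: I_def submodule_iff)
  next
    fix b a assume b: "b \<in> carrier R" and "a \<in> I L"
    then obtain t where *: "a \<in> carrier R" "t \<in> T" "a \<odot>\<^bsub>M\<^esub> s \<oplus>\<^bsub>M\<^esub> t \<in> L" by (auto simp: I_def)
    have "(b \<otimes> a) \<odot>\<^bsub>M\<^esub> s \<oplus>\<^bsub>M\<^esub> b \<odot>\<^bsub>M\<^esub> t = b \<odot>\<^bsub>M\<^esub> (a \<odot>\<^bsub>M\<^esub> s \<oplus>\<^bsub>M\<^esub> t)"
      using b s * Tc by (simp add: module_simps subset_iff)
    also have "\<dots> \<in> L" using * b L by (simp add: submodule_iff)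
    finally show "b \<otimes> a \<in> I L" using * b T by (auto simp: I_def submodule_iff)
  qed
  obtain A where A: "finite A" "A \<subseteq> I N" "\<And>J. ideal J R \<Longrightarrow> A \<subseteq> J \<Longrightarrow> I N \<subseteq> J"
    using fg_ideal[OF I[OF insert.prems(2)]] by blast
  have "\<forall>a\<in>A. \<exists>t. t \<in> T \<and> a \<odot>\<^bsub>M\<^esub> s \<oplus>\<^bsub>M\<^esub> t \<in> N" using A(2) by (auto simp: I_def)
  then obtain t where t: "\<forall>a\<in>A. t a \<in> T \<and> a \<odot>\<^bsub>M\<^esub> s \<oplus>\<^bsub>M\<^esub> t a \<in> N" by metis
  have "\<exists>G. finite G \<and> G \<subseteq> N \<inter> T \<and> (\<forall>L. submodule L R M \<longrightarrow> G \<subseteq> L \<longrightarrow> N \<inter> T \<subseteq> L)"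
  proof (rule insert.IH)
    show "S \<subseteq> carrier M" "submodule (N \<inter> T) R M" using insert.prems submodule_Int T by auto
    show "N \<inter> T \<subseteq> L" if "submodule L R M" "S \<subseteq> L" for L using that by (auto simp: T_def)
  qed
  then obtain G where G: "finite G" "G \<subseteq> N \<inter> T"
    "\<And>L. submodule L R M \<Longrightarrow> G \<subseteq> L \<Longrightarrow> N \<inter> T \<subseteq> L" by metis
  define H where "H = (\<lambda>a. a \<odot>\<^bsub>M\<^esub> s \<oplus>\<^bsub>M\<^esub> t a) ` A \<union> G"
  have "N \<subseteq> L" if L: "submodule L R M" "H \<subseteq> L" for L
  proof
    fix x assume x: "x \<in> N"
    \<comment> \<open>the coefficient ideal of \<open>L \<inter> N\<close> contains that of \<open>N\<close>, so \<open>x\<close> differs from an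
      element of \<open>L \<inter> N\<close> by an element of \<open>N \<inter> T\<close>\<close>
    have LN: "submodule (L \<inter> N) R M" using L insert.prems submodule_Int by blast
    have "A \<subseteq> I (L \<inter> N)" using L(2) t A(2) unfolding I_def H_def by blast
    then have IN: "I N \<subseteq> I (L \<inter> N)" using A(3)[OF I[OF LN]] by blast
    obtain a u where a: "a \<in> carrier R" "u \<in> T" "x = a \<odot>\<^bsub>M\<^esub> s \<oplus>\<^bsub>M\<^esub> u" using NL x by blast
    then have "a \<in> I N" using x by (auto simp: I_def)
    then obtain v where v: "v \<in> T" "a \<odot>\<^bsub>M\<^esub> s \<oplus>\<^bsub>M\<^esub> v \<in> L \<inter> N" using IN by (auto simp: I_def)
    have uv: "u \<in> carrier M" "v \<in> carrier M" using a v Tc by auto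
    have e: "x \<ominus>\<^bsub>M\<^esub> (a \<odot>\<^bsub>M\<^esub> s \<oplus>\<^bsub>M\<^esub> v) = u \<ominus>\<^bsub>M\<^esub> v"
      unfolding a(3) using a uv s
      by (simp add: M.minus_eq M.minus_add M.a_ac M.r_neg1 M.r_neg)
    have "x \<ominus>\<^bsub>M\<^esub> (a \<odot>\<^bsub>M\<^esub> s \<oplus>\<^bsub>M\<^esub> v) \<in> N" using x v insert.prems(2) submodule_minus_closed by auto
    moreover have "u \<ominus>\<^bsub>M\<^esub> v \<in> T" using a v T submodule_minus_closed by auto
    ultimately have "x \<ominus>\<^bsub>M\<^esub> (a \<odot>\<^bsub>M\<^esub> s \<oplus>\<^bsub>M\<^esub> v) \<in> N \<inter> T" using e by auto
    also have "\<dots> \<subseteq> L" using G(3) L by (auto simp: H_def)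
    finally have "x \<ominus>\<^bsub>M\<^esub> (a \<odot>\<^bsub>M\<^esub> s \<oplus>\<^bsub>M\<^esub> v) \<in> L" .
    moreover have "(x \<ominus>\<^bsub>M\<^esub> (a \<odot>\<^bsub>M\<^esub> s \<oplus>\<^bsub>M\<^esub> v)) \<oplus>\<^bsub>M\<^esub> (a \<odot>\<^bsub>M\<^esub> s \<oplus>\<^bsub>M\<^esub> v) = x"
    proof -
      have "a \<odot>\<^bsub>M\<^esub> s \<oplus>\<^bsub>M\<^esub> v \<in> carrier M" "x \<in> carrier M" using a s uv x Nc by auto
      then show ?thesis by (simp add: M.minus_eq M.a_assoc M.l_neg)
    qed
    ultimately show "x \<in> L" using v L(1) by (metis IntD1 submodule_iff)
  qed
  moreover have "finite H" "H \<subseteq> N" using A G t by (auto simp: H_def)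
  ultimately show ?case by blast
qed

lemma fg_submodule:
  assumes fg: "fg_module R M" and N: "submodule N R M"
  shows "fg_module R (M\<lparr>carrier := N\<rparr>)"
proof -
  have M: "module R M" using fg by (simp add: fg_module_def)
  interpret module R M by fact
  interpret N: module R "M\<lparr>carrier := N\<rparr>" using submodule.submodule_is_module[OF N M] .
  obtain S where S: "S \<subseteq> carrier M" "finite S" "\<forall>L. submodule L R M \<longrightarrow> S \<subseteq> L \<longrightarrow> L = carrier M"
    using fg unfolding fg_module_iff by blast
  have Nc: "N \<subseteq> carrier M" using N by (simp add: submodule_iff)
  obtain G where G: "finite G" "G \<subseteq> N" "\<And>L. submodule L R M \<Longrightarrow> G \<subseteq> L \<Longrightarrow> N \<subseteq> L"
    using submodule_of_span_fg[OF M S(2,1) N] S(3) Nc by metis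
  have "L = N" if L: "submodule L R (M\<lparr>carrier := N\<rparr>)" "G \<subseteq> L" for L
  proof -
    have "submodule L R M" using L(1) Nc unfolding submodule_iff N.submodule_iff by auto
    with G(3) L show ?thesis unfolding N.submodule_iff by auto
  qed
  then show ?thesis unfolding N.fg_module_iff using G by auto
qed

text \<open>The union of a chain of submodules is finitely generated, so it is already a member of the chain.\<close>

lemma maximal_submodule_in_family:
  assumes fg: "fg_module R M" and F: "F \<noteq> {}" "\<And>N. N \<in> F \<Longrightarrow> submodule N R M"
  shows "\<exists>N\<in>F. \<forall>L\<in>F. N \<subseteq> L \<longrightarrow> L = N"
proof (rule subset_Zorn_nonempty[OF F(1)])
  have M: "module R M" using fg by (simp add: fg_module_def)
  interpret module R M by fact
  obtain S where S: "S \<subseteq> carrier M" "finite S" "\<forall>L. submodule L R M \<longrightarrow> S \<subseteq> L \<longrightarrow> L = carrier M"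
    using fg unfolding fg_module_iff by blast
  fix C assume C: "C \<noteq> {}" "subset.chain F C"
  have CF: "N \<in> C \<Longrightarrow> submodule N R M" for N using C F by (auto simp: subset.chain_def)
  have lin: "N \<subseteq> L \<or> L \<subseteq> N" if "N \<in> C" "L \<in> C" for N L
    using that C(2) by (auto simp: subset.chain_def)
  have sub: "submodule (\<Union>C) R M" unfolding submodule_iff
  proof (intro conjI ballI)
    show "\<Union>C \<subseteq> carrier M" using CF by (meson Union_least submodule_iff)
    show "\<zero>\<^bsub>M\<^esub> \<in> \<Union>C" using CF C(1) by (auto simp: submodule_iff)
  next
    fix x y assume "x \<in> \<Union>C" "y \<in> \<Union>C"
    then obtain N L where "N \<in> C" "L \<in> C" "x \<in> N" "y \<in> L" by blast
    then obtain K where "K \<in> C" "x \<in> K" "y \<in> K" using lin by (metis subsetD)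
    then show "x \<oplus>\<^bsub>M\<^esub> y \<in> \<Union>C" using CF by (auto simp: submodule_iff)
  next
    fix a x assume "a \<in> carrier R" "x \<in> \<Union>C"
    then show "a \<odot>\<^bsub>M\<^esub> x \<in> \<Union>C" using CF unfolding submodule_iff by blast
  qed
  obtain G where G: "finite G" "G \<subseteq> \<Union>C" "\<And>L. submodule L R M \<Longrightarrow> G \<subseteq> L \<Longrightarrow> \<Union>C \<subseteq> L"
    using submodule_of_span_fg[OF M S(2,1) sub] S(3) sub by (metis submodule_iff)
  have "\<exists>N\<in>C. G \<subseteq> N"
    using G(1,2)
  proof (induction G)
    case empty
    then show ?case using C(1) by blast
  next
    case (insert g G)
    then obtain N L where "N \<in> C" "G \<subseteq> N" "L \<in> C" "g \<in> L" by auto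
    then show ?case using lin[of N L] by blast
  qed
  then obtain N where N: "N \<in> C" "G \<subseteq> N" by blast
  then have "\<Union>C = N" using G(3) CF by blast
  then show "\<Union>C \<in> F" using N C(2) by (auto simp: subset.chain_def)
qed

end

section \<open>Associated primes and supports\<close>

definition annih :: "('a, 'm) ring_scheme \<Rightarrow> ('a, 'b, 'k) module_scheme \<Rightarrow> 'b \<Rightarrow> 'a set" where
  "annih R M x = {a \<in> carrier R. a \<odot>\<^bsub>M\<^esub> x = \<zero>\<^bsub>M\<^esub>}"

definition ass :: "('a, 'm) ring_scheme \<Rightarrow> ('a, 'b, 'k) module_scheme \<Rightarrow> 'a set set" where
  "ass R M = {P \<in> Spec R. \<exists>x \<in> carrier M. P = annih R M x}"

text \<open>The primes \<open>P\<close> with \<open>M\<^sub>P \<noteq> 0\<close>: some element of \<open>M\<close> is killed by nothing outside \<open>P\<close>.\<close>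

definition supp :: "('a, 'm) ring_scheme \<Rightarrow> ('a, 'b, 'k) module_scheme \<Rightarrow> 'a set set" where
  "supp R M = {P \<in> Spec R. \<exists>x \<in> carrier M. annih R M x \<subseteq> P}"

lemma ass_subset_supp: "ass R M \<subseteq> supp R M"
  by (auto simp: ass_def supp_def)

context cring begin

lemma minus_add_cancel: "a \<in> carrier R \<Longrightarrow> b \<in> carrier R \<Longrightarrow> a \<ominus> b \<oplus> b = a"
  by (simp add: minus_eq a_assoc l_neg)

lemma Spec_iff:
  "P \<in> Spec R \<longleftrightarrow> ideal P R \<and> \<one> \<notin> P \<and> (\<forall>a\<in>carrier R. \<forall>b\<in>carrier R. a \<otimes> b \<in> P \<longrightarrow> a \<in> P \<or> b \<in> P)"
proof
  assume "P \<in> Spec R"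
  then interpret P: primeideal P R by (simp add: Spec_def)
  have "\<one> \<notin> P" using P.one_imp_carrier P.I_notcarr by auto
  then show "ideal P R \<and> \<one> \<notin> P \<and> (\<forall>a\<in>carrier R. \<forall>b\<in>carrier R. a \<otimes> b \<in> P \<longrightarrow> a \<in> P \<or> b \<in> P)"
    using P.is_ideal P.I_prime by auto
next
  assume *: "ideal P R \<and> \<one> \<notin> P \<and> (\<forall>a\<in>carrier R. \<forall>b\<in>carrier R. a \<otimes> b \<in> P \<longrightarrow> a \<in> P \<or> b \<in> P)"
  then have "carrier R \<noteq> P" by auto
  with * show "P \<in> Spec R" by (auto simp: Spec_def intro!: primeidealI is_cring)
qed

lemma Spec_ideal: "P \<in> Spec R \<Longrightarrow> ideal P R" by (simp add: Spec_iff)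

lemma Spec_subset: "P \<in> Spec R \<Longrightarrow> P \<subseteq> carrier R" by (simp add: Spec_iff ideal_iff)

lemma Spec_zero: "P \<in> Spec R \<Longrightarrow> \<zero> \<in> P" by (simp add: Spec_iff ideal_iff)

lemma Spec_one: "P \<in> Spec R \<Longrightarrow> \<one> \<notin> P" by (simp add: Spec_iff)

lemma Spec_add_iff:
  assumes P: "P \<in> Spec R" and "a \<in> P" "b \<in> carrier R"
  shows "a \<oplus> b \<in> P \<longleftrightarrow> b \<in> P"
proof
  interpret P: ideal P R using P by (rule Spec_ideal)
  have a: "a \<in> carrier R" using assms(2) by (rule P.a_Hcarr)
  have "\<ominus> a \<oplus> (a \<oplus> b) = b" using a assms(3) by (simp add: r_neg1)
  then show "b \<in> P" if "a \<oplus> b \<in> P" using that assms(2) P.a_closed P.a_inv_closed by metis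
  show "a \<oplus> b \<in> P" if "b \<in> P" using that assms by simp
qed

lemma Spec_mult_iff:
  "P \<in> Spec R \<Longrightarrow> a \<in> carrier R \<Longrightarrow> b \<in> carrier R \<Longrightarrow> a \<otimes> b \<in> P \<longleftrightarrow> a \<in> P \<or> b \<in> P"
  unfolding Spec_iff ideal_iff by (metis m_comm)

lemma Spec_power_iff: "P \<in> Spec R \<Longrightarrow> a \<in> carrier R \<Longrightarrow> a [^] (n::nat) \<in> P \<longleftrightarrow> a \<in> P \<and> n \<noteq> 0"
  by (induction n) (auto simp: Spec_one Spec_mult_iff)

lemma module_self: "module R (self_module R)"
proof (rule moduleI[OF is_cring])
  show "abelian_group (self_module R)"
  proof (rule abelian_groupI)
    show "\<exists>y\<in>carrier (self_module R). y \<oplus>\<^bsub>self_module R\<^esub> x = \<zero>\<^bsub>self_module R\<^esub>"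
      if "x \<in> carrier (self_module R)" for x
      using that by (intro bexI[of _ "\<ominus> x"]) (auto simp: self_module_def l_neg)
  qed (auto simp: self_module_def a_ac)
qed (auto simp: self_module_def l_distr r_distr m_assoc)

lemma self_module_simps [simp]:
  "carrier (self_module R) = carrier R" "\<zero>\<^bsub>self_module R\<^esub> = \<zero>"
  "x \<oplus>\<^bsub>self_module R\<^esub> y = x \<oplus> y" "a \<odot>\<^bsub>self_module R\<^esub> x = a \<otimes> x"
  by (auto simp: self_module_def)

lemma submodule_self_iff: "submodule I R (self_module R) \<longleftrightarrow> ideal I R"
  unfolding module.submodule_iff[OF module_self] ideal_iff by simp

end

context noetherian_cring begin

lemma fg_module_self: "fg_module R (self_module R)"
  unfolding module.fg_module_iff[OF module_self] submodule_self_iff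
  using ideal.one_imp_carrier by (intro exI[of _ "{\<one>}"]) auto

text \<open>For each multiple \<open>y\<close> of \<open>x\<close> with nonzero image in the localization \<open>S\<^sup>-\<^sup>1M\<close>, consider the elements of
  \<open>R\<close> that annihilate this image.  A maximal one among these ideals is prime: if it contains \<open>a \<otimes> b\<close> but not
  \<open>b\<close>, it equals the ideal that belongs to the multiple \<open>b \<odot> y\<close>, and the latter contains \<open>a\<close>.
  The case \<open>S = {1}\<close> yields associated primes, the module \<open>R\<close> itself yields primes that avoid \<open>S\<close>.\<close>

lemma prime_annihilator_avoiding:
  assumes M: "module R M"
    and S: "S \<subseteq> carrier R" "\<one> \<in> S" "\<And>a b. a \<in> S \<Longrightarrow> b \<in> S \<Longrightarrow> a \<otimes> b \<in> S"
    and x: "x \<in> carrier M" "\<And>s. s \<in> S \<Longrightarrow> s \<odot>\<^bsub>M\<^esub> x \<noteq> \<zero>\<^bsub>M\<^esub>"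
  obtains r where "r \<in> carrier R"
    "{a \<in> carrier R. \<exists>s\<in>S. s \<odot>\<^bsub>M\<^esub> (a \<odot>\<^bsub>M\<^esub> (r \<odot>\<^bsub>M\<^esub> x)) = \<zero>\<^bsub>M\<^esub>} \<in> Spec R"
    "{a \<in> carrier R. \<exists>s\<in>S. s \<odot>\<^bsub>M\<^esub> (a \<odot>\<^bsub>M\<^esub> (r \<odot>\<^bsub>M\<^esub> x)) = \<zero>\<^bsub>M\<^esub>} \<inter> S = {}"
proof -
  interpret module R M by fact
  have Sc: "s \<in> S \<Longrightarrow> s \<in> carrier R" for s using S by auto
  define A where "A y = {a \<in> carrier R. \<exists>s\<in>S. s \<odot>\<^bsub>M\<^esub> (a \<odot>\<^bsub>M\<^esub> y) = \<zero>\<^bsub>M\<^esub>}" for y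
  define Y where "Y = {r \<odot>\<^bsub>M\<^esub> x | r. r \<in> carrier R \<and> (\<forall>s\<in>S. s \<odot>\<^bsub>M\<^esub> (r \<odot>\<^bsub>M\<^esub> x) \<noteq> \<zero>\<^bsub>M\<^esub>)}"
  have Yc: "y \<in> carrier M" if "y \<in> Y" for y using that x by (auto simp: Y_def)
  have idl: "ideal (A y) R" if y: "y \<in> carrier M" for y
    unfolding ideal_iff
  proof (intro conjI ballI)
    show "A y \<subseteq> carrier R" by (auto simp: A_def)
    show "\<zero> \<in> A y" using S Sc y by (auto simp: A_def)
  next
    fix a b assume "a \<in> A y" "b \<in> A y"
    then obtain s t where *: "a \<in> carrier R" "b \<in> carrier R" "s \<in> S" "t \<in> S"
      "s \<odot>\<^bsub>M\<^esub> (a \<odot>\<^bsub>M\<^esub> y) = \<zero>\<^bsub>M\<^esub>" "t \<odot>\<^bsub>M\<^esub> (b \<odot>\<^bsub>M\<^esub> y) = \<zero>\<^bsub>M\<^esub>" by (auto simp: A_def)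
    have "(s \<otimes> t) \<odot>\<^bsub>M\<^esub> ((a \<oplus> b) \<odot>\<^bsub>M\<^esub> y) = t \<odot>\<^bsub>M\<^esub> (s \<odot>\<^bsub>M\<^esub> (a \<odot>\<^bsub>M\<^esub> y)) \<oplus>\<^bsub>M\<^esub> s \<odot>\<^bsub>M\<^esub> (t \<odot>\<^bsub>M\<^esub> (b \<odot>\<^bsub>M\<^esub> y))"
      using *(1-4) y Sc by (simp add: module_simps)
    also have "\<dots> = \<zero>\<^bsub>M\<^esub>" using * Sc by simp
    finally show "a \<oplus> b \<in> A y" using * S(3) by (auto simp: A_def)
  next
    fix b a assume b: "b \<in> carrier R" and "a \<in> A y"
    then obtain s where *: "a \<in> carrier R" "s \<in> S" "s \<odot>\<^bsub>M\<^esub> (a \<odot>\<^bsub>M\<^esub> y) = \<zero>\<^bsub>M\<^esub>" by (auto simp: A_def)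
    have "s \<odot>\<^bsub>M\<^esub> ((b \<otimes> a) \<odot>\<^bsub>M\<^esub> y) = b \<odot>\<^bsub>M\<^esub> (s \<odot>\<^bsub>M\<^esub> (a \<odot>\<^bsub>M\<^esub> y))"
      using *(1,2) y Sc b by (simp add: module_simps)
    also have "\<dots> = \<zero>\<^bsub>M\<^esub>" using * b by simp
    finally show "b \<otimes> a \<in> A y" using * b by (auto simp: A_def)
  qed
  have "\<one> \<odot>\<^bsub>M\<^esub> x \<in> Y" unfolding Y_def using x by force
  then have "\<exists>I\<in>A ` Y. \<forall>J\<in>A ` Y. I \<subseteq> J \<longrightarrow> J = I"
    using idl Yc by (intro maximal_ideal_in_family) auto
  then obtain y where y: "y \<in> Y" and max: "\<And>z. z \<in> Y \<Longrightarrow> A y \<subseteq> A z \<Longrightarrow> A z = A y" by auto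
  have yc: "y \<in> carrier M" using y Yc by auto
  obtain r where r: "r \<in> carrier R" "y = r \<odot>\<^bsub>M\<^esub> x" using y by (auto simp: Y_def)
  have disj: "A y \<inter> S = {}"
  proof (rule ccontr)
    assume "A y \<inter> S \<noteq> {}"
    then obtain s t where "s \<in> S" "t \<in> S" "s \<odot>\<^bsub>M\<^esub> (t \<odot>\<^bsub>M\<^esub> y) = \<zero>\<^bsub>M\<^esub>" by (auto simp: A_def)
    then have "s \<otimes> t \<in> S" "(s \<otimes> t) \<odot>\<^bsub>M\<^esub> y = \<zero>\<^bsub>M\<^esub>" using S(3) Sc yc by (auto simp: smult_assoc1)
    then show False using y by (auto simp: Y_def)
  qed
  have "a \<in> A y" if ab: "a \<in> carrier R" "b \<in> carrier R" "a \<otimes> b \<in> A y" "b \<notin> A y" for a b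
  proof -
    have "b \<odot>\<^bsub>M\<^esub> y = (b \<otimes> r) \<odot>\<^bsub>M\<^esub> x" using ab r x by (simp add: smult_assoc1)
    moreover have "\<forall>s\<in>S. s \<odot>\<^bsub>M\<^esub> (b \<odot>\<^bsub>M\<^esub> y) \<noteq> \<zero>\<^bsub>M\<^esub>" using ab by (auto simp: A_def)
    ultimately have "b \<odot>\<^bsub>M\<^esub> y \<in> Y" unfolding Y_def using ab r by force
    moreover have "A y \<subseteq> A (b \<odot>\<^bsub>M\<^esub> y)"
    proof
      fix c assume "c \<in> A y"
      then obtain s where c: "c \<in> carrier R" "s \<in> S" "s \<odot>\<^bsub>M\<^esub> (c \<odot>\<^bsub>M\<^esub> y) = \<zero>\<^bsub>M\<^esub>" by (auto simp: A_def)
      have "s \<odot>\<^bsub>M\<^esub> (c \<odot>\<^bsub>M\<^esub> (b \<odot>\<^bsub>M\<^esub> y)) = b \<odot>\<^bsub>M\<^esub> (s \<odot>\<^bsub>M\<^esub> (c \<odot>\<^bsub>M\<^esub> y))"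
        using c(1,2) ab yc Sc by (simp add: module_simps)
      then show "c \<in> A (b \<odot>\<^bsub>M\<^esub> y)" using c ab by (auto simp: A_def)
    qed
    ultimately have "A (b \<odot>\<^bsub>M\<^esub> y) = A y" using max by blast
    moreover have "a \<in> A (b \<odot>\<^bsub>M\<^esub> y)" using ab yc by (auto simp: A_def smult_assoc1)
    ultimately show ?thesis by blast
  qed
  moreover have "\<one> \<notin> A y" using disj S(2) by blast
  ultimately have "A y \<in> Spec R" using idl[OF yc] unfolding Spec_iff by blast
  with disj r show thesis unfolding A_def by (intro that) auto
qed

lemma assoc_prime_exists:
  assumes M: "module R M" and x: "x \<in> carrier M" "x \<noteq> \<zero>\<^bsub>M\<^esub>"
  obtains r where "r \<in> carrier R" "annih R M (r \<odot>\<^bsub>M\<^esub> x) \<in> ass R M"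
proof -
  interpret module R M by fact
  obtain r where r: "r \<in> carrier R"
    "{a \<in> carrier R. \<exists>s\<in>{\<one>}. s \<odot>\<^bsub>M\<^esub> (a \<odot>\<^bsub>M\<^esub> (r \<odot>\<^bsub>M\<^esub> x)) = \<zero>\<^bsub>M\<^esub>} \<in> Spec R"
    using x by (rule_tac prime_annihilator_avoiding[OF M, of "{\<one>}" x]) auto
  have "{a \<in> carrier R. \<exists>s\<in>{\<one>}. s \<odot>\<^bsub>M\<^esub> (a \<odot>\<^bsub>M\<^esub> (r \<odot>\<^bsub>M\<^esub> x)) = \<zero>\<^bsub>M\<^esub>} = annih R M (r \<odot>\<^bsub>M\<^esub> x)"
    using r x by (auto simp: annih_def)
  with r x show thesis by (intro that[of r]) (auto simp: ass_def)
qed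

lemma prime_avoiding:
  assumes S: "S \<subseteq> carrier R" "\<one> \<in> S" "\<And>a b. a \<in> S \<Longrightarrow> b \<in> S \<Longrightarrow> a \<otimes> b \<in> S" "\<zero> \<notin> S"
  obtains P where "P \<in> Spec R" "P \<inter> S = {}"
proof -
  have "s \<odot>\<^bsub>self_module R\<^esub> \<one> \<noteq> \<zero>\<^bsub>self_module R\<^esub>" if "s \<in> S" for s using that S by auto
  with S(1-3) show thesis
    using that by (rule_tac prime_annihilator_avoiding[OF module_self, of S \<one>]) auto
qed

lemma annih_smult_mono:
  assumes M: "module R M" and "x \<in> carrier M" "r \<in> carrier R"
  shows "annih R M x \<subseteq> annih R M (r \<odot>\<^bsub>M\<^esub> x)"
proof -
  interpret module R M by fact
  show ?thesis using assms by (auto simp: annih_def smult_lcomm[of _ r])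
qed

text \<open>The submodule generated by \<open>x\<close> is isomorphic to the domain \<open>R/P\<close>, where \<open>P\<close> is the annihilator of \<open>x\<close>.\<close>

lemma annih_smult_prime:
  assumes M: "module R M" and x: "x \<in> carrier M" "r \<in> carrier R" "annih R M x \<in> Spec R"
    "r \<odot>\<^bsub>M\<^esub> x \<noteq> \<zero>\<^bsub>M\<^esub>"
  shows "annih R M (r \<odot>\<^bsub>M\<^esub> x) = annih R M x"
proof
  interpret module R M by fact
  show "annih R M (r \<odot>\<^bsub>M\<^esub> x) \<subseteq> annih R M x"
  proof
    fix a assume a: "a \<in> annih R M (r \<odot>\<^bsub>M\<^esub> x)"
    then have "a \<otimes> r \<in> annih R M x" using x by (auto simp: annih_def smult_assoc1)
    moreover have "r \<notin> annih R M x" using x by (auto simp: annih_def)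
    ultimately show "a \<in> annih R M x" using x a Spec_mult_iff by (auto simp: annih_def)
  qed
qed (rule annih_smult_mono[OF M x(1,2)])

end

text \<open>This is \<open>(N + R z : s)\<close>, the elements that \<open>s\<close> multiplies into \<open>N + R z\<close>.  It grows when
  \<open>s\<close> is replaced by a multiple.\<close>

definition colon ::
  "('a, 'm) ring_scheme \<Rightarrow> ('a, 'b, 'k) module_scheme \<Rightarrow> 'b set \<Rightarrow> 'b \<Rightarrow> 'a \<Rightarrow> 'b set" where
  "colon R M N z s =
     {m \<in> carrier M. \<exists>a\<in>carrier R. \<exists>n\<in>N. s \<odot>\<^bsub>M\<^esub> m = a \<odot>\<^bsub>M\<^esub> z \<oplus>\<^bsub>M\<^esub> n}"

lemma (in module) submodule_colon:
  assumes N: "submodule N R M" and z: "z \<in> carrier M" and s: "s \<in> carrier R"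
  shows "submodule (colon R M N z s) R M" (is "submodule ?U R M")
  unfolding submodule_iff
proof (intro conjI ballI)
  have Nc: "N \<subseteq> carrier M" using N by (simp add: submodule_iff)
  show "?U \<subseteq> carrier M" by (auto simp: colon_def)
  have "s \<odot>\<^bsub>M\<^esub> \<zero>\<^bsub>M\<^esub> = \<zero> \<odot>\<^bsub>M\<^esub> z \<oplus>\<^bsub>M\<^esub> \<zero>\<^bsub>M\<^esub>" "\<zero>\<^bsub>M\<^esub> \<in> N" using s z N by (auto simp: submodule_iff)
  then show "\<zero>\<^bsub>M\<^esub> \<in> ?U" unfolding colon_def by blast
  fix m assume "m \<in> ?U"
  then obtain a n where m: "m \<in> carrier M" "a \<in> carrier R" "n \<in> N" "s \<odot>\<^bsub>M\<^esub> m = a \<odot>\<^bsub>M\<^esub> z \<oplus>\<^bsub>M\<^esub> n"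
    by (auto simp: colon_def)
  then have nc: "n \<in> carrier M" using Nc by auto
  show "m \<oplus>\<^bsub>M\<^esub> m' \<in> ?U" if "m' \<in> ?U" for m'
  proof -
    obtain a' n' where m': "m' \<in> carrier M" "a' \<in> carrier R" "n' \<in> N"
      "s \<odot>\<^bsub>M\<^esub> m' = a' \<odot>\<^bsub>M\<^esub> z \<oplus>\<^bsub>M\<^esub> n'" using \<open>m' \<in> ?U\<close> by (auto simp: colon_def)
    then have "n' \<in> carrier M" using Nc by auto
    then have "s \<odot>\<^bsub>M\<^esub> (m \<oplus>\<^bsub>M\<^esub> m') = (a \<oplus> a') \<odot>\<^bsub>M\<^esub> z \<oplus>\<^bsub>M\<^esub> (n \<oplus>\<^bsub>M\<^esub> n')"
      using s m m' nc z by (simp add: smult_r_distr) (simp add: module_simps)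
    moreover have "n \<oplus>\<^bsub>M\<^esub> n' \<in> N" using m m' N by (simp add: submodule_iff)
    ultimately show ?thesis unfolding colon_def using m m' by blast
  qed
  show "b \<odot>\<^bsub>M\<^esub> m \<in> ?U" if b: "b \<in> carrier R" for b
  proof -
    have "s \<odot>\<^bsub>M\<^esub> (b \<odot>\<^bsub>M\<^esub> m) = b \<odot>\<^bsub>M\<^esub> (s \<odot>\<^bsub>M\<^esub> m)" using b s m(1) by (simp add: module_simps)
    also have "\<dots> = (b \<otimes> a) \<odot>\<^bsub>M\<^esub> z \<oplus>\<^bsub>M\<^esub> b \<odot>\<^bsub>M\<^esub> n" unfolding m(4) using b m nc z by (simp add: module_simps)
    finally have "s \<odot>\<^bsub>M\<^esub> (b \<odot>\<^bsub>M\<^esub> m) = (b \<otimes> a) \<odot>\<^bsub>M\<^esub> z \<oplus>\<^bsub>M\<^esub> b \<odot>\<^bsub>M\<^esub> n" .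
    moreover have "b \<odot>\<^bsub>M\<^esub> n \<in> N" using b m N by (simp add: submodule_iff)
    ultimately show ?thesis unfolding colon_def using b m by blast
  qed
qed

lemma (in module) colon_mult:
  assumes N: "submodule N R M" and z: "z \<in> carrier M" and st: "s \<in> carrier R" "t \<in> carrier R"
    and m: "m \<in> colon R M N z s"
  shows "m \<in> colon R M N z (t \<otimes> s)"
proof -
  obtain a n where *: "m \<in> carrier M" "a \<in> carrier R" "n \<in> N" "s \<odot>\<^bsub>M\<^esub> m = a \<odot>\<^bsub>M\<^esub> z \<oplus>\<^bsub>M\<^esub> n"
    using m by (auto simp: colon_def)
  have nc: "n \<in> carrier M" using * N by (auto simp: submodule_iff)
  have "(t \<otimes> s) \<odot>\<^bsub>M\<^esub> m = t \<odot>\<^bsub>M\<^esub> (s \<odot>\<^bsub>M\<^esub> m)" using st * by (simp add: smult_assoc1)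
  also have "\<dots> = (t \<otimes> a) \<odot>\<^bsub>M\<^esub> z \<oplus>\<^bsub>M\<^esub> t \<odot>\<^bsub>M\<^esub> n" unfolding *(4) using st * nc z by (simp add: module_simps)
  finally have "(t \<otimes> s) \<odot>\<^bsub>M\<^esub> m = (t \<otimes> a) \<odot>\<^bsub>M\<^esub> z \<oplus>\<^bsub>M\<^esub> t \<odot>\<^bsub>M\<^esub> n" .
  moreover have "t \<odot>\<^bsub>M\<^esub> n \<in> N" "t \<otimes> a \<in> carrier R" using st * N by (simp_all add: submodule_iff)
  ultimately show ?thesis unfolding colon_def using * by blast
qed

context noetherian_cring begin

text \<open>Submodules \<open>N\<close> that are saturated with respect to the complement of \<open>P\<close> correspond to the submodules of
  \<open>M\<^sub>P\<close>.  For a maximal proper one, \<open>M\<^sub>P / N\<^sub>P\<close> is simple, that is, a line over the residue field of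
  \<open>P\<close>: up to \<open>N\<close> and a denominator, all elements are multiples of any \<open>y\<close> outside \<open>N\<close>, and
  \<open>P\<close> multiplies \<open>M\<close> into \<open>N\<close>.  This line is the target of the homomorphisms constructed
  below, and it also plays the part of Nakayama's lemma.\<close>

lemma maximal_saturated_submodule:
  assumes fg: "fg_module R M" and P: "P \<in> supp R M"
  obtains N where "submodule N R M" "N \<noteq> carrier M"
    "\<forall>s\<in>carrier R - P. \<forall>m\<in>carrier M. s \<odot>\<^bsub>M\<^esub> m \<in> N \<longrightarrow> m \<in> N"
    "\<forall>y\<in>carrier M - N. \<forall>m\<in>carrier M.
        \<exists>s\<in>carrier R - P. \<exists>a\<in>carrier R. \<exists>n\<in>N. s \<odot>\<^bsub>M\<^esub> m = a \<odot>\<^bsub>M\<^esub> y \<oplus>\<^bsub>M\<^esub> n"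
    "\<forall>p\<in>P. \<forall>m\<in>carrier M. p \<odot>\<^bsub>M\<^esub> m \<in> N"
proof -
  have M: "module R M" using fg by (simp add: fg_module_def)
  interpret module R M by fact
  have PS: "P \<in> Spec R" using P by (simp add: supp_def)
  have Pc: "P \<subseteq> carrier R" using PS by (rule Spec_subset)
  define F where "F = {N. submodule N R M \<and> N \<noteq> carrier M \<and>
    (\<forall>s\<in>carrier R - P. \<forall>m\<in>carrier M. s \<odot>\<^bsub>M\<^esub> m \<in> N \<longrightarrow> m \<in> N)}"
  \<comment> \<open>the saturation of \<open>N + R z\<close>\<close>
  define Sat where "Sat N z = (\<Union>s\<in>carrier R - P. colon R M N z s)" for N z
  have sat: "submodule (Sat N z) R M \<and> (\<forall>s\<in>carrier R - P. \<forall>m\<in>carrier M. s \<odot>\<^bsub>M\<^esub> m \<in> Sat N z \<longrightarrow> m \<in> Sat N z) \<and>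
    N \<subseteq> Sat N z \<and> z \<in> Sat N z"
    if N: "submodule N R M" and z: "z \<in> carrier M" for N z
  proof (intro conjI ballI impI)
    have N0: "\<zero>\<^bsub>M\<^esub> \<in> N" "N \<subseteq> carrier M" using N by (auto simp: submodule_iff)
    have one: "\<one> \<in> carrier R - P" using PS Spec_one by auto
    have "n \<in> colon R M N z \<one>" if "n \<in> N" for n
    proof -
      have "\<one> \<odot>\<^bsub>M\<^esub> n = \<zero> \<odot>\<^bsub>M\<^esub> z \<oplus>\<^bsub>M\<^esub> n" "n \<in> carrier M" using that N0 z by auto
      then show ?thesis unfolding colon_def using that by blast
    qed
    then show NS: "N \<subseteq> Sat N z" unfolding Sat_def using one by blast
    have "\<one> \<odot>\<^bsub>M\<^esub> z = \<one> \<odot>\<^bsub>M\<^esub> z \<oplus>\<^bsub>M\<^esub> \<zero>\<^bsub>M\<^esub>" using z by auto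
    then have "z \<in> colon R M N z \<one>" unfolding colon_def using z N0 by blast
    then show "z \<in> Sat N z" unfolding Sat_def using one by blast
    show "m \<in> Sat N z" if t: "t \<in> carrier R - P" "m \<in> carrier M" "t \<odot>\<^bsub>M\<^esub> m \<in> Sat N z" for t m
    proof -
      obtain s where s: "s \<in> carrier R - P" "t \<odot>\<^bsub>M\<^esub> m \<in> colon R M N z s"
        using t by (auto simp: Sat_def)
      then have "m \<in> colon R M N z (s \<otimes> t)"
        using t by (simp add: colon_def smult_assoc1)
      moreover have "s \<otimes> t \<in> carrier R - P" using s t PS by (auto simp: Spec_mult_iff)
      ultimately show ?thesis unfolding Sat_def by blast
    qed
    show "submodule (Sat N z) R M" unfolding submodule_iff
    proof (intro conjI ballI)
      show "Sat N z \<subseteq> carrier M" by (auto simp: Sat_def colon_def)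
      show "\<zero>\<^bsub>M\<^esub> \<in> Sat N z" using N0 NS by auto
    next
      fix m m' assume "m \<in> Sat N z" "m' \<in> Sat N z"
      then obtain s s' where *: "s \<in> carrier R - P" "m \<in> colon R M N z s"
        "s' \<in> carrier R - P" "m' \<in> colon R M N z s'" by (auto simp: Sat_def)
      have "m \<in> colon R M N z (s' \<otimes> s)" "m' \<in> colon R M N z (s' \<otimes> s)"
        using * colon_mult[OF N z, of s s' m] colon_mult[OF N z, of s' s m']
        by (simp_all add: m_comm)
      then have "m \<oplus>\<^bsub>M\<^esub> m' \<in> colon R M N z (s' \<otimes> s)"
        using submodule_colon[OF N z, of "s' \<otimes> s"] * by (simp add: submodule_iff)
      moreover have "s' \<otimes> s \<in> carrier R - P" using * PS by (auto simp: Spec_mult_iff)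
      ultimately show "m \<oplus>\<^bsub>M\<^esub> m' \<in> Sat N z" unfolding Sat_def by blast
    next
      fix b m assume b: "b \<in> carrier R" and "m \<in> Sat N z"
      then obtain s where s: "s \<in> carrier R - P" "m \<in> colon R M N z s" by (auto simp: Sat_def)
      then have "b \<odot>\<^bsub>M\<^esub> m \<in> colon R M N z s"
        using submodule_colon[OF N z, of s] b by (simp add: submodule_iff)
      then show "b \<odot>\<^bsub>M\<^esub> m \<in> Sat N z" unfolding Sat_def using s by blast
    qed
  qed
  have triv: "submodule {\<zero>\<^bsub>M\<^esub>} R M" by (auto simp: submodule_iff)
  obtain x where x: "x \<in> carrier M" "annih R M x \<subseteq> P" using P by (auto simp: supp_def)
  have "x \<notin> Sat {\<zero>\<^bsub>M\<^esub>} \<zero>\<^bsub>M\<^esub>" using x by (auto simp: Sat_def colon_def annih_def)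
  then have "Sat {\<zero>\<^bsub>M\<^esub>} \<zero>\<^bsub>M\<^esub> \<in> F" using sat[OF triv M.zero_closed] x by (auto simp: F_def)
  then have "F \<noteq> {}" by blast
  moreover have "N \<in> F \<Longrightarrow> submodule N R M" for N by (simp add: F_def)
  ultimately have "\<exists>N\<in>F. \<forall>L\<in>F. N \<subseteq> L \<longrightarrow> L = N" by (rule maximal_submodule_in_family[OF fg])
  then obtain N where N: "N \<in> F" and max: "\<And>L. L \<in> F \<Longrightarrow> N \<subseteq> L \<Longrightarrow> L = N" by blast
  have Ns: "submodule N R M" "N \<noteq> carrier M" "N \<subseteq> carrier M" using N by (auto simp: F_def submodule_iff)
  have Nsat: "\<forall>s\<in>carrier R - P. \<forall>m\<in>carrier M. s \<odot>\<^bsub>M\<^esub> m \<in> N \<longrightarrow> m \<in> N"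
    using N by (auto simp: F_def)
  have full: "Sat N y = carrier M" if y: "y \<in> carrier M" "y \<notin> N" for y
  proof (rule ccontr)
    assume "Sat N y \<noteq> carrier M"
    then have "Sat N y \<in> F" using sat[OF Ns(1) y(1)] by (auto simp: F_def)
    then have "Sat N y = N" using max sat[OF Ns(1) y(1)] by blast
    then show False using y sat[OF Ns(1) y(1)] by blast
  qed
  show thesis
  proof (rule that[OF Ns(1,2) Nsat]; intro ballI)
    show "\<exists>s\<in>carrier R - P. \<exists>a\<in>carrier R. \<exists>n\<in>N. s \<odot>\<^bsub>M\<^esub> m = a \<odot>\<^bsub>M\<^esub> y \<oplus>\<^bsub>M\<^esub> n"
      if "y \<in> carrier M - N" "m \<in> carrier M" for y m
      using full[of y] that unfolding Sat_def colon_def by blast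
    show "p \<odot>\<^bsub>M\<^esub> m \<in> N" if p: "p \<in> P" and m: "m \<in> carrier M" for p m
    proof (rule ccontr)
      assume nin: "p \<odot>\<^bsub>M\<^esub> m \<notin> N"
      have pc: "p \<in> carrier R" using p Pc by auto
      \<comment> \<open>Otherwise \<open>p \<odot> m\<close> generates the whole line together with \<open>N\<close>, so \<open>(s - a p) \<odot> m\<close> lies
        in \<open>N\<close> for some \<open>s \<notin> P\<close>; but then \<open>s - a p \<notin> P\<close> and saturation yields \<open>m \<in> N\<close>.\<close>
      have "m \<in> Sat N (p \<odot>\<^bsub>M\<^esub> m)" using full[OF _ nin] pc m by simp
      then obtain s a n where *: "s \<in> carrier R" "s \<notin> P" "a \<in> carrier R" "n \<in> N"
        "s \<odot>\<^bsub>M\<^esub> m = a \<odot>\<^bsub>M\<^esub> (p \<odot>\<^bsub>M\<^esub> m) \<oplus>\<^bsub>M\<^esub> n" by (auto simp: Sat_def colon_def)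
      have nc: "n \<in> carrier M" using * Ns by auto
      define t where "t = s \<ominus> a \<otimes> p"
      have tc: "t \<in> carrier R" using * pc by (simp add: t_def)
      have ts: "t \<oplus> a \<otimes> p = s" using * pc by (simp add: t_def minus_add_cancel)
      have ap: "a \<otimes> p \<in> P" using p * PS by (simp add: Spec_mult_iff pc)
      have "t \<notin> P"
      proof
        assume "t \<in> P"
        then have "t \<oplus> a \<otimes> p \<in> P" using ap Spec_ideal[OF PS] by (simp add: ideal_iff)
        then show False using ts * by simp
      qed
      have "t \<odot>\<^bsub>M\<^esub> m \<oplus>\<^bsub>M\<^esub> a \<odot>\<^bsub>M\<^esub> (p \<odot>\<^bsub>M\<^esub> m) = (t \<oplus> a \<otimes> p) \<odot>\<^bsub>M\<^esub> m"
        using tc * pc m by (simp add: module_simps)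
      also have "\<dots> = n \<oplus>\<^bsub>M\<^esub> a \<odot>\<^bsub>M\<^esub> (p \<odot>\<^bsub>M\<^esub> m)" unfolding ts using * pc m nc by (simp add: M.a_comm)
      finally have "t \<odot>\<^bsub>M\<^esub> m = n" using tc * pc m nc by simp
      then have "m \<in> N" using Nsat tc \<open>t \<notin> P\<close> m * by simp
      then have "p \<odot>\<^bsub>M\<^esub> m \<in> N" using Ns pc by (simp add: submodule_iff)
      then show False using nin by simp
    qed
  qed
qed

section \<open>Vanishing of homomorphisms\<close>

lemma module_hom_zero:
  assumes "module R M" "module R N" "f \<in> module_hom R M N"
  shows "f \<zero>\<^bsub>M\<^esub> = \<zero>\<^bsub>N\<^esub>"
proof -
  interpret M: module R M by fact
  interpret N: module R N by fact
  have z: "f \<zero>\<^bsub>M\<^esub> \<in> carrier N" using assms(3) by (auto simp: module_hom_def)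
  have "f \<zero>\<^bsub>M\<^esub> = f (\<zero> \<odot>\<^bsub>M\<^esub> \<zero>\<^bsub>M\<^esub>)" by simp
  also have "\<dots> = \<zero> \<odot>\<^bsub>N\<^esub> f \<zero>\<^bsub>M\<^esub>" using assms(3) by (simp add: module_hom_def del: M.smult_l_null M.smult_r_null)
  finally show ?thesis using z by simp
qed

text \<open>Map \<open>M\<close> to its line over the residue field of \<open>P\<close> given by \<open>maximal_saturated_submodule\<close>.
  Finitely many generators have a common denominator \<open>s\<close>, and multiplying by \<open>s\<close> moves the image into a copy of
  \<open>R/P\<close>, which \<open>N\<close> contains as the submodule generated by an element \<open>e\<close> with annihilator \<open>P\<close>.
  In terms of elements, \<open>m\<close> goes to \<open>a \<odot> e\<close> if \<open>s \<odot> m\<close> equals \<open>a \<odot> y\<close> modulo the saturated submodule.\<close>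

lemma exists_nonzero_hom:
  assumes fg: "fg_module R M" and N: "module R N" and P: "P \<in> supp R M" "P \<in> ass R N"
  shows "\<not> Hom_zero R M N"
proof -
  have M: "module R M" using fg by (simp add: fg_module_def)
  interpret module R M by fact
  interpret N: module R N by fact
  have PS: "P \<in> Spec R" using P by (simp add: supp_def)
  obtain e where e: "e \<in> carrier N" "P = annih R N e" using P by (auto simp: ass_def)
  obtain K where K: "submodule K R M" "K \<noteq> carrier M"
    and sat: "\<forall>s\<in>carrier R - P. \<forall>m\<in>carrier M. s \<odot>\<^bsub>M\<^esub> m \<in> K \<longrightarrow> m \<in> K"
    and rank: "\<forall>y\<in>carrier M - K. \<forall>m\<in>carrier M.
        \<exists>s\<in>carrier R - P. \<exists>a\<in>carrier R. \<exists>n\<in>K. s \<odot>\<^bsub>M\<^esub> m = a \<odot>\<^bsub>M\<^esub> y \<oplus>\<^bsub>M\<^esub> n"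
    by (rule maximal_saturated_submodule[OF fg P(1)])
  have Kc: "K \<subseteq> carrier M" using K by (simp add: submodule_iff)
  then obtain y where y: "y \<in> carrier M" "y \<notin> K" using K(2) by blast
  define U where "U = colon R M K y"
  note U_def' = U_def colon_def
  have Usub: "submodule (U s) R M" if "s \<in> carrier R" for s
    using submodule_colon[OF K(1) y(1) that] by (simp add: U_def)
  have Umult: "m \<in> U (t \<otimes> s)" if "m \<in> U s" "s \<in> carrier R" "t \<in> carrier R" for m s t
    using colon_mult[OF K(1) y(1)] that by (simp add: U_def)
  obtain G where G: "G \<subseteq> carrier M" "finite G" "\<forall>L. submodule L R M \<longrightarrow> G \<subseteq> L \<longrightarrow> L = carrier M"
    using fg unfolding fg_module_iff by blast
  have "\<exists>s\<in>carrier R - P. G \<subseteq> U s"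
    using G(2,1)
  proof (induction G)
    case empty
    have "\<one> \<in> carrier R - P" using PS Spec_one by auto
    then show ?case by blast
  next
    case (insert g G)
    then obtain s where s: "s \<in> carrier R - P" "G \<subseteq> U s" by auto
    obtain t where t: "t \<in> carrier R - P" "g \<in> U t"
    proof -
      have "g \<in> carrier M" "y \<in> carrier M - K" using y insert.prems by auto
      with rank have "\<exists>t\<in>carrier R - P. \<exists>a\<in>carrier R. \<exists>n\<in>K. t \<odot>\<^bsub>M\<^esub> g = a \<odot>\<^bsub>M\<^esub> y \<oplus>\<^bsub>M\<^esub> n" by blast
      then show thesis using that \<open>g \<in> carrier M\<close> by (auto simp: U_def')
    qed
    have "insert g G \<subseteq> U (t \<otimes> s)"
    proof
      fix h assume "h \<in> insert g G"
      then consider "h \<in> U s" | "h \<in> U t" using s t by blast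
      then show "h \<in> U (t \<otimes> s)"
      proof cases
        case 1
        then show ?thesis using Umult[of h s t] s t by simp
      next
        case 2
        then show ?thesis using Umult[of h t s] s t by (simp add: m_comm)
      qed
    qed
    moreover have "t \<otimes> s \<in> carrier R - P" using s t PS by (auto simp: Spec_mult_iff)
    ultimately show ?case by blast
  qed
  then obtain s where s: "s \<in> carrier R" "s \<notin> P" "G \<subseteq> U s" by blast
  then have Us: "U s = carrier M" using G(3) Usub by blast
  define f where "f m = (SOME a. a \<in> carrier R \<and> (\<exists>n\<in>K. s \<odot>\<^bsub>M\<^esub> m = a \<odot>\<^bsub>M\<^esub> y \<oplus>\<^bsub>M\<^esub> n)) \<odot>\<^bsub>N\<^esub> e" for m
  have val: "f m = a \<odot>\<^bsub>N\<^esub> e"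
    if a: "a \<in> carrier R" "n \<in> K" "s \<odot>\<^bsub>M\<^esub> m = a \<odot>\<^bsub>M\<^esub> y \<oplus>\<^bsub>M\<^esub> n" for m a n
  proof -
    define b where "b = (SOME a. a \<in> carrier R \<and> (\<exists>n\<in>K. s \<odot>\<^bsub>M\<^esub> m = a \<odot>\<^bsub>M\<^esub> y \<oplus>\<^bsub>M\<^esub> n))"
    have "b \<in> carrier R \<and> (\<exists>n\<in>K. s \<odot>\<^bsub>M\<^esub> m = b \<odot>\<^bsub>M\<^esub> y \<oplus>\<^bsub>M\<^esub> n)"
      unfolding b_def by (rule someI[of _ a]) (use a in blast)
    then obtain n' where b: "b \<in> carrier R" "n' \<in> K" "s \<odot>\<^bsub>M\<^esub> m = b \<odot>\<^bsub>M\<^esub> y \<oplus>\<^bsub>M\<^esub> n'" by blast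
    have nc: "n \<in> carrier M" "n' \<in> carrier M" using a b Kc by auto
    define c where "c = b \<ominus> a"
    have c: "c \<in> carrier R" "c \<oplus> a = b" using a b by (auto simp: c_def minus_add_cancel)
    have "a \<odot>\<^bsub>M\<^esub> y \<oplus>\<^bsub>M\<^esub> (c \<odot>\<^bsub>M\<^esub> y \<oplus>\<^bsub>M\<^esub> n') = (c \<oplus> a) \<odot>\<^bsub>M\<^esub> y \<oplus>\<^bsub>M\<^esub> n'"
      using a(1) c(1) y nc by (simp add: module_simps)
    also have "\<dots> = a \<odot>\<^bsub>M\<^esub> y \<oplus>\<^bsub>M\<^esub> n" using a b c by simp
    finally have "c \<odot>\<^bsub>M\<^esub> y \<oplus>\<^bsub>M\<^esub> n' = n" using a c y nc by simp
    then have "c \<odot>\<^bsub>M\<^esub> y \<in> K" using submodule_cancel[OF K(1), of "c \<odot>\<^bsub>M\<^esub> y" n'] a b c y by simp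
    then have "c \<in> P" using sat c(1) y by blast
    \<comment> \<open>two admissible coefficients differ by an element of \<open>P\<close>, which kills \<open>e\<close>\<close>
    then have "c \<odot>\<^bsub>N\<^esub> e = \<zero>\<^bsub>N\<^esub>" using e by (auto simp: annih_def)
    then have "b \<odot>\<^bsub>N\<^esub> e = a \<odot>\<^bsub>N\<^esub> e" using c a e by (simp flip: c(2) add: N.smult_l_distr)
    then show ?thesis by (simp add: f_def b_def)
  qed
  have ex: "\<exists>a\<in>carrier R. \<exists>n\<in>K. s \<odot>\<^bsub>M\<^esub> m = a \<odot>\<^bsub>M\<^esub> y \<oplus>\<^bsub>M\<^esub> n" if "m \<in> carrier M" for m
  proof -
    have "m \<in> U s" using that Us by simp
    then show ?thesis by (simp add: U_def')
  qed
  have hom: "f \<in> module_hom R M N" unfolding module_hom_def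
  proof (intro CollectI conjI ballI Pi_I)
    fix m assume "m \<in> carrier M"
    then obtain a n where "a \<in> carrier R" "n \<in> K" "s \<odot>\<^bsub>M\<^esub> m = a \<odot>\<^bsub>M\<^esub> y \<oplus>\<^bsub>M\<^esub> n" using ex by blast
    then show "f m \<in> carrier N" using val e(1) by (metis N.smult_closed)
  next
    fix m m' assume m: "m \<in> carrier M" "m' \<in> carrier M"
    obtain a n where *: "a \<in> carrier R" "n \<in> K" "s \<odot>\<^bsub>M\<^esub> m = a \<odot>\<^bsub>M\<^esub> y \<oplus>\<^bsub>M\<^esub> n" using ex m by blast
    obtain a' n' where **: "a' \<in> carrier R" "n' \<in> K" "s \<odot>\<^bsub>M\<^esub> m' = a' \<odot>\<^bsub>M\<^esub> y \<oplus>\<^bsub>M\<^esub> n'" using ex m by blast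
    have nc: "n \<in> carrier M" "n' \<in> carrier M" using * ** Kc by auto
    have "s \<odot>\<^bsub>M\<^esub> (m \<oplus>\<^bsub>M\<^esub> m') = (a \<oplus> a') \<odot>\<^bsub>M\<^esub> y \<oplus>\<^bsub>M\<^esub> (n \<oplus>\<^bsub>M\<^esub> n')"
      using s * ** nc y m by (simp add: smult_r_distr) (simp add: module_simps)
    moreover have "n \<oplus>\<^bsub>M\<^esub> n' \<in> K" using * ** K by (simp add: submodule_iff)
    ultimately have "f (m \<oplus>\<^bsub>M\<^esub> m') = (a \<oplus> a') \<odot>\<^bsub>N\<^esub> e" using * ** by (intro val) auto
    then show "f (m \<oplus>\<^bsub>M\<^esub> m') = f m \<oplus>\<^bsub>N\<^esub> f m'"
      using val[OF *] val[OF **] * ** e by (simp add: N.smult_l_distr)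
  next
    fix b m assume b: "b \<in> carrier R" and m: "m \<in> carrier M"
    obtain a n where *: "a \<in> carrier R" "n \<in> K" "s \<odot>\<^bsub>M\<^esub> m = a \<odot>\<^bsub>M\<^esub> y \<oplus>\<^bsub>M\<^esub> n" using ex m by blast
    have nc: "n \<in> carrier M" using * Kc by auto
    have "s \<odot>\<^bsub>M\<^esub> (b \<odot>\<^bsub>M\<^esub> m) = b \<odot>\<^bsub>M\<^esub> (s \<odot>\<^bsub>M\<^esub> m)" using b s m by (simp add: module_simps)
    also have "\<dots> = (b \<otimes> a) \<odot>\<^bsub>M\<^esub> y \<oplus>\<^bsub>M\<^esub> b \<odot>\<^bsub>M\<^esub> n" unfolding * using b * nc y by (simp add: module_simps)
    finally have "s \<odot>\<^bsub>M\<^esub> (b \<odot>\<^bsub>M\<^esub> m) = (b \<otimes> a) \<odot>\<^bsub>M\<^esub> y \<oplus>\<^bsub>M\<^esub> b \<odot>\<^bsub>M\<^esub> n" .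
    moreover have "b \<odot>\<^bsub>M\<^esub> n \<in> K" using b * K by (simp add: submodule_iff)
    ultimately have "f (b \<odot>\<^bsub>M\<^esub> m) = (b \<otimes> a) \<odot>\<^bsub>N\<^esub> e" using b * by (intro val) auto
    then show "f (b \<odot>\<^bsub>M\<^esub> m) = b \<odot>\<^bsub>N\<^esub> f m" using val[OF *] * b e by (simp add: N.smult_assoc1)
  qed
  have "s \<odot>\<^bsub>M\<^esub> y = s \<odot>\<^bsub>M\<^esub> y \<oplus>\<^bsub>M\<^esub> \<zero>\<^bsub>M\<^esub>" "\<zero>\<^bsub>M\<^esub> \<in> K" using s y K by (auto simp: submodule_iff)
  then have "f y = s \<odot>\<^bsub>N\<^esub> e" using s val by blast
  moreover have "s \<odot>\<^bsub>N\<^esub> e \<noteq> \<zero>\<^bsub>N\<^esub>" using s e by (auto simp: annih_def)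
  ultimately show ?thesis using hom y unfolding Hom_zero_def by metis
qed

text \<open>Conversely, a nonzero value \<open>f x\<close> has a multiple whose annihilator is an associated prime of \<open>N\<close>, and this
  prime contains the annihilator of the corresponding multiple of \<open>x\<close>.\<close>

lemma Hom_zero_iff:
  assumes fg: "fg_module R M" and N: "module R N"
  shows "Hom_zero R M N \<longleftrightarrow> supp R M \<inter> ass R N = {}"
proof
  assume "Hom_zero R M N"
  then show "supp R M \<inter> ass R N = {}" using exists_nonzero_hom[OF fg N] by blast
next
  have M: "module R M" using fg by (simp add: fg_module_def)
  interpret M: module R M by fact
  assume disj: "supp R M \<inter> ass R N = {}"
  show "Hom_zero R M N"
    unfolding Hom_zero_def
  proof (intro ballI, rule ccontr)
    fix f x assume f: "f \<in> module_hom R M N" and x: "x \<in> carrier M" "f x \<noteq> \<zero>\<^bsub>N\<^esub>"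
    then have fx: "f x \<in> carrier N" by (auto simp: module_hom_def)
    obtain r where r: "r \<in> carrier R" "annih R N (r \<odot>\<^bsub>N\<^esub> f x) \<in> ass R N"
      using assoc_prime_exists[OF N fx x(2)] .
    have "annih R M (r \<odot>\<^bsub>M\<^esub> x) \<subseteq> annih R N (r \<odot>\<^bsub>N\<^esub> f x)"
    proof
      fix a assume a: "a \<in> annih R M (r \<odot>\<^bsub>M\<^esub> x)"
      then have ac: "a \<in> carrier R" "a \<odot>\<^bsub>M\<^esub> (r \<odot>\<^bsub>M\<^esub> x) = \<zero>\<^bsub>M\<^esub>" by (auto simp: annih_def)
      have "a \<odot>\<^bsub>N\<^esub> (r \<odot>\<^bsub>N\<^esub> f x) = f (a \<odot>\<^bsub>M\<^esub> (r \<odot>\<^bsub>M\<^esub> x))"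
        using f x(1) r(1) ac(1) by (simp add: module_hom_def)
      also have "\<dots> = \<zero>\<^bsub>N\<^esub>" using ac module_hom_zero[OF M N f] by simp
      finally show "a \<in> annih R N (r \<odot>\<^bsub>N\<^esub> f x)" using a by (simp add: annih_def)
    qed
    then have "annih R N (r \<odot>\<^bsub>N\<^esub> f x) \<in> supp R M" using r x by (auto simp: supp_def ass_def)
    then show False using r disj by blast
  qed
qed

end

section \<open>Quotients and exact sequences\<close>

definition quot_module :: "('a, 'm) ring_scheme \<Rightarrow> ('a, 'b, 'k) module_scheme \<Rightarrow> 'b set \<Rightarrow> ('a, 'b set) module"
  where "quot_module R M N = \<lparr>carrier = (\<lambda>x. N +>\<^bsub>M\<^esub> x) ` carrier M, mult = undefined, one = undefined,
    zero = N, add = (\<lambda>X Y. X <+>\<^bsub>M\<^esub> Y), smult = (\<lambda>a X. \<Union>x\<in>X. N +>\<^bsub>M\<^esub> (a \<odot>\<^bsub>M\<^esub> x))\<rparr>"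

lemma (in module) quot_module:
  assumes N: "submodule N R M"
  shows "module R (quot_module R M N)"
    and "(\<lambda>x. N +>\<^bsub>M\<^esub> x) \<in> module_hom R M (quot_module R M N)"
    and "x \<in> carrier M \<Longrightarrow> N +>\<^bsub>M\<^esub> x = \<zero>\<^bsub>quot_module R M N\<^esub> \<longleftrightarrow> x \<in> N"
proof -
  interpret N: abelian_subgroup N M
    using submodule.axioms(1)[OF N] by (intro abelian_subgroupI3 additive_subgroupI M.abelian_group_axioms)
  have Nc: "n \<in> carrier M" if "n \<in> N" for n using that N by (auto simp: submodule_iff)
  define q where "q x = N +>\<^bsub>M\<^esub> x" for x
  define Q where "Q = quot_module R M N"
  have car: "carrier Q = q ` carrier M" and zero: "\<zero>\<^bsub>Q\<^esub> = N"
    by (auto simp: Q_def quot_module_def q_def)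
  have q0: "q \<zero>\<^bsub>M\<^esub> = N" unfolding q_def using N by (intro N.a_rcos_const) (simp add: submodule_iff)
  have add: "q x \<oplus>\<^bsub>Q\<^esub> q y = q (x \<oplus>\<^bsub>M\<^esub> y)" if "x \<in> carrier M" "y \<in> carrier M" for x y
    using that by (simp add: Q_def quot_module_def q_def N.a_rcos_sum)
  have qn: "q (n \<oplus>\<^bsub>M\<^esub> x) = q x" if "n \<in> N" "x \<in> carrier M" for n x
    unfolding q_def using that Nc N.a_subset
    by (metis M.a_coset_add_assoc N.a_rcos_const)
  have smult: "a \<odot>\<^bsub>Q\<^esub> q x = q (a \<odot>\<^bsub>M\<^esub> x)" if "a \<in> carrier R" "x \<in> carrier M" for a x
  proof -
    have "q (a \<odot>\<^bsub>M\<^esub> y) = q (a \<odot>\<^bsub>M\<^esub> x)" if y: "y \<in> q x" for y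
    proof -
      obtain n where n: "n \<in> N" "y = n \<oplus>\<^bsub>M\<^esub> x" using y by (auto simp: q_def a_r_coset_def')
      have "a \<odot>\<^bsub>M\<^esub> y = a \<odot>\<^bsub>M\<^esub> n \<oplus>\<^bsub>M\<^esub> a \<odot>\<^bsub>M\<^esub> x"
        using n Nc \<open>a \<in> carrier R\<close> \<open>x \<in> carrier M\<close> by (simp add: smult_r_distr)
      then show ?thesis using qn n N \<open>a \<in> carrier R\<close> \<open>x \<in> carrier M\<close> by (simp add: submodule_iff)
    qed
    moreover have "x \<in> q x" unfolding q_def using that by (intro N.a_rcos_self)
    ultimately have "(\<Union>y\<in>q x. q (a \<odot>\<^bsub>M\<^esub> y)) = q (a \<odot>\<^bsub>M\<^esub> x)" by (intro UN_constant_eq ballI)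
    then show ?thesis by (simp add: Q_def quot_module_def q_def)
  qed
  have ab: "abelian_group Q"
  proof (rule abelian_groupI)
    show "\<exists>Y\<in>carrier Q. Y \<oplus>\<^bsub>Q\<^esub> X = \<zero>\<^bsub>Q\<^esub>" if X: "X \<in> carrier Q" for X
    proof -
      obtain x where x: "x \<in> carrier M" "X = q x" using X by (auto simp: car)
      then show ?thesis
        by (intro bexI[of _ "q (\<ominus>\<^bsub>M\<^esub> x)"]) (simp_all add: add q0 zero M.l_neg car)
    qed
    show "\<zero>\<^bsub>Q\<^esub> \<oplus>\<^bsub>Q\<^esub> X = X" if "X \<in> carrier Q" for X
    proof -
      obtain x where x: "x \<in> carrier M" "X = q x" using \<open>X \<in> carrier Q\<close> by (auto simp: car)
      then show ?thesis using add[of "\<zero>\<^bsub>M\<^esub>" x] by (simp add: zero q0)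
    qed
    show "\<zero>\<^bsub>Q\<^esub> \<in> carrier Q" unfolding car zero q0[symmetric] by blast
  qed (auto simp: car add M.a_ac)
  have "module R Q"
    by (rule moduleI[OF is_cring ab])
      (auto simp: car add smult smult_l_distr smult_r_distr smult_assoc1)
  then show "module R (quot_module R M N)" by (simp add: Q_def)
  have "q \<in> module_hom R M Q" by (auto simp: module_hom_def car add smult)
  moreover have "q = (\<lambda>x. N +>\<^bsub>M\<^esub> x)" by (simp add: q_def fun_eq_iff)
  ultimately show "(\<lambda>x. N +>\<^bsub>M\<^esub> x) \<in> module_hom R M (quot_module R M N)" by (simp add: Q_def)
  show "x \<in> carrier M \<Longrightarrow> N +>\<^bsub>M\<^esub> x = \<zero>\<^bsub>quot_module R M N\<^esub> \<longleftrightarrow> x \<in> N"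
    using N.a_rcos_const N.a_rcos_self zero unfolding Q_def by metis
qed

lemma carrier_quot_module: "carrier (quot_module R M N) = (\<lambda>x. N +>\<^bsub>M\<^esub> x) ` carrier M"
  by (simp add: quot_module_def)

lemma module_homD:
  assumes "f \<in> module_hom R M N"
  shows "x \<in> carrier M \<Longrightarrow> f x \<in> carrier N"
    and "x \<in> carrier M \<Longrightarrow> y \<in> carrier M \<Longrightarrow> f (x \<oplus>\<^bsub>M\<^esub> y) = f x \<oplus>\<^bsub>N\<^esub> f y"
    and "a \<in> carrier R \<Longrightarrow> x \<in> carrier M \<Longrightarrow> f (a \<odot>\<^bsub>M\<^esub> x) = a \<odot>\<^bsub>N\<^esub> f x"
  using assms by (auto simp: module_hom_def)

lemma module_hom_comp:
  assumes "f \<in> module_hom R L M" "g \<in> module_hom R M N"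
  shows "g \<circ> f \<in> module_hom R L N"
  using assms by (auto simp: module_hom_def Pi_def)

lemma weak_torsion_pairs_iff:
  "(T, F) \<in> weak_torsion_pairs R C \<longleftrightarrow> (T, F) \<in> subcategory_pairs R C \<and>
     T = {X \<in> C. \<forall>Y\<in>F. Hom_zero R X Y} \<and> F = {X \<in> C. \<forall>Y\<in>T. Hom_zero R Y X}"
  unfolding weak_torsion_pairs_def mem_Collect_eq prod.case by (rule refl)

context noetherian_cring begin

lemma fg_imageI:
  assumes fg: "fg_module R M" and N: "module R N" and g: "g \<in> module_hom R M N"
    and surj: "g ` carrier M = carrier N"
  shows "fg_module R N"
proof -
  have M: "module R M" using fg by (simp add: fg_module_def)
  interpret M: module R M by fact
  interpret N: module R N by fact
  note hom = module_homD[OF g]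
  obtain G where G: "G \<subseteq> carrier M" "finite G" "\<forall>L. submodule L R M \<longrightarrow> G \<subseteq> L \<longrightarrow> L = carrier M"
    using fg unfolding M.fg_module_iff by blast
  have "L = carrier N" if L: "submodule L R N" "g ` G \<subseteq> L" for L
  proof -
    have "submodule {x \<in> carrier M. g x \<in> L} R M"
      using L(1) module_hom_zero[OF M N g] unfolding M.submodule_iff N.submodule_iff by (auto simp: hom)
    moreover have "G \<subseteq> {x \<in> carrier M. g x \<in> L}" using G L by auto
    ultimately have "{x \<in> carrier M. g x \<in> L} = carrier M" using G(3) by blast
    then have "g ` carrier M \<subseteq> L" by blast
    then have "carrier N \<subseteq> L" using surj by simp
    then show ?thesis using L(1) by (auto simp: N.submodule_iff)
  qed
  then show ?thesis unfolding N.fg_module_iff using G(1,2) surj by (intro exI[of _ "g ` G"]) blast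
qed

lemma annih_hom:
  assumes "module R M" "module R N" "f \<in> module_hom R M N" "x \<in> carrier M"
  shows "annih R M x \<subseteq> annih R N (f x)"
proof
  fix a assume "a \<in> annih R M x"
  then have a: "a \<in> carrier R" "a \<odot>\<^bsub>M\<^esub> x = \<zero>\<^bsub>M\<^esub>" by (auto simp: annih_def)
  have "a \<odot>\<^bsub>N\<^esub> f x = f (a \<odot>\<^bsub>M\<^esub> x)" using module_homD(3)[OF assms(3) a(1) assms(4)] by simp
  also have "\<dots> = \<zero>\<^bsub>N\<^esub>" using a module_hom_zero[OF assms(1-3)] by simp
  finally show "a \<in> annih R N (f x)" using a by (simp add: annih_def)
qed

lemma annih_inj_hom:
  assumes M: "module R M" and N: "module R N" and f: "f \<in> module_hom R M N" and x: "x \<in> carrier M"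
    and inj: "inj_on f (carrier M)"
  shows "annih R N (f x) = annih R M x"
proof
  interpret M: module R M by fact
  show "annih R N (f x) \<subseteq> annih R M x"
  proof
    fix a assume a: "a \<in> annih R N (f x)"
    then have "f (a \<odot>\<^bsub>M\<^esub> x) = f \<zero>\<^bsub>M\<^esub>"
      using module_homD[OF f] x module_hom_zero[OF M N f] by (simp add: annih_def)
    then show "a \<in> annih R M x" using a x inj_onD[OF inj] by (auto simp: annih_def)
  qed
qed (rule annih_hom[OF M N f x])

lemma ass_inj_hom:
  assumes "module R M" "module R N" "f \<in> module_hom R M N" "inj_on f (carrier M)"
  shows "ass R M \<subseteq> ass R N"
proof -
  have "f x \<in> carrier N \<and> annih R N (f x) = annih R M x" if "x \<in> carrier M" for x
    using that module_homD(1)[OF assms(3)] annih_inj_hom[OF assms(1-3) _ assms(4)] by blast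
  then show ?thesis unfolding ass_def by fastforce
qed

lemma ass_supp_iso:
  assumes M: "module R M" "module R N" and iso: "module_isomorphic R M N"
  shows "ass R N = ass R M" and "supp R N = supp R M"
proof -
  obtain f where f: "f \<in> module_hom R M N" "inj_on f (carrier M)" "f ` carrier M = carrier N"
    using iso by (auto simp: module_isomorphic_def bij_betw_def)
  have an: "annih R N (f x) = annih R M x" if "x \<in> carrier M" for x
    using annih_inj_hom[OF M f(1) that f(2)] .
  show "ass R N = ass R M" "supp R N = supp R M"
    unfolding ass_def supp_def f(3)[symmetric] using an by auto
qed

text \<open>Let \<open>x\<close> have the prime annihilator \<open>P\<close>, so that \<open>R x \<cong> R/P\<close>.  Either \<open>R x\<close> meets the image of
  \<open>L\<close>, and every nonzero element there still has annihilator \<open>P\<close>, or \<open>R x\<close> embeds into \<open>N\<close>.\<close>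

lemma ass_short_exact:
  assumes L: "module R L" and M: "module R M" and N: "module R N" and e: "short_exact R L f M g N"
  shows "ass R M \<subseteq> ass R L \<union> ass R N"
proof
  fix P assume P: "P \<in> ass R M"
  interpret M: module R M by fact
  interpret N: module R N by fact
  have f: "f \<in> module_hom R L M" "inj_on f (carrier L)" and g: "g \<in> module_hom R M N"
    and ex: "f ` carrier L = {x \<in> carrier M. g x = \<zero>\<^bsub>N\<^esub>}"
    using e by (auto simp: short_exact_def)
  obtain x where x: "x \<in> carrier M" "P = annih R M x" and PS: "P \<in> Spec R"
    using P by (auto simp: ass_def)
  have gx: "g x \<in> carrier N" using module_homD(1)[OF g x(1)] .
  show "P \<in> ass R L \<union> ass R N"
  proof (cases "\<exists>r\<in>carrier R. r \<odot>\<^bsub>M\<^esub> x \<in> f ` carrier L \<and> r \<odot>\<^bsub>M\<^esub> x \<noteq> \<zero>\<^bsub>M\<^esub>")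
    case True
    then obtain r y where r: "r \<in> carrier R" "y \<in> carrier L" "r \<odot>\<^bsub>M\<^esub> x = f y" "r \<odot>\<^bsub>M\<^esub> x \<noteq> \<zero>\<^bsub>M\<^esub>" by auto
    have "annih R L y = annih R M (r \<odot>\<^bsub>M\<^esub> x)"
      using annih_inj_hom[OF L M f(1) r(2) f(2)] r(3) by simp
    also have "\<dots> = P" using annih_smult_prime[OF M x(1) r(1)] x PS r(4) by simp
    finally show ?thesis using r PS by (auto simp: ass_def)
  next
    case False
    have "annih R N (g x) \<subseteq> annih R M x"
    proof
      fix a assume a: "a \<in> annih R N (g x)"
      then have ac: "a \<in> carrier R" by (simp add: annih_def)
      have "g (a \<odot>\<^bsub>M\<^esub> x) = \<zero>\<^bsub>N\<^esub>" using a module_homD(3)[OF g] x by (simp add: annih_def)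
      then have "a \<odot>\<^bsub>M\<^esub> x \<in> f ` carrier L" using ex ac x by simp
      then show "a \<in> annih R M x" using False ac by (auto simp: annih_def)
    qed
    then have "annih R N (g x) = P" using annih_hom[OF M N g x(1)] x by blast
    then show ?thesis using gx PS by (auto simp: ass_def)
  qed
qed

lemma annih_restrict [simp]: "annih R (M\<lparr>carrier := N\<rparr>) x = annih R M x"
  by (simp add: annih_def)

lemma inclusion_hom: "N \<subseteq> carrier M \<Longrightarrow> (\<lambda>x. x) \<in> module_hom R (M\<lparr>carrier := N\<rparr>) M"
  by (auto simp: module_hom_def)

lemma mod_catD: "X \<in> mod_cat R \<Longrightarrow> fg_module R X" "X \<in> mod_cat R \<Longrightarrow> module R X"
  by (auto simp: mod_cat_def fg_module_def)

text \<open>The module \<open>R/P\<close>, moved to the carrier type of \<open>mod_cat\<close>.  It is the test object that recovers a set of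
  primes from the classes of modules defined by it.\<close>

lemma residue_module_exists:
  assumes P: "P \<in> Spec R"
  obtains X where "X \<in> mod_cat R" "ass R X = {P}" "supp R X = {Q \<in> Spec R. P \<subseteq> Q}"
    "X \<in> annihilated_by (mod_cat R) P"
proof -
  interpret S: module R "self_module R" by (rule module_self)
  have sub: "submodule P R (self_module R)" using P Spec_ideal by (simp add: submodule_self_iff)
  define Q where "Q = quot_module R (self_module R) P"
  define q where "q = (\<lambda>x. P +>\<^bsub>self_module R\<^esub> x)"
  have Q: "module R Q" and q: "q \<in> module_hom R (self_module R) Q"
    and q0: "\<And>x. x \<in> carrier R \<Longrightarrow> q x = \<zero>\<^bsub>Q\<^esub> \<longleftrightarrow> x \<in> P" and car: "carrier Q = q ` carrier R"
    using S.quot_module[OF sub] by (auto simp: Q_def q_def carrier_quot_module)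
  have fg: "fg_module R Q" using fg_imageI[OF fg_module_self Q q] car by simp
  have an: "annih R Q (q r) = (if r \<in> P then carrier R else P)" if r: "r \<in> carrier R" for r
  proof -
    have "annih R Q (q r) = {a \<in> carrier R. a \<otimes> r \<in> P}"
    proof -
      have "a \<odot>\<^bsub>Q\<^esub> q r = \<zero>\<^bsub>Q\<^esub> \<longleftrightarrow> a \<otimes> r \<in> P" if "a \<in> carrier R" for a
        using module_homD(3)[OF q that, of r] q0[of "a \<otimes> r"] r that by simp
      then show ?thesis by (auto simp: annih_def)
    qed
    also have "\<dots> = (if r \<in> P then carrier R else P)"
      using P r Spec_subset[OF P] by (auto simp: Spec_mult_iff)
    finally show ?thesis .
  qed
  have ne: "Q' \<in> Spec R \<Longrightarrow> \<not> carrier R \<subseteq> Q'" for Q' using Spec_one by blast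
  have one: "annih R Q (q \<one>) = P" using an Spec_one[OF P] by simp
  have "ass R Q \<subseteq> {P}" using an ne by (auto simp: ass_def car split: if_splits)
  moreover have "P \<in> ass R Q" unfolding ass_def car using P one by auto
  moreover have "supp R Q \<subseteq> {Q' \<in> Spec R. P \<subseteq> Q'}"
    using an ne by (auto simp: supp_def car split: if_splits)
  moreover have "{Q' \<in> Spec R. P \<subseteq> Q'} \<subseteq> supp R Q" unfolding supp_def car using one by auto
  ultimately have asQ: "ass R Q = {P}" "supp R Q = {Q' \<in> Spec R. P \<subseteq> Q'}" by auto
  obtain X where X: "X \<in> mod_cat R" "module_isomorphic R Q X" using mod_cat_universal[OF fg] by blast
  then obtain h where h: "h \<in> module_hom R Q X" "carrier X = h ` q ` carrier R"
    unfolding module_isomorphic_def bij_betw_def car by blast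
  have "P \<subseteq> annih R X (h (q r))" if "r \<in> carrier R" for r
    using annih_hom[OF Q mod_catD(2)[OF X(1)] h(1), of "q r"] that an[OF that] Spec_subset[OF P] car
    by (auto split: if_splits)
  then have "X \<in> annihilated_by (mod_cat R) P"
    using X(1) h(2) by (fastforce simp: annihilated_by_def annih_def)
  with asQ X show thesis using ass_supp_iso[OF Q mod_catD(2)[OF X(1)] X(2)] that by auto
qed

section \<open>Torsion pairs given by sets of primes\<close>

text \<open>For a set \<open>Z\<close> closed under specialization, the two classes defined next are the torsion and the torsionfree modules
  with respect to \<open>Z\<close>.\<close>

definition supported_cat :: "'a set set \<Rightarrow> 'a fgmod set" where
  "supported_cat Z = {M \<in> mod_cat R. supp R M \<subseteq> Z}"

definition torsionfree_cat :: "'a set set \<Rightarrow> 'a fgmod set" where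
  "torsionfree_cat Z = {M \<in> mod_cat R. ass R M \<inter> Z = {}}"

definition upward_closed :: "'a set set \<Rightarrow> bool" where
  "upward_closed Z \<longleftrightarrow> Z \<subseteq> Spec R \<and> (\<forall>P\<in>Z. \<forall>Q\<in>Spec R. P \<subseteq> Q \<longrightarrow> Q \<in> Z)"

text \<open>The closure of a point \<open>P\<close> is the set of all primes that contain \<open>P\<close>.\<close>

lemma specialization_closed_iff: "specialization_closed R Z \<longleftrightarrow> upward_closed Z"
proof -
  have cl: "zariski_topology R closure_of {P} = {Q \<in> Spec R. P \<subseteq> Q}" if P: "P \<in> Spec R" for P
  proof
    have "closedin (zariski_topology R) {Q \<in> Spec R. P \<subseteq> Q}"
      using P Spec_ideal closedin_zariski[OF is_cring] by blast
    then show "zariski_topology R closure_of {P} \<subseteq> {Q \<in> Spec R. P \<subseteq> Q}"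
      using P by (intro closure_of_minimal) auto
    obtain I where I: "zariski_topology R closure_of {P} = {Q \<in> Spec R. I \<subseteq> Q}"
      using closedin_closure_of[of "zariski_topology R" "{P}"]
      unfolding closedin_zariski[OF is_cring] by blast
    have "P \<in> zariski_topology R closure_of {P}"
      using closure_of_subset[of "{P}" "zariski_topology R"] P by (simp add: topspace_zariski[OF is_cring])
    then show "{Q \<in> Spec R. P \<subseteq> Q} \<subseteq> zariski_topology R closure_of {P}" unfolding I by auto
  qed
  have "zariski_topology R closure_of {P} \<subseteq> Z \<longleftrightarrow> (\<forall>Q\<in>Spec R. P \<subseteq> Q \<longrightarrow> Q \<in> Z)" if "P \<in> Spec R" for P
    using cl[OF that] by auto
  then show ?thesis unfolding specialization_closed_def upward_closed_def by (metis subsetD)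
qed

text \<open>The elements \<open>x\<close> of \<open>X\<close> all of whose primes over the annihilator lie in \<open>Z\<close> form the largest
  submodule \<open>N\<close> supported in \<open>Z\<close>.  The quotient has no associated prime in \<open>Z\<close>: suppose \<open>P \<in> Z\<close> is
  the annihilator of the class of \<open>x\<close>.  A prime \<open>Q\<close> over the annihilator of \<open>x\<close> either contains \<open>P\<close>
  and lies in \<open>Z\<close>, or it misses some \<open>p \<in> P\<close>; then \<open>Q\<close> is also a prime over the annihilator of
  \<open>p \<odot> x \<in> N\<close>, so it lies in \<open>Z\<close> again.  Hence \<open>x \<in> N\<close>, which is absurd.\<close>

lemma torsion_sequence:
  assumes X: "X \<in> mod_cat R" and Z: "upward_closed Z"
  obtains N F g where "submodule N R X" "X\<lparr>carrier := N\<rparr> \<in> supported_cat Z" "F \<in> torsionfree_cat Z"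
    "short_exact R (X\<lparr>carrier := N\<rparr>) (\<lambda>x. x) X g F"
proof -
  note XM = mod_catD(2)[OF X]
  interpret module R X by (rule XM)
  define N where "N = {x \<in> carrier X. \<forall>P\<in>Spec R. annih R X x \<subseteq> P \<longrightarrow> P \<in> Z}"
  have N: "submodule N R X" unfolding submodule_iff
  proof (intro conjI ballI)
    show "N \<subseteq> carrier X" by (auto simp: N_def)
    have "annih R X \<zero>\<^bsub>X\<^esub> = carrier R" by (auto simp: annih_def)
    then show "\<zero>\<^bsub>X\<^esub> \<in> N" using Spec_one by (auto simp: N_def)
  next
    fix x y assume xy: "x \<in> N" "y \<in> N"
    show "x \<oplus>\<^bsub>X\<^esub> y \<in> N" unfolding N_def
    proof (intro CollectI conjI ballI impI)
      show "x \<oplus>\<^bsub>X\<^esub> y \<in> carrier X" using xy by (auto simp: N_def)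
      fix P assume P: "P \<in> Spec R" "annih R X (x \<oplus>\<^bsub>X\<^esub> y) \<subseteq> P"
      have "annih R X x \<subseteq> P \<or> annih R X y \<subseteq> P"
      proof (rule ccontr)
        assume "\<not> ?thesis"
        then obtain a b where ab: "a \<in> annih R X x" "a \<notin> P" "b \<in> annih R X y" "b \<notin> P" by blast
        have "(a \<otimes> b) \<odot>\<^bsub>X\<^esub> (x \<oplus>\<^bsub>X\<^esub> y) = b \<odot>\<^bsub>X\<^esub> (a \<odot>\<^bsub>X\<^esub> x) \<oplus>\<^bsub>X\<^esub> a \<odot>\<^bsub>X\<^esub> (b \<odot>\<^bsub>X\<^esub> y)"
          using ab xy by (simp add: annih_def N_def smult_r_distr smult_assoc1 smult_lcomm[of a b x])
        also have "\<dots> = \<zero>\<^bsub>X\<^esub>" using ab by (simp add: annih_def)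
        finally have "a \<otimes> b \<in> P" using P(2) ab by (auto simp: annih_def)
        then show False using ab P(1) by (simp add: Spec_mult_iff annih_def)
      qed
      then show "P \<in> Z" using xy P by (auto simp: N_def)
    qed
  next
    fix a x assume a: "a \<in> carrier R" and x: "x \<in> N"
    then have "annih R X x \<subseteq> annih R X (a \<odot>\<^bsub>X\<^esub> x)"
      by (intro annih_smult_mono[OF XM]) (auto simp: N_def)
    then show "a \<odot>\<^bsub>X\<^esub> x \<in> N" using a x by (auto simp: N_def)
  qed
  have Nc: "N \<subseteq> carrier X" by (auto simp: N_def)
  have TM: "X\<lparr>carrier := N\<rparr> \<in> mod_cat R"
    using fg_submodule[OF mod_catD(1)[OF X] N] by (simp add: mod_cat_def)
  have T: "X\<lparr>carrier := N\<rparr> \<in> supported_cat Z"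
    using TM by (auto simp: supported_cat_def supp_def N_def)
  define Q where "Q = quot_module R X N"
  define q where "q = (\<lambda>x. N +>\<^bsub>X\<^esub> x)"
  have Q: "module R Q" and q: "q \<in> module_hom R X Q"
    and q0: "\<And>x. x \<in> carrier X \<Longrightarrow> q x = \<zero>\<^bsub>Q\<^esub> \<longleftrightarrow> x \<in> N" and car: "carrier Q = q ` carrier X"
    using quot_module[OF N] by (auto simp: Q_def q_def carrier_quot_module)
  have fg: "fg_module R Q" using fg_imageI[OF mod_catD(1)[OF X] Q q] car by simp
  have "P \<notin> Z" if P: "P \<in> ass R Q" for P
  proof
    assume PZ: "P \<in> Z"
    obtain x where x: "x \<in> carrier X" "P = annih R Q (q x)" and PS: "P \<in> Spec R"
      using P by (auto simp: ass_def car)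
    have px: "p \<in> P \<longleftrightarrow> p \<odot>\<^bsub>X\<^esub> x \<in> N" if "p \<in> carrier R" for p
      using that x q0[of "p \<odot>\<^bsub>X\<^esub> x"] module_homD(3)[OF q that x(1)] by (auto simp: annih_def)
    have "x \<in> N" unfolding N_def
    proof (intro CollectI conjI ballI impI)
      fix Q' assume Q': "Q' \<in> Spec R" "annih R X x \<subseteq> Q'"
      show "Q' \<in> Z"
      proof (cases "P \<subseteq> Q'")
        case True
        then show ?thesis using Z Q' PZ by (auto simp: upward_closed_def)
      next
        case False
        then obtain p where p: "p \<in> P" "p \<notin> Q'" by blast
        then have pc: "p \<in> carrier R" using Spec_subset[OF PS] by auto
        have "annih R X (p \<odot>\<^bsub>X\<^esub> x) \<subseteq> Q'"
        proof
          fix a assume a: "a \<in> annih R X (p \<odot>\<^bsub>X\<^esub> x)"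
          then have "a \<otimes> p \<in> annih R X x" using pc x(1) by (auto simp: annih_def smult_assoc1)
          then have "a \<otimes> p \<in> Q'" using Q' by blast
          then show "a \<in> Q'" using a pc p Q' by (simp add: Spec_mult_iff annih_def)
        qed
        moreover have "p \<odot>\<^bsub>X\<^esub> x \<in> N" using px[OF pc] p by simp
        ultimately show ?thesis using Q'(1) by (auto simp: N_def)
      qed
    qed (rule x)
    then have "\<one> \<in> P" using px[OF one_closed] x by simp
    then show False using Spec_one PS by blast
  qed
  then have disj: "ass R Q \<inter> Z = {}" by blast
  obtain F h where F: "F \<in> mod_cat R" and h: "h \<in> module_hom R Q F" "bij_betw h (carrier Q) (carrier F)"
    using mod_cat_universal[OF fg] unfolding module_isomorphic_def by blast
  have FM: "module R F" using mod_catD(2)[OF F] .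
  have "ass R F = ass R Q" using h ass_supp_iso[OF Q FM] unfolding module_isomorphic_def by blast
  then have FZ: "F \<in> torsionfree_cat Z" using disj F by (simp add: torsionfree_cat_def)
  have "{x \<in> carrier X. (h \<circ> q) x = \<zero>\<^bsub>F\<^esub>} = N"
  proof -
    have "h (q x) = \<zero>\<^bsub>F\<^esub> \<longleftrightarrow> q x = \<zero>\<^bsub>Q\<^esub>" if "x \<in> carrier X" for x
    proof -
      interpret Q: module R Q by fact
      have "q x \<in> carrier Q" using that car by blast
      then show ?thesis
        using bij_betw_imp_inj_on[OF h(2)] module_hom_zero[OF Q FM h(1)] Q.M.zero_closed
        by (metis inj_onD)
    qed
    then show ?thesis using q0 Nc by auto
  qed
  moreover have "(h \<circ> q) ` carrier X = carrier F"
    unfolding image_comp[symmetric] car[symmetric] using h(2) by (simp add: bij_betw_def)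
  ultimately have "short_exact R (X\<lparr>carrier := N\<rparr>) (\<lambda>x. x) X (h \<circ> q) F"
    unfolding short_exact_def using inclusion_hom[OF Nc] module_hom_comp[OF q h(1)] by simp
  with N T FZ show thesis using that by blast
qed

text \<open>Isomorphic modules have the same associated primes and the same support.\<close>

lemma is_subcategoryI:
  assumes "C \<subseteq> mod_cat R" "\<And>M N. M \<in> C \<Longrightarrow> N \<in> mod_cat R \<Longrightarrow> ass R N = ass R M \<Longrightarrow> supp R N = supp R M \<Longrightarrow> N \<in> C"
  shows "is_subcategory R C"
  unfolding is_subcategory_def
proof (intro conjI ballI impI)
  fix M N assume "M \<in> C" "N \<in> mod_cat R" "module_isomorphic R M N"
  then show "N \<in> C" using assms ass_supp_iso[of M N] mod_catD(2) by blast
qed fact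

lemma torsion_pairI:
  assumes C: "C \<subseteq> mod_cat R" "is_subcategory R C" "extension_closed R C"
    and sub: "\<And>X N. X \<in> C \<Longrightarrow> submodule N R X \<Longrightarrow> X\<lparr>carrier := N\<rparr> \<in> C"
    and Z: "upward_closed Z" and ZC: "torsionfree_cat Z \<subseteq> C"
  shows "(supported_cat Z \<inter> C, torsionfree_cat Z) \<in> torsion_pairs R C"
  unfolding torsion_pairs_def subcategory_pairs_def
proof (intro CollectI case_prodI conjI ballI)
  have "is_subcategory R (supported_cat Z)"
    by (rule is_subcategoryI) (auto simp: supported_cat_def)
  then show "is_subcategory R (supported_cat Z \<inter> C)"
    using C(2) unfolding is_subcategory_def by blast
  show "is_subcategory R (torsionfree_cat Z)"
    by (rule is_subcategoryI) (auto simp: torsionfree_cat_def)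
  show "Hom_zero R T F" if "T \<in> supported_cat Z \<inter> C" "F \<in> torsionfree_cat Z" for T F
    using that mod_catD Hom_zero_iff[of T F] by (auto simp: supported_cat_def torsionfree_cat_def)
  show "\<exists>T\<in>supported_cat Z \<inter> C. \<exists>F\<in>torsionfree_cat Z. \<exists>f g. short_exact R T f X g F" if X: "X \<in> C" for X
  proof -
    obtain N F g where *: "submodule N R X" "X\<lparr>carrier := N\<rparr> \<in> supported_cat Z" "F \<in> torsionfree_cat Z"
      "short_exact R (X\<lparr>carrier := N\<rparr>) (\<lambda>x. x) X g F"
      using torsion_sequence[OF _ Z, of X] X C(1) by blast
    then have "X\<lparr>carrier := N\<rparr> \<in> supported_cat Z \<inter> C" using sub X by blast
    with * show ?thesis by blast
  qed
qed (use C ZC in auto)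

text \<open>If \<open>X\<close> has no nonzero homomorphism to \<open>F\<close>, the torsionfree part in its exact sequence vanishes and \<open>X\<close>
  is isomorphic to its torsion part; dually for \<open>F\<close>.\<close>

lemma torsion_pairs_subset_weak:
  assumes "C \<subseteq> mod_cat R"
  shows "torsion_pairs R C \<subseteq> weak_torsion_pairs R C"
proof
  fix p assume p: "p \<in> torsion_pairs R C"
  obtain T F where pTF: "p = (T, F)" by fastforce
  have sp: "(T, F) \<in> subcategory_pairs R C" and hz: "\<And>X Y. X \<in> T \<Longrightarrow> Y \<in> F \<Longrightarrow> Hom_zero R X Y"
    and ses: "\<And>X. X \<in> C \<Longrightarrow> \<exists>L\<in>T. \<exists>N\<in>F. \<exists>f g. short_exact R L f X g N"
    using p unfolding torsion_pairs_def pTF by auto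
  have TC: "T \<subseteq> C" "F \<subseteq> C" and iT: "is_subcategory R T" and iF: "is_subcategory R F"
    using sp by (auto simp: subcategory_pairs_def)
  have "X \<in> T" if X: "X \<in> C" "\<forall>F'\<in>F. Hom_zero R X F'" for X
  proof -
    obtain L N f g where LN: "L \<in> T" "N \<in> F" and e: "short_exact R L f X g N" using ses X by blast
    have "Hom_zero R X N" using X LN by blast
    then have "{x \<in> carrier X. g x = \<zero>\<^bsub>N\<^esub>} = carrier X"
      using e by (auto simp: Hom_zero_def short_exact_def)
    then have "module_isomorphic R L X"
      using e by (auto simp: short_exact_def module_isomorphic_def bij_betw_def)
    then show ?thesis using iT LN X(1) assms unfolding is_subcategory_def by blast
  qed
  moreover have "X \<in> F" if X: "X \<in> C" "\<forall>T'\<in>T. Hom_zero R T' X" for X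
  proof -
    obtain L N f g where LN: "L \<in> T" "N \<in> F" and e: "short_exact R L f X g N" using ses X by blast
    have mods: "module R L" "module R X" "module R N"
      using LN X TC assms mod_catD(2) by blast+
    interpret X: module R X by fact
    interpret N: module R N by fact
    have f: "f \<in> module_hom R L X" and g: "g \<in> module_hom R X N" "g ` carrier X = carrier N"
      and ex: "f ` carrier L = {x \<in> carrier X. g x = \<zero>\<^bsub>N\<^esub>}"
      using e by (auto simp: short_exact_def)
    have "Hom_zero R L X" using X LN by blast
    then have ker: "x = \<zero>\<^bsub>X\<^esub>" if kx: "x \<in> carrier X" "g x = \<zero>\<^bsub>N\<^esub>" for x
    proof -
      obtain y where y: "y \<in> carrier L" "x = f y" using ex kx by blast
      have "f y = \<zero>\<^bsub>X\<^esub>" using \<open>Hom_zero R L X\<close> f y(1) by (simp add: Hom_zero_def)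
      then show ?thesis using y(2) by simp
    qed
    have "inj_on g (carrier X)"
    proof (rule inj_onI)
      fix x y assume xy: "x \<in> carrier X" "y \<in> carrier X" "g x = g y"
      have "(\<ominus> \<one>) \<odot>\<^bsub>X\<^esub> y = \<ominus>\<^bsub>X\<^esub> y" "(\<ominus> \<one>) \<odot>\<^bsub>N\<^esub> g y = \<ominus>\<^bsub>N\<^esub> g y"
        using xy module_homD(1)[OF g(1)] by (auto simp: X.smult_l_minus N.smult_l_minus)
      then have "g (x \<oplus>\<^bsub>X\<^esub> \<ominus>\<^bsub>X\<^esub> y) = g x \<oplus>\<^bsub>N\<^esub> \<ominus>\<^bsub>N\<^esub> g y"
        using xy module_homD(2)[OF g(1), of x "\<ominus>\<^bsub>X\<^esub> y"] module_homD(3)[OF g(1), of "\<ominus> \<one>" y] by simp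
      also have "\<dots> = \<zero>\<^bsub>N\<^esub>" using xy module_homD(1)[OF g(1)] by (simp add: N.M.r_neg)
      finally have "x \<oplus>\<^bsub>X\<^esub> \<ominus>\<^bsub>X\<^esub> y = \<zero>\<^bsub>X\<^esub>" using ker xy by simp
      then have "\<ominus>\<^bsub>X\<^esub> (\<ominus>\<^bsub>X\<^esub> y) = x" using xy by (intro X.M.minus_equality) auto
      then show "x = y" using xy by simp
    qed
    then have bij: "bij_betw g (carrier X) (carrier N)" using g by (simp add: bij_betw_def)
    have "module_isomorphic R N X"
      unfolding module_isomorphic_def
    proof (intro bexI)
      let ?h = "inv_into (carrier X) g"
      show "bij_betw ?h (carrier N) (carrier X)" using bij by (rule bij_betw_inv_into)
      have h: "?h n \<in> carrier X" "g (?h n) = n" if "n \<in> carrier N" for n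
        using that g(2) by (metis inv_into_into, metis f_inv_into_f)
      have hg: "?h (g x) = x" if "x \<in> carrier X" for x
        using that bij by (simp add: bij_betw_def)
      show "?h \<in> module_hom R N X" unfolding module_hom_def
      proof (intro CollectI conjI ballI Pi_I)
        fix m n assume mn: "m \<in> carrier N" "n \<in> carrier N"
        then have "m \<oplus>\<^bsub>N\<^esub> n = g (?h m \<oplus>\<^bsub>X\<^esub> ?h n)" using h module_homD(2)[OF g(1)] by simp
        then show "?h (m \<oplus>\<^bsub>N\<^esub> n) = ?h m \<oplus>\<^bsub>X\<^esub> ?h n" using hg h mn by simp
      next
        fix a n assume an: "a \<in> carrier R" "n \<in> carrier N"
        then have "a \<odot>\<^bsub>N\<^esub> n = g (a \<odot>\<^bsub>X\<^esub> ?h n)" using h module_homD(3)[OF g(1)] by simp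
        then show "?h (a \<odot>\<^bsub>N\<^esub> n) = a \<odot>\<^bsub>X\<^esub> ?h n" using hg h an by simp
      qed (use h in auto)
    qed
    then show ?thesis using iF LN X(1) assms unfolding is_subcategory_def by blast
  qed
  ultimately show "p \<in> weak_torsion_pairs R C"
    using sp hz TC unfolding weak_torsion_pairs_iff pTF by blast
qed

text \<open>By the criterion for vanishing \<open>Hom\<close>, \<open>T\<close> consists of the modules whose support avoids all associated primes
  of modules in \<open>F\<close>.  As supports are closed under specialization, they then avoid all primes below these as well.\<close>

lemma weak_torsion_class_supported:
  assumes C: "C \<subseteq> mod_cat R" and w: "(T, F) \<in> weak_torsion_pairs R C"
    and Z: "Z = {Q \<in> Spec R. \<forall>X\<in>F. \<forall>P\<in>ass R X. \<not> Q \<subseteq> P}"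
  shows "upward_closed Z" and "T = supported_cat Z \<inter> C"
proof -
  show "upward_closed Z" unfolding upward_closed_def Z by blast
  have TF: "T = {X \<in> C. \<forall>Y\<in>F. Hom_zero R X Y}" "F \<subseteq> C"
    using w[unfolded weak_torsion_pairs_iff] unfolding subcategory_pairs_def by blast+
  have up: "Q \<in> supp R X" if "P \<in> supp R X" "Q \<in> Spec R" "P \<subseteq> Q" for P Q X
    using that by (auto simp: supp_def)
  have "(\<forall>Y\<in>F. Hom_zero R X Y) \<longleftrightarrow> supp R X \<subseteq> Z" if X: "X \<in> C" for X
  proof -
    have "(\<forall>Y\<in>F. Hom_zero R X Y) \<longleftrightarrow> (\<forall>Y\<in>F. supp R X \<inter> ass R Y = {})"
      using Hom_zero_iff[of X] X C TF(2) mod_catD by (metis subsetD)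
    also have "\<dots> \<longleftrightarrow> supp R X \<subseteq> Z"
    proof
      assume a: "\<forall>Y\<in>F. supp R X \<inter> ass R Y = {}"
      have "\<not> Q \<subseteq> P" if "Q \<in> supp R X" "Y \<in> F" "P \<in> ass R Y" for Q Y P
        using a that up[of Q X P] by (auto simp: ass_def)
      then show "supp R X \<subseteq> Z" by (auto simp: Z supp_def)
    qed (auto simp: Z)
    finally show ?thesis .
  qed
  then show "T = supported_cat Z \<inter> C" unfolding TF(1) supported_cat_def using C by blast
qed

lemma weak_torsion_pair_eq:
  "(T, F) \<in> weak_torsion_pairs R C \<Longrightarrow> (T, F') \<in> weak_torsion_pairs R C \<Longrightarrow> F = F'"
  unfolding weak_torsion_pairs_iff by metis

section \<open>Minimal primes and kernels of localization\<close>

lemma exists_prime_above: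
  assumes I: "ideal I R" "\<one> \<notin> I"
  obtains P where "P \<in> Spec R" "I \<subseteq> P"
proof -
  define F where "F = {J. ideal J R \<and> I \<subseteq> J \<and> \<one> \<notin> J}"
  have "F \<noteq> {}" using I by (auto simp: F_def)
  moreover have "J \<in> F \<Longrightarrow> ideal J R" for J by (simp add: F_def)
  ultimately have "\<exists>P\<in>F. \<forall>J\<in>F. P \<subseteq> J \<longrightarrow> J = P" by (rule maximal_ideal_in_family)
  then obtain P where P: "P \<in> F" and max: "\<And>J. J \<in> F \<Longrightarrow> P \<subseteq> J \<Longrightarrow> J = P" by blast
  have "maximalideal P R"
  proof (rule maximalidealI)
    show "ideal P R" "carrier R \<noteq> P" using P by (auto simp: F_def)
    show "J = P \<or> J = carrier R" if "ideal J R" "P \<subseteq> J" for J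
      using that max[of J] P ideal.one_imp_carrier[OF that(1)] by (auto simp: F_def)
  qed
  then have "P \<in> Spec R" using maximalideal_prime by (simp add: Spec_def)
  then show thesis using that P by (auto simp: F_def)
qed

lemma nilpotent_if_in_all_primes:
  assumes a: "a \<in> carrier R" and all: "\<And>P. P \<in> Spec R \<Longrightarrow> a \<in> P"
  obtains n :: nat where "a [^] n = \<zero>"
proof (cases "\<zero> \<in> range (\<lambda>n::nat. a [^] n)")
  case True
  then show thesis using that by auto
next
  case False
  obtain P where "P \<in> Spec R" "P \<inter> range (\<lambda>n::nat. a [^] n) = {}"
  proof (rule prime_avoiding[of "range (\<lambda>n::nat. a [^] n)"])
    show "\<one> \<in> range (\<lambda>n::nat. a [^] n)" by (metis nat_pow_0 rangeI)
    show "b \<otimes> c \<in> range (\<lambda>n::nat. a [^] n)"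
      if bc: "b \<in> range (\<lambda>n::nat. a [^] n)" "c \<in> range (\<lambda>n::nat. a [^] n)" for b c
    proof -
      obtain m n :: nat where "b = a [^] m" "c = a [^] n" using bc by auto
      then have "b \<otimes> c = a [^] (m + n)" using a by (simp add: nat_pow_mult)
      then show ?thesis by simp
    qed
  qed (use a False in auto)
  moreover have "a [^] (1::nat) \<in> range (\<lambda>n::nat. a [^] n)" by (rule rangeI)
  ultimately show thesis using all a by (auto simp: disjoint_iff)
qed

text \<open>Noetherian induction: if \<open>a \<otimes> b \<in> I\<close> with \<open>a\<close> and \<open>b\<close> outside \<open>I\<close>, a prime containing \<open>I\<close>
  contains \<open>I + (a)\<close> or \<open>I + (b)\<close>.\<close>

lemma finite_primes_below:
  assumes "ideal I R"
  shows "\<exists>F. finite F \<and> F \<subseteq> Spec R \<and> (\<forall>P\<in>Spec R. I \<subseteq> P \<longrightarrow> (\<exists>Q\<in>F. Q \<subseteq> P))"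
proof (rule ccontr)
  assume no: "\<not> ?thesis"
  define good where "good I \<longleftrightarrow> (\<exists>F. finite F \<and> F \<subseteq> Spec R \<and> (\<forall>P\<in>Spec R. I \<subseteq> P \<longrightarrow> (\<exists>Q\<in>F. Q \<subseteq> P)))" for I
  have "{I. ideal I R \<and> \<not> good I} \<noteq> {}" using assms no by (auto simp: good_def)
  moreover have "J \<in> {I. ideal I R \<and> \<not> good I} \<Longrightarrow> ideal J R" for J by blast
  ultimately have "\<exists>I\<in>{I. ideal I R \<and> \<not> good I}. \<forall>J\<in>{I. ideal I R \<and> \<not> good I}. I \<subseteq> J \<longrightarrow> J = I"
    by (rule maximal_ideal_in_family)
  then obtain I where I: "ideal I R" "\<not> good I"
    and max: "\<And>J. ideal J R \<Longrightarrow> I \<subseteq> J \<Longrightarrow> J \<noteq> I \<Longrightarrow> good J" by blast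
  have "I \<notin> Spec R"
  proof
    assume "I \<in> Spec R"
    then have "good I" unfolding good_def by (intro exI[of _ "{I}"]) auto
    then show False using I by simp
  qed
  moreover have "\<one> \<notin> I"
  proof
    assume "\<one> \<in> I"
    then have "good I" unfolding good_def using Spec_one by (intro exI[of _ "{}"]) blast
    then show False using I by simp
  qed
  ultimately obtain a b where ab: "a \<in> carrier R" "b \<in> carrier R" "a \<otimes> b \<in> I" "a \<notin> I" "b \<notin> I"
    using I by (auto simp: Spec_iff)
  have Ic: "I \<subseteq> carrier R" using I by (simp add: ideal_iff)
  have big: "good (Idl (insert c I))" if c: "c \<in> carrier R" "c \<notin> I" for c
  proof (rule max)
    have "insert c I \<subseteq> carrier R" using c Ic by auto
    then have "ideal (Idl (insert c I)) R" "insert c I \<subseteq> Idl (insert c I)"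
      by (rule genideal_ideal, rule genideal_self)
    then show "ideal (Idl (insert c I)) R" "I \<subseteq> Idl (insert c I)" "Idl (insert c I) \<noteq> I"
      using c by auto
  qed
  obtain F where F: "finite F" "F \<subseteq> Spec R" "\<forall>P\<in>Spec R. Idl (insert a I) \<subseteq> P \<longrightarrow> (\<exists>Q\<in>F. Q \<subseteq> P)"
    using big[OF ab(1,4)] by (auto simp: good_def)
  obtain G where G: "finite G" "G \<subseteq> Spec R" "\<forall>P\<in>Spec R. Idl (insert b I) \<subseteq> P \<longrightarrow> (\<exists>Q\<in>G. Q \<subseteq> P)"
    using big[OF ab(2,5)] by (auto simp: good_def)
  have "\<exists>Q\<in>F \<union> G. Q \<subseteq> P" if P: "P \<in> Spec R" "I \<subseteq> P" for P
  proof -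
    have "a \<in> P \<or> b \<in> P" using ab P Spec_mult_iff[OF P(1) ab(1,2)] by blast
    then have "insert a I \<subseteq> P \<or> insert b I \<subseteq> P" using P(2) by blast
    then have "Idl (insert a I) \<subseteq> P \<or> Idl (insert b I) \<subseteq> P"
      using genideal_minimal[OF Spec_ideal[OF P(1)]] by blast
    then have "(\<exists>Q\<in>F. Q \<subseteq> P) \<or> (\<exists>Q\<in>G. Q \<subseteq> P)"
      using F(3) G(3) P(1) by fast
    then show ?thesis by (simp add: bex_Un)
  qed
  then have "good I" unfolding good_def using F G by (intro exI[of _ "F \<union> G"]) auto
  then show False using I by simp
qed

lemma finite_Min_Spec: "finite (Min_Spec R)"
proof -
  obtain F where F: "finite F" "F \<subseteq> Spec R" "\<forall>P\<in>Spec R. {\<zero>} \<subseteq> P \<longrightarrow> (\<exists>Q\<in>F. Q \<subseteq> P)"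
    using finite_primes_below[OF zeroideal] by blast
  have "Min_Spec R \<subseteq> F"
  proof
    fix P assume P: "P \<in> Min_Spec R"
    then have "P \<in> Spec R" by (simp add: Min_Spec_def)
    moreover from this have "{\<zero>} \<subseteq> P" using Spec_zero by blast
    ultimately obtain Q where "Q \<in> F" "Q \<subseteq> P" using F(3) by blast
    then show "P \<in> F" using P F(2) by (auto simp: Min_Spec_def)
  qed
  then show ?thesis using F(1) finite_subset by blast
qed

lemma finite_Inter_not_subset_prime:
  assumes P: "P \<in> Spec R" and F: "finite F" "\<And>I. I \<in> F \<Longrightarrow> ideal I R" "\<And>I. I \<in> F \<Longrightarrow> \<not> I \<subseteq> P"
  obtains y where "y \<in> carrier R" "y \<notin> P" "\<forall>I\<in>F. y \<in> I"
proof -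
  have "\<exists>y\<in>carrier R - P. \<forall>I\<in>F. y \<in> I"
    using F
  proof (induction F)
    case empty
    then show ?case using Spec_one[OF P] by auto
  next
    case (insert I F)
    then obtain y where y: "y \<in> carrier R" "y \<notin> P" "\<forall>J\<in>F. y \<in> J" by auto
    obtain z where z: "z \<in> I" "z \<notin> P" using insert.prems by blast
    have idl: "ideal I R" "\<And>J. J \<in> F \<Longrightarrow> ideal J R" using insert.prems by auto
    have zc: "z \<in> carrier R" using z idl by (auto simp: ideal_iff)
    have "y \<otimes> z \<in> carrier R - P" using y z zc P by (simp add: Spec_mult_iff)
    moreover have "y \<otimes> z \<in> I" using ideal.I_l_closed[OF idl(1) z(1) y(1)] .
    moreover have "y \<otimes> z \<in> J" if "J \<in> F" for J
      using ideal.I_r_closed[OF idl(2)[OF that] _ zc] y that by blast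
    ultimately show ?case by blast
  qed
  then show thesis using that by blast
qed

text \<open>The kernel of \<open>R\<close> in the product of the localizations \<open>R\<^sub>P\<close> at the primes \<open>P \<in> A\<close>.\<close>

definition loc_kernel :: "'a set set \<Rightarrow> 'a set" where
  "loc_kernel A = {r \<in> carrier R. \<forall>P\<in>A. \<exists>s\<in>carrier R - P. s \<otimes> r = \<zero>}"

lemma ideal_loc_kernel:
  assumes A: "A \<subseteq> Spec R"
  shows "ideal (loc_kernel A) R"
  unfolding ideal_iff
proof (intro conjI ballI)
  show "loc_kernel A \<subseteq> carrier R" by (auto simp: loc_kernel_def)
  have "\<one> \<in> carrier R - P" if "P \<in> A" for P using that A Spec_one by auto
  then show "\<zero> \<in> loc_kernel A" by (auto simp: loc_kernel_def)
next
  fix a b assume ab: "a \<in> loc_kernel A" "b \<in> loc_kernel A"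
  then have abc: "a \<in> carrier R" "b \<in> carrier R" by (auto simp: loc_kernel_def)
  have "\<exists>s\<in>carrier R - P. s \<otimes> (a \<oplus> b) = \<zero>" if P: "P \<in> A" for P
  proof -
    obtain s t where st: "s \<in> carrier R - P" "t \<in> carrier R - P" "s \<otimes> a = \<zero>" "t \<otimes> b = \<zero>"
      using ab P unfolding loc_kernel_def by blast
    have "(s \<otimes> t) \<otimes> (a \<oplus> b) = t \<otimes> (s \<otimes> a) \<oplus> s \<otimes> (t \<otimes> b)"
      using st(1,2) abc by (simp add: r_distr m_ac)
    also have "\<dots> = \<zero>" using st by simp
    finally have "(s \<otimes> t) \<otimes> (a \<oplus> b) = \<zero>" .
    moreover have "s \<otimes> t \<in> carrier R - P" using st A P by (auto simp: Spec_mult_iff)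
    ultimately show ?thesis by blast
  qed
  then show "a \<oplus> b \<in> loc_kernel A" using abc by (auto simp: loc_kernel_def)
next
  fix b a assume b: "b \<in> carrier R" and a: "a \<in> loc_kernel A"
  have "s \<otimes> (b \<otimes> a) = \<zero>" if "s \<in> carrier R" "s \<otimes> a = \<zero>" "a \<in> carrier R" for s
  proof -
    have "s \<otimes> (b \<otimes> a) = b \<otimes> (s \<otimes> a)" using that(1,3) b by (simp add: m_ac)
    then show ?thesis using that b by simp
  qed
  then show "b \<otimes> a \<in> loc_kernel A" using a b by (fastforce simp: loc_kernel_def)
qed

text \<open>A module whose associated primes all lie in \<open>A\<close> embeds into the product of its localizations at \<open>A\<close>, so it is
  killed by \<open>loc_kernel A\<close>.  Conversely, \<open>sep\<close> says that \<open>loc_kernel A\<close> detects membership in \<open>A\<close>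
  among the primes of \<open>A \<union> B\<close>.  Basic torsion pairs arise from two kinds of partitions that satisfy \<open>sep\<close>: open and closed
  subsets of the whole spectrum, and arbitrary subsets of the minimal primes.\<close>

lemma annihilated_by_loc_kernel:
  assumes C: "C \<subseteq> mod_cat R" and AB: "A \<subseteq> Spec R" "B \<subseteq> Spec R" "\<And>X. X \<in> C \<Longrightarrow> ass R X \<subseteq> A \<union> B"
    and sep: "\<And>P. P \<in> B \<Longrightarrow> \<not> loc_kernel A \<subseteq> P" "\<And>P. P \<in> A \<Longrightarrow> \<not> loc_kernel B \<subseteq> P"
  shows "{X \<in> C. supp R X \<inter> B = {}} = annihilated_by C (loc_kernel A)"
    and "{X \<in> C. ass R X \<subseteq> B} = annihilated_by C (loc_kernel B)"
proof -
  have kill: "i \<odot>\<^bsub>X\<^esub> x = \<zero>\<^bsub>X\<^esub>"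
    if X: "X \<in> C" "ass R X \<subseteq> E" and i: "i \<in> loc_kernel E" and x: "x \<in> carrier X" for X E i x
  proof (rule ccontr)
    assume nz: "i \<odot>\<^bsub>X\<^esub> x \<noteq> \<zero>\<^bsub>X\<^esub>"
    have XM: "module R X" using X C mod_catD by blast
    interpret X: module R X by fact
    have ic: "i \<in> carrier R" using i by (simp add: loc_kernel_def)
    have "i \<odot>\<^bsub>X\<^esub> x \<in> carrier X" using ic x by simp
    then obtain r where r: "r \<in> carrier R" "annih R X (r \<odot>\<^bsub>X\<^esub> (i \<odot>\<^bsub>X\<^esub> x)) \<in> ass R X"
      using assoc_prime_exists[OF XM _ nz] by blast
    then obtain s where s: "s \<in> carrier R" "s \<notin> annih R X (r \<odot>\<^bsub>X\<^esub> (i \<odot>\<^bsub>X\<^esub> x))" "s \<otimes> i = \<zero>"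
      using i X by (auto simp: loc_kernel_def)
    \<comment> \<open>\<open>s\<close> lies outside the annihilator of \<open>r \<odot> (i \<odot> x)\<close>, a prime in \<open>E\<close>, and yet kills \<open>i\<close>\<close>
    have "s \<odot>\<^bsub>X\<^esub> (r \<odot>\<^bsub>X\<^esub> (i \<odot>\<^bsub>X\<^esub> x)) = r \<odot>\<^bsub>X\<^esub> ((s \<otimes> i) \<odot>\<^bsub>X\<^esub> x)"
      using s(1) r ic x by (simp add: X.module_simps)
    also have "\<dots> = \<zero>\<^bsub>X\<^esub>" using s x r by simp
    finally show False using s by (simp add: annih_def)
  qed
  have annD: "J \<subseteq> annih R X x" if "X \<in> annihilated_by C J" "x \<in> carrier X" "J \<subseteq> carrier R" for J X x
    using that by (auto simp: annihilated_by_def annih_def)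
  have kc: "loc_kernel E \<subseteq> carrier R" for E by (auto simp: loc_kernel_def)
  show "{X \<in> C. supp R X \<inter> B = {}} = annihilated_by C (loc_kernel A)"
  proof (intro equalityI subsetI)
    fix X assume X: "X \<in> {X \<in> C. supp R X \<inter> B = {}}"
    then have "ass R X \<subseteq> A" using AB(3) ass_subset_supp[of R X] by blast
    then show "X \<in> annihilated_by C (loc_kernel A)" using X kill by (auto simp: annihilated_by_def)
  next
    fix X assume X: "X \<in> annihilated_by C (loc_kernel A)"
    then have "\<not> annih R X x \<subseteq> P" if "x \<in> carrier X" "P \<in> B" for x P
      using annD[OF X that(1) kc] sep(1)[OF that(2)] by blast
    then show "X \<in> {X \<in> C. supp R X \<inter> B = {}}" using X by (auto simp: supp_def annihilated_by_def)
  qed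
  show "{X \<in> C. ass R X \<subseteq> B} = annihilated_by C (loc_kernel B)"
  proof (intro equalityI subsetI)
    fix X assume "X \<in> {X \<in> C. ass R X \<subseteq> B}"
    then show "X \<in> annihilated_by C (loc_kernel B)" using kill by (auto simp: annihilated_by_def)
  next
    fix X assume X: "X \<in> annihilated_by C (loc_kernel B)"
    then have XC: "X \<in> C" by (simp add: annihilated_by_def)
    have "ass R X \<subseteq> B"
    proof
      fix P assume P: "P \<in> ass R X"
      then obtain x where "x \<in> carrier X" "P = annih R X x" by (auto simp: ass_def)
      then have "loc_kernel B \<subseteq> P" using annD[OF X _ kc] by blast
      then show "P \<in> B" using sep(2) AB(3)[OF XC] P by blast
    qed
    then show "X \<in> {X \<in> C. ass R X \<subseteq> B}" using XC by simp
  qed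
qed

text \<open>The ideals are comaximal, say \<open>f + g = 1\<close> with \<open>f \<in> I\<close>, \<open>g \<in> J\<close>, and \<open>f \<otimes> g\<close> is nilpotent because it
  lies in all primes.  A power of \<open>f\<close> is then killed by the same power of \<open>g\<close>, which lies in no prime over \<open>I\<close>,
  while \<open>f\<close> lies in no prime over \<open>J\<close>.\<close>

lemma loc_kernel_clopen:
  assumes I: "ideal I R" and J: "ideal J R"
    and cover: "\<And>P. P \<in> Spec R \<Longrightarrow> I \<subseteq> P \<or> J \<subseteq> P" and disj: "\<And>P. P \<in> Spec R \<Longrightarrow> \<not> (I \<subseteq> P \<and> J \<subseteq> P)"
    and P: "P \<in> Spec R" "J \<subseteq> P"
  shows "\<not> loc_kernel {Q \<in> Spec R. I \<subseteq> Q} \<subseteq> P"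
proof -
  have IJ: "I \<subseteq> carrier R" "J \<subseteq> carrier R" "\<zero> \<in> I" "\<zero> \<in> J" using I J by (auto simp: ideal_iff)
  have "I \<subseteq> I <+>\<^bsub>R\<^esub> J" "J \<subseteq> I <+>\<^bsub>R\<^esub> J" using IJ by (force simp: set_add_def')+
  moreover have "\<one> \<in> I <+>\<^bsub>R\<^esub> J"
  proof (rule ccontr)
    assume "\<one> \<notin> I <+>\<^bsub>R\<^esub> J"
    then obtain Q where "Q \<in> Spec R" "I <+>\<^bsub>R\<^esub> J \<subseteq> Q" by (rule exists_prime_above[OF add_ideals[OF I J]])
    then show False using disj calculation by blast
  qed
  ultimately obtain f g where fg: "f \<in> I" "g \<in> J" "f \<oplus> g = \<one>" by (auto simp: set_add_def')
  have c: "f \<in> carrier R" "g \<in> carrier R" using fg IJ by auto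
  have sum: "\<not> (f \<in> Q \<and> g \<in> Q)" if "Q \<in> Spec R" for Q
    using that Spec_one[OF that] Spec_ideal[OF that] fg(3) by (metis ideal_iff)
  have "f \<otimes> g \<in> Q" if "Q \<in> Spec R" for Q
    using that cover[OF that] fg c by (auto simp: Spec_mult_iff)
  then obtain n :: nat where n: "(f \<otimes> g) [^] n = \<zero>"
    using nilpotent_if_in_all_primes[of "f \<otimes> g"] c by blast
  have "f [^] n \<in> loc_kernel {Q \<in> Spec R. I \<subseteq> Q}"
    unfolding loc_kernel_def
  proof (intro CollectI conjI ballI)
    fix Q assume "Q \<in> {Q \<in> Spec R. I \<subseteq> Q}"
    then have "Q \<in> Spec R" "g \<notin> Q" using sum fg by auto
    then have "g [^] n \<in> carrier R - Q" using c by (simp add: Spec_power_iff)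
    moreover have "g [^] n \<otimes> f [^] n = \<zero>" using n c by (simp add: nat_pow_distrib m_comm)
    ultimately show "\<exists>s\<in>carrier R - Q. s \<otimes> f [^] n = \<zero>" by blast
  qed (use c in simp)
  moreover have "f [^] n \<notin> P" using sum[OF P(1)] P fg c by (auto simp: Spec_power_iff)
  ultimately show ?thesis by blast
qed

text \<open>The elements of a minimal prime \<open>Q\<close> are nilpotent in \<open>R\<^sub>Q\<close>: otherwise a prime avoiding all products of
  powers of \<open>q\<close> with elements outside \<open>Q\<close> would lie strictly below \<open>Q\<close>.  So every \<open>q \<in> Q\<close> has a power in
  the kernel.\<close>

lemma loc_kernel_minimal_prime:
  assumes Q: "Q \<in> Min_Spec R" and P: "P \<in> Spec R" "loc_kernel {Q} \<subseteq> P"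
  shows "Q \<subseteq> P"
proof
  fix q assume q: "q \<in> Q"
  have QS: "Q \<in> Spec R" using Q by (simp add: Min_Spec_def)
  then have qc: "q \<in> carrier R" using q Spec_subset by blast
  define S where "S = {s \<otimes> q [^] (n::nat) | s n. s \<in> carrier R - Q}"
  have "\<zero> \<in> S"
  proof (rule ccontr)
    assume "\<zero> \<notin> S"
    obtain p where p: "p \<in> Spec R" "p \<inter> S = {}"
    proof (rule prime_avoiding[of S])
      show "S \<subseteq> carrier R" using qc by (auto simp: S_def)
      have "\<one> \<otimes> q [^] (0::nat) \<in> S" using Spec_one[OF QS] unfolding S_def by blast
      then show "\<one> \<in> S" by simp
      show "a \<otimes> b \<in> S" if ab: "a \<in> S" "b \<in> S" for a b
      proof -
        obtain s m t n where *: "s \<in> carrier R - Q" "t \<in> carrier R - Q"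
          "a = s \<otimes> q [^] (m::nat)" "b = t \<otimes> q [^] (n::nat)" using ab by (auto simp: S_def)
        then have "a \<otimes> b = (s \<otimes> t) \<otimes> q [^] (m + n)"
          using qc by (simp add: m_ac nat_pow_mult[symmetric])
        moreover have "s \<otimes> t \<in> carrier R - Q" using * QS by (simp add: Spec_mult_iff)
        ultimately show ?thesis unfolding S_def by blast
      qed
      show "\<zero> \<notin> S" by fact
    qed (rule that)
    have "p \<subseteq> Q"
    proof
      fix a assume a: "a \<in> p"
      then have ac: "a \<in> carrier R" using p Spec_subset by blast
      show "a \<in> Q"
      proof (rule ccontr)
        assume "a \<notin> Q"
        then have "a \<otimes> q [^] (0::nat) \<in> S" using ac unfolding S_def by blast
        then show False using a ac p by auto
      qed
    qed
    then have "q \<in> p" using Q p q by (auto simp: Min_Spec_def)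
    moreover have "\<one> \<otimes> q [^] (1::nat) \<in> S" using Spec_one[OF QS] unfolding S_def by blast
    ultimately show False using p qc by auto
  qed
  then obtain s n where s: "s \<in> carrier R - Q" "s \<otimes> q [^] (n::nat) = \<zero>" by (auto simp: S_def)
  then have "q [^] n \<in> loc_kernel {Q}" using qc by (auto simp: loc_kernel_def)
  then show "q \<in> P" using P qc by (auto simp: Spec_power_iff)
qed

text \<open>As there are only finitely many minimal primes, \<open>loc_kernel A\<close> is a finite intersection, and a prime containing it
  contains the kernel for a single prime of \<open>A\<close>, hence this prime itself.\<close>

lemma loc_kernel_Min:
  assumes A: "A \<subseteq> Min_Spec R" and P: "P \<in> Min_Spec R" "P \<notin> A"
  shows "\<not> loc_kernel A \<subseteq> P"
proof -
  have PS: "P \<in> Spec R" and AS: "A \<subseteq> Spec R" using A P by (auto simp: Min_Spec_def)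
  obtain y where y: "y \<in> carrier R" "y \<notin> P" "\<forall>I\<in>(\<lambda>Q. loc_kernel {Q}) ` A. y \<in> I"
  proof (rule finite_Inter_not_subset_prime[OF PS, of "(\<lambda>Q. loc_kernel {Q}) ` A"])
    show "finite ((\<lambda>Q. loc_kernel {Q}) ` A)" using A finite_Min_Spec finite_subset by blast
    show "ideal I R" if "I \<in> (\<lambda>Q. loc_kernel {Q}) ` A" for I
      using that AS ideal_loc_kernel by auto
    show "\<not> I \<subseteq> P" if I: "I \<in> (\<lambda>Q. loc_kernel {Q}) ` A" for I
    proof
      assume "I \<subseteq> P"
      then obtain Q where Q: "Q \<in> A" "loc_kernel {Q} \<subseteq> P" using I by auto
      then have "Q \<subseteq> P" using loc_kernel_minimal_prime[OF _ PS] A by blast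
      then have "Q = P" using P Q AS by (auto simp: Min_Spec_def)
      then show False using Q P by simp
    qed
  qed
  then have "y \<in> loc_kernel A" by (auto simp: loc_kernel_def)
  then show ?thesis using y by blast
qed

section \<open>Torsion pairs of finitely generated modules\<close>

lemma is_subcategory_mod_cat: "is_subcategory R (mod_cat R)"
  by (auto simp: is_subcategory_def)

lemma extension_closed_mod_cat: "extension_closed R (mod_cat R)"
  by (auto simp: extension_closed_def)

lemma submodule_mod_cat: "X \<in> mod_cat R \<Longrightarrow> submodule N R X \<Longrightarrow> X\<lparr>carrier := N\<rparr> \<in> mod_cat R"
  using fg_submodule by (simp add: mod_cat_def)

lemma torsion_pairs_mod_cat:
  shows "torsion_pairs R (mod_cat R) = (\<lambda>Z. (supported_cat Z, torsionfree_cat Z)) ` {Z. upward_closed Z}"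
    and "weak_torsion_pairs R (mod_cat R) = torsion_pairs R (mod_cat R)"
proof -
  have tors: "(supported_cat Z, torsionfree_cat Z) \<in> torsion_pairs R (mod_cat R)" if Z: "upward_closed Z" for Z
  proof -
    have "supported_cat Z \<inter> mod_cat R = supported_cat Z" "torsionfree_cat Z \<subseteq> mod_cat R"
      by (auto simp: supported_cat_def torsionfree_cat_def)
    then show ?thesis
      using torsion_pairI[OF subset_refl is_subcategory_mod_cat extension_closed_mod_cat submodule_mod_cat Z]
      by simp
  qed
  have weak: "p \<in> (\<lambda>Z. (supported_cat Z, torsionfree_cat Z)) ` {Z. upward_closed Z}"
    if p: "p \<in> weak_torsion_pairs R (mod_cat R)" for p
  proof -
    obtain T F where TF: "p = (T, F)" by fastforce
    define Z where "Z = {Q \<in> Spec R. \<forall>X\<in>F. \<forall>P\<in>ass R X. \<not> Q \<subseteq> P}"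
    have Z: "upward_closed Z" and T: "T = supported_cat Z"
      using weak_torsion_class_supported[OF subset_refl p[unfolded TF] Z_def]
      by (auto simp: supported_cat_def)
    have "(T, torsionfree_cat Z) \<in> weak_torsion_pairs R (mod_cat R)"
      using tors[OF Z] torsion_pairs_subset_weak[OF subset_refl] T by blast
    then have "F = torsionfree_cat Z" using weak_torsion_pair_eq p TF by blast
    then show ?thesis using T TF Z by blast
  qed
  have sub: "torsion_pairs R (mod_cat R) \<subseteq> weak_torsion_pairs R (mod_cat R)"
    by (rule torsion_pairs_subset_weak) simp
  show "torsion_pairs R (mod_cat R) = (\<lambda>Z. (supported_cat Z, torsionfree_cat Z)) ` {Z. upward_closed Z}"
    using tors weak sub by blast
  show "weak_torsion_pairs R (mod_cat R) = torsion_pairs R (mod_cat R)"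
    using tors weak sub by blast
qed

lemma supported_cat_inj:
  assumes "upward_closed Z" "upward_closed Z'" "supported_cat Z = supported_cat Z'"
  shows "Z = Z'"
proof -
  have "Z \<subseteq> Z'" if Z: "upward_closed Z" "supported_cat Z \<subseteq> supported_cat Z'" for Z Z'
  proof
    fix P assume P: "P \<in> Z"
    then have PS: "P \<in> Spec R" using Z by (auto simp: upward_closed_def)
    obtain X where X: "X \<in> mod_cat R" "supp R X = {Q \<in> Spec R. P \<subseteq> Q}"
      by (rule residue_module_exists[OF PS])
    then have "X \<in> supported_cat Z" using Z P by (auto simp: supported_cat_def upward_closed_def)
    then have "X \<in> supported_cat Z'" using Z by blast
    then show "P \<in> Z'" using X PS by (auto simp: supported_cat_def)
  qed
  then show ?thesis using assms by blast
qed

lemma bij_torsion_pairs_mod_cat: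
  "bij_betw (\<lambda>Z. (supported_cat Z, torsionfree_cat Z)) {Z. specialization_closed R Z}
     (torsion_pairs R (mod_cat R))"
  unfolding specialization_closed_iff bij_betw_def torsion_pairs_mod_cat(1)
  using supported_cat_inj by (auto intro!: inj_onI)

text \<open>If the two classes are cut out by ideals \<open>I\<close> and \<open>J\<close>, testing them on \<open>R/P\<close> shows that \<open>Z\<close> and its
  complement are the zero sets of \<open>I\<close> and \<open>J\<close>.\<close>

lemma basic_torsion_pair_mod_cat_iff:
  assumes Z: "upward_closed Z"
  shows "(supported_cat Z, torsionfree_cat Z) \<in> basic_torsion_pairs R (mod_cat R) \<longleftrightarrow>
    closedin (zariski_topology R) Z \<and> closedin (zariski_topology R) (Spec R - Z)"
proof
  assume "(supported_cat Z, torsionfree_cat Z) \<in> basic_torsion_pairs R (mod_cat R)"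
  then obtain I J where I: "ideal I R" "supported_cat Z = annihilated_by (mod_cat R) I"
    and J: "ideal J R" "torsionfree_cat Z = annihilated_by (mod_cat R) J"
    by (auto simp: basic_torsion_pairs_def)
  have iff: "(P \<in> Z \<longleftrightarrow> I \<subseteq> P) \<and> (P \<notin> Z \<longleftrightarrow> J \<subseteq> P)" if P: "P \<in> Spec R" for P
  proof -
    obtain X where X: "X \<in> mod_cat R" "ass R X = {P}" "supp R X = {Q \<in> Spec R. P \<subseteq> Q}"
      "X \<in> annihilated_by (mod_cat R) P" using residue_module_exists[OF P] .
    have ann: "X \<in> annihilated_by (mod_cat R) K \<longleftrightarrow> K \<subseteq> P" if K: "ideal K R" for K
    proof
      obtain x where "x \<in> carrier X" "P = annih R X x" using X(2) unfolding ass_def by blast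
      then show "K \<subseteq> P" if "X \<in> annihilated_by (mod_cat R) K"
        using that K by (auto simp: annihilated_by_def annih_def ideal_iff)
    qed (use X(4) in \<open>auto simp: annihilated_by_def\<close>)
    have "P \<in> Z \<longleftrightarrow> X \<in> supported_cat Z" "P \<notin> Z \<longleftrightarrow> X \<in> torsionfree_cat Z"
      using X Z P by (auto simp: supported_cat_def torsionfree_cat_def upward_closed_def)
    then show ?thesis using ann I J by simp
  qed
  then have "Z = {P \<in> Spec R. I \<subseteq> P}" "Spec R - Z = {P \<in> Spec R. J \<subseteq> P}"
    using Z unfolding upward_closed_def by blast+
  then show "closedin (zariski_topology R) Z \<and> closedin (zariski_topology R) (Spec R - Z)"
    using I(1) J(1) unfolding closedin_zariski[OF is_cring] by blast
next
  assume "closedin (zariski_topology R) Z \<and> closedin (zariski_topology R) (Spec R - Z)"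
  then obtain I J where IJ: "ideal I R" "ideal J R" and ZI: "Z = {P \<in> Spec R. I \<subseteq> P}"
    and ZJ: "Spec R - Z = {P \<in> Spec R. J \<subseteq> P}"
    by (auto simp: closedin_zariski[OF is_cring])
  have cd: "I \<subseteq> P \<or> J \<subseteq> P" "\<not> (I \<subseteq> P \<and> J \<subseteq> P)" if "P \<in> Spec R" for P
    using that ZI ZJ by blast+
  have s1: "\<not> loc_kernel Z \<subseteq> P" if "P \<in> Spec R - Z" for P
    unfolding ZI using loc_kernel_clopen[OF IJ cd] that ZJ by blast
  have s2: "\<not> loc_kernel (Spec R - Z) \<subseteq> P" if "P \<in> Z" for P
    unfolding ZJ using loc_kernel_clopen[OF IJ(2,1)] cd that ZI by blast
  have as: "ass R X \<subseteq> Spec R" "supp R X \<subseteq> Spec R" for X :: "'a fgmod" by (auto simp: ass_def supp_def)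
  have ZS: "Z \<subseteq> Spec R" using Z by (simp add: upward_closed_def)
  have cov: "ass R X \<subseteq> Z \<union> (Spec R - Z)" for X :: "'a fgmod" using as by blast
  note * = annihilated_by_loc_kernel[OF subset_refl ZS Diff_subset cov s1 s2]
  have "{X \<in> mod_cat R. supp R X \<inter> (Spec R - Z) = {}} = supported_cat Z"
    using as unfolding supported_cat_def by blast
  moreover have "{X \<in> mod_cat R. ass R X \<subseteq> Spec R - Z} = torsionfree_cat Z"
    using as unfolding torsionfree_cat_def by blast
  ultimately have "supported_cat Z = annihilated_by (mod_cat R) (loc_kernel Z)"
    "torsionfree_cat Z = annihilated_by (mod_cat R) (loc_kernel (Spec R - Z))"
    using * by simp_all
  moreover have "(supported_cat Z, torsionfree_cat Z) \<in> torsion_pairs R (mod_cat R)"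
    unfolding torsion_pairs_mod_cat(1) using Z by blast
  ultimately show "(supported_cat Z, torsionfree_cat Z) \<in> basic_torsion_pairs R (mod_cat R)"
    unfolding basic_torsion_pairs_def using ideal_loc_kernel[OF ZS] ideal_loc_kernel[OF Diff_subset]
    by blast
qed

end

section \<open>Localization\<close>

locale localization = cring R for R (structure) + fixes S
  assumes S_subset: "S \<subseteq> carrier R" and one_S: "\<one> \<in> S"
    and mult_S: "s \<in> S \<Longrightarrow> t \<in> S \<Longrightarrow> s \<otimes> t \<in> S"
begin

lemma S_carrier [simp]: "s \<in> S \<Longrightarrow> s \<in> carrier R" using S_subset by auto

declare one_S [simp] mult_S [simp]

text \<open>Equality of fractions is an equivalence relation; for transitivity, multiply the two witnesses.\<close>

lemma fraction_eq_iff: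
  assumes M: "module R M" and *: "m \<in> carrier M" "n \<in> carrier M" "s \<in> S" "t \<in> S"
  shows "fraction S M m s = fraction S M n t \<longleftrightarrow> (\<exists>u\<in>S. u \<odot>\<^bsub>M\<^esub> (t \<odot>\<^bsub>M\<^esub> m) = u \<odot>\<^bsub>M\<^esub> (s \<odot>\<^bsub>M\<^esub> n))"
proof
  interpret module R M by fact
  assume "fraction S M m s = fraction S M n t"
  moreover have "(n, t) \<in> fraction S M n t" using * one_S by (auto simp: fraction_def)
  ultimately have "(n, t) \<in> fraction S M m s" by simp
  then show "\<exists>u\<in>S. u \<odot>\<^bsub>M\<^esub> (t \<odot>\<^bsub>M\<^esub> m) = u \<odot>\<^bsub>M\<^esub> (s \<odot>\<^bsub>M\<^esub> n)" by (auto simp: fraction_def)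
next
  interpret module R M by fact
  have sub: "fraction S M n t \<subseteq> fraction S M m s"
    if "m \<in> carrier M" "n \<in> carrier M" "s \<in> S" "t \<in> S" "u \<in> S"
      "u \<odot>\<^bsub>M\<^esub> (t \<odot>\<^bsub>M\<^esub> m) = u \<odot>\<^bsub>M\<^esub> (s \<odot>\<^bsub>M\<^esub> n)" for m n s t u
  proof
    fix p assume "p \<in> fraction S M n t"
    then obtain k w v where p: "p = (k, w)" "k \<in> carrier M" "w \<in> S" "v \<in> S"
      "v \<odot>\<^bsub>M\<^esub> (w \<odot>\<^bsub>M\<^esub> n) = v \<odot>\<^bsub>M\<^esub> (t \<odot>\<^bsub>M\<^esub> k)" by (auto simp: fraction_def)
    have "(t \<otimes> (u \<otimes> v)) \<odot>\<^bsub>M\<^esub> (w \<odot>\<^bsub>M\<^esub> m) = v \<odot>\<^bsub>M\<^esub> (w \<odot>\<^bsub>M\<^esub> (u \<odot>\<^bsub>M\<^esub> (t \<odot>\<^bsub>M\<^esub> m)))"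
      using that(1-5) p(2-4) by (simp add: module_simps)
    also have "\<dots> = u \<odot>\<^bsub>M\<^esub> (s \<odot>\<^bsub>M\<^esub> (v \<odot>\<^bsub>M\<^esub> (w \<odot>\<^bsub>M\<^esub> n)))"
      unfolding that(6) using that(1-5) p(2-4) by (simp add: module_simps)
    also have "\<dots> = (t \<otimes> (u \<otimes> v)) \<odot>\<^bsub>M\<^esub> (s \<odot>\<^bsub>M\<^esub> k)"
      unfolding p(5) using that(1-5) p(2-4) by (simp add: module_simps)
    finally show "p \<in> fraction S M m s" using p that by (auto simp: fraction_def)
  qed
  assume "\<exists>u\<in>S. u \<odot>\<^bsub>M\<^esub> (t \<odot>\<^bsub>M\<^esub> m) = u \<odot>\<^bsub>M\<^esub> (s \<odot>\<^bsub>M\<^esub> n)"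
  then obtain u where u: "u \<in> S" "u \<odot>\<^bsub>M\<^esub> (t \<odot>\<^bsub>M\<^esub> m) = u \<odot>\<^bsub>M\<^esub> (s \<odot>\<^bsub>M\<^esub> n)" by blast
  show "fraction S M m s = fraction S M n t"
    using sub[OF * u] sub[OF *(2,1,4,3) u(1) u(2)[symmetric]] by blast
qed

lemma fraction_cancel:
  assumes M: "module R M" and "m \<in> carrier M" "s \<in> S" "t \<in> S"
  shows "fraction S M (t \<odot>\<^bsub>M\<^esub> m) (t \<otimes> s) = fraction S M m s"
proof -
  interpret module R M by fact
  have "\<one> \<odot>\<^bsub>M\<^esub> (s \<odot>\<^bsub>M\<^esub> (t \<odot>\<^bsub>M\<^esub> m)) = \<one> \<odot>\<^bsub>M\<^esub> ((t \<otimes> s) \<odot>\<^bsub>M\<^esub> m)"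
    using assms(2-) by (simp add: module_simps)
  then show ?thesis using assms(2-) one_S by (subst fraction_eq_iff[OF M]) auto
qed

lemma fraction_self: "module R M \<Longrightarrow> m \<in> carrier M \<Longrightarrow> s \<in> S \<Longrightarrow> (m, s) \<in> fraction S M m s"
  using one_S by (auto simp: fraction_def)

lemma carrier_loc_module:
  "X \<in> carrier (loc_module R S M) \<longleftrightarrow> (\<exists>m\<in>carrier M. \<exists>s\<in>S. X = fraction S M m s)"
  by (auto simp: loc_module_def Let_def)

lemma zero_loc_module: "\<zero>\<^bsub>loc_module R S M\<^esub> = fraction S M \<zero>\<^bsub>M\<^esub> \<one>"
  by (simp add: loc_module_def Let_def)

lemma fraction_eq_zero_iff:
  assumes M: "module R M" and "m \<in> carrier M" "s \<in> S"
  shows "fraction S M m s = \<zero>\<^bsub>loc_module R S M\<^esub> \<longleftrightarrow> (\<exists>u\<in>S. u \<odot>\<^bsub>M\<^esub> m = \<zero>\<^bsub>M\<^esub>)"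
proof -
  interpret module R M by fact
  show ?thesis unfolding zero_loc_module using assms(2-) by (subst fraction_eq_iff[OF M]) auto
qed

lemma fraction_add:
  assumes M: "module R M" and *: "m \<in> carrier M" "n \<in> carrier M" "s \<in> S" "t \<in> S"
  shows "fraction S M m s \<oplus>\<^bsub>loc_module R S M\<^esub> fraction S M n t =
    fraction S M (t \<odot>\<^bsub>M\<^esub> m \<oplus>\<^bsub>M\<^esub> s \<odot>\<^bsub>M\<^esub> n) (s \<otimes> t)"
proof -
  interpret module R M by fact
  have eq: "fraction S M (t' \<odot>\<^bsub>M\<^esub> m' \<oplus>\<^bsub>M\<^esub> s' \<odot>\<^bsub>M\<^esub> n') (s' \<otimes> t') =
    fraction S M (t \<odot>\<^bsub>M\<^esub> m \<oplus>\<^bsub>M\<^esub> s \<odot>\<^bsub>M\<^esub> n) (s \<otimes> t)"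
    if a: "(m', s') \<in> fraction S M m s" and b: "(n', t') \<in> fraction S M n t" for m' s' n' t'
  proof -
    obtain u where u: "m' \<in> carrier M" "s' \<in> S" "u \<in> S" "u \<odot>\<^bsub>M\<^esub> (s' \<odot>\<^bsub>M\<^esub> m) = u \<odot>\<^bsub>M\<^esub> (s \<odot>\<^bsub>M\<^esub> m')"
      using a by (auto simp: fraction_def)
    obtain v where v: "n' \<in> carrier M" "t' \<in> S" "v \<in> S" "v \<odot>\<^bsub>M\<^esub> (t' \<odot>\<^bsub>M\<^esub> n) = v \<odot>\<^bsub>M\<^esub> (t \<odot>\<^bsub>M\<^esub> n')"
      using b by (auto simp: fraction_def)
    have "(u \<otimes> v) \<odot>\<^bsub>M\<^esub> ((s \<otimes> t) \<odot>\<^bsub>M\<^esub> (t' \<odot>\<^bsub>M\<^esub> m' \<oplus>\<^bsub>M\<^esub> s' \<odot>\<^bsub>M\<^esub> n')) =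
      v \<odot>\<^bsub>M\<^esub> (t \<odot>\<^bsub>M\<^esub> (t' \<odot>\<^bsub>M\<^esub> (u \<odot>\<^bsub>M\<^esub> (s \<odot>\<^bsub>M\<^esub> m')))) \<oplus>\<^bsub>M\<^esub> u \<odot>\<^bsub>M\<^esub> (s \<odot>\<^bsub>M\<^esub> (s' \<odot>\<^bsub>M\<^esub> (v \<odot>\<^bsub>M\<^esub> (t \<odot>\<^bsub>M\<^esub> n'))))"
      using * u(1-3) v(1-3) by (simp add: module_simps)
    also have "\<dots> = (u \<otimes> v) \<odot>\<^bsub>M\<^esub> ((s' \<otimes> t') \<odot>\<^bsub>M\<^esub> (t \<odot>\<^bsub>M\<^esub> m \<oplus>\<^bsub>M\<^esub> s \<odot>\<^bsub>M\<^esub> n))"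
      unfolding u(4)[symmetric] v(4)[symmetric] using * u(1-3) v(1-3) by (simp add: module_simps)
    finally have "\<exists>w\<in>S. w \<odot>\<^bsub>M\<^esub> ((s \<otimes> t) \<odot>\<^bsub>M\<^esub> (t' \<odot>\<^bsub>M\<^esub> m' \<oplus>\<^bsub>M\<^esub> s' \<odot>\<^bsub>M\<^esub> n')) =
      w \<odot>\<^bsub>M\<^esub> ((s' \<otimes> t') \<odot>\<^bsub>M\<^esub> (t \<odot>\<^bsub>M\<^esub> m \<oplus>\<^bsub>M\<^esub> s \<odot>\<^bsub>M\<^esub> n))"
      using mult_S[OF u(3) v(3)] by blast
    then show ?thesis using * u(1-3) v(1-3) by (subst fraction_eq_iff[OF M]) simp_all
  qed
  have "(\<Union>p\<in>fraction S M m s. \<Union>q\<in>fraction S M n t.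
      fraction S M (snd q \<odot>\<^bsub>M\<^esub> fst p \<oplus>\<^bsub>M\<^esub> snd p \<odot>\<^bsub>M\<^esub> fst q) (snd p \<otimes> snd q)) =
    fraction S M (t \<odot>\<^bsub>M\<^esub> m \<oplus>\<^bsub>M\<^esub> s \<odot>\<^bsub>M\<^esub> n) (s \<otimes> t)"
  proof (rule UN_constant_eq[OF fraction_self[OF M *(1,3)] ballI],
      rule UN_constant_eq[OF fraction_self[OF M *(2,4)] ballI])
    fix p q assume "p \<in> fraction S M m s" "q \<in> fraction S M n t"
    then show "fraction S M (snd q \<odot>\<^bsub>M\<^esub> fst p \<oplus>\<^bsub>M\<^esub> snd p \<odot>\<^bsub>M\<^esub> fst q) (snd p \<otimes> snd q) =
      fraction S M (t \<odot>\<^bsub>M\<^esub> m \<oplus>\<^bsub>M\<^esub> s \<odot>\<^bsub>M\<^esub> n) (s \<otimes> t)"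
      using eq[of "fst p" "snd p" "fst q" "snd q"] by simp
  qed
  then show ?thesis by (simp add: loc_module_def Let_def case_prod_beta)
qed

lemma fraction_smult:
  assumes M: "module R M" and *: "a \<in> carrier R" "n \<in> carrier M" "s \<in> S" "t \<in> S"
  shows "fraction S (self_module R) a s \<odot>\<^bsub>loc_module R S M\<^esub> fraction S M n t =
    fraction S M (a \<odot>\<^bsub>M\<^esub> n) (s \<otimes> t)"
proof -
  interpret module R M by fact
  have eq: "fraction S M (a' \<odot>\<^bsub>M\<^esub> n') (s' \<otimes> t') = fraction S M (a \<odot>\<^bsub>M\<^esub> n) (s \<otimes> t)"
    if a: "(a', s') \<in> fraction S (self_module R) a s" and b: "(n', t') \<in> fraction S M n t" for a' s' n' t'
  proof -
    obtain u where u: "a' \<in> carrier R" "s' \<in> S" "u \<in> S" "u \<otimes> (s' \<otimes> a) = u \<otimes> (s \<otimes> a')"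
      using a by (auto simp: fraction_def)
    obtain v where v: "n' \<in> carrier M" "t' \<in> S" "v \<in> S" "v \<odot>\<^bsub>M\<^esub> (t' \<odot>\<^bsub>M\<^esub> n) = v \<odot>\<^bsub>M\<^esub> (t \<odot>\<^bsub>M\<^esub> n')"
      using b by (auto simp: fraction_def)
    have "(u \<otimes> v) \<odot>\<^bsub>M\<^esub> ((s \<otimes> t) \<odot>\<^bsub>M\<^esub> (a' \<odot>\<^bsub>M\<^esub> n')) = (u \<otimes> (s \<otimes> a')) \<odot>\<^bsub>M\<^esub> (v \<odot>\<^bsub>M\<^esub> (t \<odot>\<^bsub>M\<^esub> n'))"
      using * u(1-3) v(1-3) by (simp add: module_simps)
    also have "\<dots> = (u \<otimes> v) \<odot>\<^bsub>M\<^esub> ((s' \<otimes> t') \<odot>\<^bsub>M\<^esub> (a \<odot>\<^bsub>M\<^esub> n))"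
      unfolding u(4)[symmetric] v(4)[symmetric] using * u(1-3) v(1-3) by (simp add: module_simps)
    finally have "\<exists>w\<in>S. w \<odot>\<^bsub>M\<^esub> ((s \<otimes> t) \<odot>\<^bsub>M\<^esub> (a' \<odot>\<^bsub>M\<^esub> n')) = w \<odot>\<^bsub>M\<^esub> ((s' \<otimes> t') \<odot>\<^bsub>M\<^esub> (a \<odot>\<^bsub>M\<^esub> n))"
      using mult_S[OF u(3) v(3)] by blast
    then show ?thesis using * u(1-3) v(1-3) by (subst fraction_eq_iff[OF M]) simp_all
  qed
  have a: "(a, s) \<in> fraction S (self_module R) a s"
    using fraction_self[OF module_self, of a s] * by simp
  have "(\<Union>p\<in>fraction S (self_module R) a s. \<Union>q\<in>fraction S M n t.
      fraction S M (fst p \<odot>\<^bsub>M\<^esub> fst q) (snd p \<otimes> snd q)) = fraction S M (a \<odot>\<^bsub>M\<^esub> n) (s \<otimes> t)"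
  proof (rule UN_constant_eq[OF a ballI], rule UN_constant_eq[OF fraction_self[OF M *(2,4)] ballI])
    fix p q assume "p \<in> fraction S (self_module R) a s" "q \<in> fraction S M n t"
    then show "fraction S M (fst p \<odot>\<^bsub>M\<^esub> fst q) (snd p \<otimes> snd q) = fraction S M (a \<odot>\<^bsub>M\<^esub> n) (s \<otimes> t)"
      using eq[of "fst p" "snd p" "fst q" "snd q"] by simp
  qed
  then show ?thesis by (simp add: loc_module_def Let_def case_prod_beta)
qed

lemma abelian_group_loc_module:
  assumes M: "module R M"
  shows "abelian_group (loc_module R S M)"
proof -
  interpret module R M by fact
  let ?N = "loc_module R S M"
  have carE: "\<exists>m s. m \<in> carrier M \<and> s \<in> S \<and> X = fraction S M m s" if "X \<in> carrier ?N" for X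
    using that unfolding carrier_loc_module by blast
  have carI: "fraction S M m s \<in> carrier ?N" if "m \<in> carrier M" "s \<in> S" for m s
    using that unfolding carrier_loc_module by blast
  note add = fraction_add[OF M]
  show ?thesis
  proof (rule abelian_groupI)
    fix X Y assume XY: "X \<in> carrier ?N" "Y \<in> carrier ?N"
    obtain m s where X: "m \<in> carrier M" "s \<in> S" "X = fraction S M m s" using carE XY by blast
    obtain n t where Y: "n \<in> carrier M" "t \<in> S" "Y = fraction S M n t" using carE XY by blast
    show "X \<oplus>\<^bsub>?N\<^esub> Y \<in> carrier ?N" using X Y by (simp add: add carI)
    show "X \<oplus>\<^bsub>?N\<^esub> Y = Y \<oplus>\<^bsub>?N\<^esub> X" using X Y by (simp add: add M.a_comm m_comm)
    fix Z assume "Z \<in> carrier ?N"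
    then obtain k w where Z: "k \<in> carrier M" "w \<in> S" "Z = fraction S M k w" using carE by blast
    show "X \<oplus>\<^bsub>?N\<^esub> Y \<oplus>\<^bsub>?N\<^esub> Z = X \<oplus>\<^bsub>?N\<^esub> (Y \<oplus>\<^bsub>?N\<^esub> Z)"
      using X Y Z by (simp add: add module_simps m_assoc)
  next
    show "\<zero>\<^bsub>?N\<^esub> \<in> carrier ?N" by (simp add: zero_loc_module carI)
    fix X assume XC: "X \<in> carrier ?N"
    obtain m s where X: "m \<in> carrier M" "s \<in> S" "X = fraction S M m s" using carE XC by blast
    show "\<zero>\<^bsub>?N\<^esub> \<oplus>\<^bsub>?N\<^esub> X = X" using X by (simp add: zero_loc_module add)
    have "fraction S M (\<ominus>\<^bsub>M\<^esub> m) s \<oplus>\<^bsub>?N\<^esub> X = fraction S M \<zero>\<^bsub>M\<^esub> (s \<otimes> s)"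
      using X by (simp add: add smult_r_minus M.l_neg)
    also have "\<dots> = \<zero>\<^bsub>?N\<^esub>" using X fraction_eq_zero_iff[OF M, of "\<zero>\<^bsub>M\<^esub>" "s \<otimes> s"] by auto
    finally show "\<exists>Y\<in>carrier ?N. Y \<oplus>\<^bsub>?N\<^esub> X = \<zero>\<^bsub>?N\<^esub>" using carI X by (metis M.a_inv_closed)
  qed
qed

abbreviation L where "L \<equiv> loc_ring R S"
abbreviation frac where "frac \<equiv> fraction S (self_module R)"

text \<open>Multiplication of fractions is scalar multiplication on the localized regular module, so the ring axioms reduce to
  facts about localized modules.\<close>

lemma loc_ring_eq:
  "carrier L = carrier (loc_module R S (self_module R))"
  "add L = add (loc_module R S (self_module R))"
  "zero L = zero (loc_module R S (self_module R))"
  "mult L = smult (loc_module R S (self_module R))"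
  by (simp_all add: loc_ring_def loc_module_def Let_def)

lemma carrier_loc_ring: "X \<in> carrier L \<longleftrightarrow> (\<exists>a\<in>carrier R. \<exists>s\<in>S. X = frac a s)"
  unfolding loc_ring_eq carrier_loc_module by simp

lemma one_loc_ring: "\<one>\<^bsub>L\<^esub> = frac \<one> \<one>"
  by (simp add: loc_ring_def Let_def)

lemma zero_loc_ring: "\<zero>\<^bsub>L\<^esub> = frac \<zero> \<one>"
  by (simp add: loc_ring_def Let_def)

lemma frac_add:
  assumes "a \<in> carrier R" "b \<in> carrier R" "s \<in> S" "t \<in> S"
  shows "frac a s \<oplus>\<^bsub>L\<^esub> frac b t = frac (t \<otimes> a \<oplus> s \<otimes> b) (s \<otimes> t)"
  unfolding loc_ring_eq using fraction_add[OF module_self, of a b s t] assms by simp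

lemma frac_mult:
  assumes "a \<in> carrier R" "b \<in> carrier R" "s \<in> S" "t \<in> S"
  shows "frac a s \<otimes>\<^bsub>L\<^esub> frac b t = frac (a \<otimes> b) (s \<otimes> t)"
  unfolding loc_ring_eq using fraction_smult[OF module_self, of a b s t] assms by simp

lemma frac_eq_iff:
  assumes "a \<in> carrier R" "b \<in> carrier R" "s \<in> S" "t \<in> S"
  shows "frac a s = frac b t \<longleftrightarrow> (\<exists>u\<in>S. u \<otimes> (t \<otimes> a) = u \<otimes> (s \<otimes> b))"
  using fraction_eq_iff[OF module_self, of a b s t] assms by simp

lemma frac_cancel:
  assumes "a \<in> carrier R" "s \<in> S" "t \<in> S"
  shows "frac (t \<otimes> a) (t \<otimes> s) = frac a s"
  using fraction_cancel[OF module_self, of a s t] assms by simp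

lemma frac_closed [simp]: "a \<in> carrier R \<Longrightarrow> s \<in> S \<Longrightarrow> frac a s \<in> carrier L"
  unfolding carrier_loc_ring by blast

lemma cring_loc_ring: "cring L"
proof (rule cringI)
  have carE: "\<exists>a s. a \<in> carrier R \<and> s \<in> S \<and> X = frac a s" if "X \<in> carrier L" for X
    using that unfolding carrier_loc_ring by blast
  interpret N: abelian_group "loc_module R S (self_module R)"
    by (rule abelian_group_loc_module[OF module_self])
  show "abelian_group L"
    by (rule abelian_groupI; unfold loc_ring_eq) (auto simp: N.a_ac intro: N.l_neg N.a_inv_closed)
  show "comm_monoid L"
  proof (rule comm_monoidI)
    fix X Y assume XY: "X \<in> carrier L" "Y \<in> carrier L"
    obtain a s where X: "a \<in> carrier R" "s \<in> S" "X = frac a s" using carE XY by blast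
    obtain b t where Y: "b \<in> carrier R" "t \<in> S" "Y = frac b t" using carE XY by blast
    show "X \<otimes>\<^bsub>L\<^esub> Y \<in> carrier L" using X Y by (simp add: frac_mult)
    show "X \<otimes>\<^bsub>L\<^esub> Y = Y \<otimes>\<^bsub>L\<^esub> X" using X Y by (simp add: frac_mult m_comm)
    fix Z assume "Z \<in> carrier L"
    then obtain c w where Z: "c \<in> carrier R" "w \<in> S" "Z = frac c w" using carE by blast
    show "X \<otimes>\<^bsub>L\<^esub> Y \<otimes>\<^bsub>L\<^esub> Z = X \<otimes>\<^bsub>L\<^esub> (Y \<otimes>\<^bsub>L\<^esub> Z)" using X Y Z by (simp add: frac_mult m_assoc)
  next
    show "\<one>\<^bsub>L\<^esub> \<in> carrier L" by (simp add: one_loc_ring)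
    fix X assume "X \<in> carrier L"
    then obtain a s where X: "a \<in> carrier R" "s \<in> S" "X = frac a s" using carE by blast
    then show "\<one>\<^bsub>L\<^esub> \<otimes>\<^bsub>L\<^esub> X = X" by (simp add: one_loc_ring frac_mult)
  qed
  fix X Y Z assume XYZ: "X \<in> carrier L" "Y \<in> carrier L" "Z \<in> carrier L"
  obtain a s where X: "a \<in> carrier R" "s \<in> S" "X = frac a s" using carE XYZ by blast
  obtain b t where Y: "b \<in> carrier R" "t \<in> S" "Y = frac b t" using carE XYZ by blast
  obtain c w where Z: "c \<in> carrier R" "w \<in> S" "Z = frac c w" using carE XYZ by blast
  have "X \<otimes>\<^bsub>L\<^esub> Z \<oplus>\<^bsub>L\<^esub> Y \<otimes>\<^bsub>L\<^esub> Z = frac (w \<otimes> ((t \<otimes> a \<oplus> s \<otimes> b) \<otimes> c)) (w \<otimes> (s \<otimes> t \<otimes> w))"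
    using X Y Z by (simp add: frac_mult frac_add l_distr r_distr m_ac)
  also have "\<dots> = (X \<oplus>\<^bsub>L\<^esub> Y) \<otimes>\<^bsub>L\<^esub> Z" using X Y Z by (simp add: frac_mult frac_add frac_cancel)
  finally show "(X \<oplus>\<^bsub>L\<^esub> Y) \<otimes>\<^bsub>L\<^esub> Z = X \<otimes>\<^bsub>L\<^esub> Z \<oplus>\<^bsub>L\<^esub> Y \<otimes>\<^bsub>L\<^esub> Z" by simp
qed

end

section \<open>Localization at a prime ideal\<close>

locale prime_localization = cring R for R (structure) + fixes P
  assumes prime_P: "P \<in> Spec R"
begin

sublocale localization R "carrier R - P"
  using Spec_one[OF prime_P] prime_P by unfold_locales (auto simp: Spec_mult_iff)

definition extend where "extend Q = {frac a s | a s. a \<in> Q \<and> s \<in> carrier R - P}"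

lemma frac_in_extend_iff:
  assumes Q: "Q \<in> Spec R" "Q \<subseteq> P" and as: "a \<in> carrier R" "s \<in> carrier R - P"
  shows "frac a s \<in> extend Q \<longleftrightarrow> a \<in> Q"
proof
  assume "frac a s \<in> extend Q"
  then obtain b t where b: "b \<in> Q" "t \<in> carrier R - P" "frac a s = frac b t" by (auto simp: extend_def)
  have bc: "b \<in> carrier R" using b Spec_subset[OF Q(1)] by auto
  obtain u where u: "u \<in> carrier R - P" "u \<otimes> (t \<otimes> a) = u \<otimes> (s \<otimes> b)"
    using b as bc frac_eq_iff[of a b s t] by auto
  have "u \<otimes> (s \<otimes> b) \<in> Q" using u(1) b as bc Q(1) by (simp add: Spec_mult_iff)
  then have "u \<otimes> (t \<otimes> a) \<in> Q" using u(2) by simp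
  then show "a \<in> Q" using u(1) b(2) as Q by (auto simp: Spec_mult_iff)
qed (use as in \<open>auto simp: extend_def\<close>)

lemma carrier_LE:
  assumes "X \<in> carrier L"
  obtains a s where "a \<in> carrier R" "s \<in> carrier R - P" "X = frac a s"
  using assms unfolding carrier_loc_ring by blast

lemma extend_Spec:
  assumes Q: "Q \<in> Spec R" "Q \<subseteq> P"
  shows "extend Q \<in> Spec L"
proof -
  note iff = frac_in_extend_iff[OF Q]
  have Qc: "Q \<subseteq> carrier R" using Q Spec_subset by blast
  have sub: "extend Q \<subseteq> carrier L"
    using Qc by (auto simp: extend_def)
  have Qadd: "a \<oplus> b \<in> Q" if "a \<in> Q" "b \<in> Q" for a b
    using that Spec_ideal[OF Q(1)] by (simp add: ideal_iff)
  show ?thesis unfolding cring.Spec_iff[OF cring_loc_ring] cring.ideal_iff[OF cring_loc_ring]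
  proof (intro conjI ballI impI)
    show "extend Q \<subseteq> carrier L" by (rule sub)
    show "\<zero>\<^bsub>L\<^esub> \<in> extend Q" using iff[of \<zero> \<one>] Spec_zero[OF Q(1)] one_S by (simp add: zero_loc_ring)
    show "\<one>\<^bsub>L\<^esub> \<notin> extend Q" using iff[of \<one> \<one>] Spec_one[OF Q(1)] one_S by (simp add: one_loc_ring)
  next
    fix X Y assume XY: "X \<in> extend Q" "Y \<in> extend Q"
    obtain a s where X: "a \<in> Q" "s \<in> carrier R - P" "X = frac a s" using XY by (auto simp: extend_def)
    obtain b t where Y: "b \<in> Q" "t \<in> carrier R - P" "Y = frac b t" using XY by (auto simp: extend_def)
    have c: "a \<in> carrier R" "b \<in> carrier R" using X Y Qc by auto
    have "X \<oplus>\<^bsub>L\<^esub> Y = frac (t \<otimes> a \<oplus> s \<otimes> b) (s \<otimes> t)" using X Y c frac_add by simp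
    moreover have "t \<otimes> a \<oplus> s \<otimes> b \<in> Q" using X Y c Q(1) by (intro Qadd) (auto simp: Spec_mult_iff)
    moreover have "s \<otimes> t \<in> carrier R - P" using X Y mult_S by blast
    ultimately show "X \<oplus>\<^bsub>L\<^esub> Y \<in> extend Q" unfolding extend_def by blast
  next
    fix Y X assume Y: "Y \<in> carrier L" and X: "X \<in> extend Q"
    obtain b t where b: "b \<in> carrier R" "t \<in> carrier R - P" "Y = frac b t" using Y by (rule carrier_LE)
    obtain a s where a: "a \<in> Q" "s \<in> carrier R - P" "X = frac a s" using X by (auto simp: extend_def)
    have ac: "a \<in> carrier R" using a Qc by auto
    have "Y \<otimes>\<^bsub>L\<^esub> X = frac (b \<otimes> a) (t \<otimes> s)" using a b ac frac_mult by simp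
    moreover have "b \<otimes> a \<in> Q" using a b ac Q(1) by (simp add: Spec_mult_iff)
    moreover have "t \<otimes> s \<in> carrier R - P" using a b mult_S by blast
    ultimately show "Y \<otimes>\<^bsub>L\<^esub> X \<in> extend Q" unfolding extend_def by blast
  next
    fix X Y assume X: "X \<in> carrier L" and Y: "Y \<in> carrier L" and XY: "X \<otimes>\<^bsub>L\<^esub> Y \<in> extend Q"
    obtain a s where a: "a \<in> carrier R" "s \<in> carrier R - P" "X = frac a s" using X by (rule carrier_LE)
    obtain b t where b: "b \<in> carrier R" "t \<in> carrier R - P" "Y = frac b t" using Y by (rule carrier_LE)
    have "frac (a \<otimes> b) (s \<otimes> t) \<in> extend Q" using XY a b by (simp add: frac_mult)
    then have "a \<otimes> b \<in> Q" using iff[of "a \<otimes> b" "s \<otimes> t"] a b mult_S[of s t] by simp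
    then have "a \<in> Q \<or> b \<in> Q" using a b Q(1) by (simp add: Spec_mult_iff)
    then show "X \<in> extend Q \<or> Y \<in> extend Q" using a b iff by simp
  qed
qed

text \<open>The ring is local: a fraction whose numerator lies outside \<open>P\<close> is invertible.\<close>

lemma proper_ideal_subset_extend:
  assumes J: "ideal J L" "J \<noteq> carrier L"
  shows "J \<subseteq> extend P"
proof
  interpret L: cring L by (rule cring_loc_ring)
  fix X assume X: "X \<in> J"
  then have "X \<in> carrier L" using J(1) unfolding L.ideal_iff by blast
  then obtain a s where a: "a \<in> carrier R" "s \<in> carrier R - P" "X = frac a s" by (rule carrier_LE)
  show "X \<in> extend P"
  proof (rule ccontr)
    assume "X \<notin> extend P"
    then have as: "a \<in> carrier R - P" using a unfolding extend_def by blast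
    have "frac s a \<otimes>\<^bsub>L\<^esub> X = frac (s \<otimes> a) (a \<otimes> s)" using a as frac_mult by simp
    also have "\<dots> = \<one>\<^bsub>L\<^esub>"
      using frac_cancel[of \<one> \<one> "a \<otimes> s"] a as mult_S[of a s] one_S by (simp add: one_loc_ring m_comm)
    finally have "\<one>\<^bsub>L\<^esub> \<in> J"
      using X J(1) a as frac_closed[of s a] unfolding L.ideal_iff by (metis DiffD1)
    then show False using J ideal.one_imp_carrier by blast
  qed
qed

lemma the_maximal_ideal: "(THE \<mm>. maximalideal \<mm> L) = extend P"
proof (rule the_equality)
  interpret L: cring L by (rule cring_loc_ring)
  have eP: "extend P \<in> Spec L" by (rule extend_Spec[OF prime_P subset_refl])
  show "maximalideal (extend P) L"
  proof (rule maximalidealI)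
    show "ideal (extend P) L" using eP by (rule L.Spec_ideal)
    show "carrier L \<noteq> extend P" using L.Spec_one[OF eP] by auto
    show "J = extend P \<or> J = carrier L" if "ideal J L" "extend P \<subseteq> J" for J
      using proper_ideal_subset_extend[OF that(1)] that(2) by blast
  qed
  fix \<mm> assume m: "maximalideal \<mm> L"
  then have "ideal \<mm> L" "\<mm> \<noteq> carrier L"
    using maximalideal.axioms(1) maximalideal.I_notcarr by blast+
  then have "\<mm> \<subseteq> extend P" by (rule proper_ideal_subset_extend)
  then show "\<mm> = extend P"
    using maximalideal.I_maximal[OF m L.Spec_ideal[OF eP]] L.Spec_subset[OF eP] L.Spec_one[OF eP] by auto
qed

definition contract where "contract J = {a \<in> carrier R. frac a \<one> \<in> J}"

lemma frac_mem_contract: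
  assumes J: "J \<in> Spec L" and as: "a \<in> carrier R" "s \<in> carrier R - P"
  shows "frac a s \<in> J \<longleftrightarrow> a \<in> contract J"
proof -
  interpret L: cring L by (rule cring_loc_ring)
  have one: "\<one> \<in> carrier R - P" by (rule one_S)
  have "frac s \<one> \<otimes>\<^bsub>L\<^esub> frac a s = frac (s \<otimes> a) (s \<otimes> \<one>)"
    using as one frac_mult[of s a \<one> s] by simp
  also have "\<dots> = frac a \<one>" using as one frac_cancel[of a \<one> s] by simp
  finally have e1: "frac s \<one> \<otimes>\<^bsub>L\<^esub> frac a s = frac a \<one>" .
  have e2: "frac \<one> s \<otimes>\<^bsub>L\<^esub> frac a \<one> = frac a s" using as one frac_mult[of \<one> a s \<one>] by simp
  have "frac s \<one> \<in> carrier L" "frac a s \<in> carrier L" "frac \<one> s \<in> carrier L" "frac a \<one> \<in> carrier L"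
    using as one by auto
  then have "frac a s \<in> J \<longleftrightarrow> frac a \<one> \<in> J" using J e1 e2 L.Spec_mult_iff[OF J] by metis
  then show ?thesis using as by (simp add: contract_def)
qed

lemma contract_Spec:
  assumes J: "J \<in> Spec L"
  shows "contract J \<in> Spec R" and "contract J \<subseteq> P"
proof -
  interpret L: cring L by (rule cring_loc_ring)
  have one: "\<one> \<in> carrier R - P" by (rule one_S)
  have mult: "frac (a \<otimes> b) \<one> = frac a \<one> \<otimes>\<^bsub>L\<^esub> frac b \<one>" if "a \<in> carrier R" "b \<in> carrier R" for a b
    using that one frac_mult[of a b \<one> \<one>] by simp
  have add: "frac (a \<oplus> b) \<one> = frac a \<one> \<oplus>\<^bsub>L\<^esub> frac b \<one>" if "a \<in> carrier R" "b \<in> carrier R" for a b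
    using that one frac_add[of a b \<one> \<one>] by simp
  have idl: "ideal J L" using J by (rule L.Spec_ideal)
  have c1: "frac a \<one> \<in> carrier L" if "a \<in> carrier R" for a using that one by simp
  show "contract J \<in> Spec R" unfolding Spec_iff ideal_iff
  proof (intro conjI ballI impI)
    show "contract J \<subseteq> carrier R" by (auto simp: contract_def)
    show "\<zero> \<in> contract J" using L.Spec_zero[OF J] by (simp add: contract_def zero_loc_ring)
    show "\<one> \<notin> contract J" using L.Spec_one[OF J] by (simp add: contract_def one_loc_ring)
    show "a \<oplus> b \<in> contract J" if "a \<in> contract J" "b \<in> contract J" for a b
      using that idl unfolding L.ideal_iff by (simp add: contract_def add)
    show "b \<otimes> a \<in> contract J" if "b \<in> carrier R" "a \<in> contract J" for a b
      using that L.Spec_mult_iff[OF J] c1 by (simp add: contract_def mult)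
    show "a \<in> contract J \<or> b \<in> contract J"
      if "a \<in> carrier R" "b \<in> carrier R" "a \<otimes> b \<in> contract J" for a b
      using that L.Spec_mult_iff[OF J] c1 by (simp add: contract_def mult)
  qed
  have "J \<subseteq> extend P"
    using proper_ideal_subset_extend[OF idl] L.Spec_one[OF J] by blast
  then show "contract J \<subseteq> P"
    using frac_in_extend_iff[OF prime_P subset_refl _ one] by (auto simp: contract_def)
qed

text \<open>Primes of \<open>R\<^sub>P\<close> are determined by their contractions to \<open>R\<close>, which are primes inside \<open>P\<close>.  So a strict chain
  of primes of \<open>R\<^sub>P\<close> yields one below \<open>P\<close>.\<close>

lemma contract_strict_mono:
  assumes J: "J \<in> Spec L" "K \<in> Spec L" and lt: "J \<subset> K"
  shows "contract J \<subset> contract K"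
proof -
  interpret L: cring L by (rule cring_loc_ring)
  obtain X where X: "X \<in> K" "X \<notin> J" using lt by blast
  then have "X \<in> carrier L" using L.Spec_subset[OF J(2)] by blast
  then obtain a s where a: "a \<in> carrier R" "s \<in> carrier R - P" "X = frac a s" by (rule carrier_LE)
  then have "a \<in> contract K" "a \<notin> contract J" using X frac_mem_contract J by auto
  moreover have "contract J \<subseteq> contract K" using lt by (auto simp: contract_def)
  ultimately show ?thesis by blast
qed

lemma krull_dim_minimal:
  assumes "P \<in> Min_Spec R"
  shows "krull_dim L = 0"
proof -
  have "n = 0" if ch: "\<forall>i\<le>n. I i \<in> Spec L" "\<forall>i<n. I i \<subset> I (Suc i)" for n I
  proof (rule ccontr)
    assume "n \<noteq> 0"
    then have "I 0 \<in> Spec L" "I 1 \<in> Spec L" "I 0 \<subset> I 1" using ch by auto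
    then have "contract (I 0) \<subset> contract (I 1)" "contract (I 1) \<subseteq> P" "contract (I 0) \<in> Spec R"
      using contract_strict_mono contract_Spec by auto
    moreover from this have "contract (I 0) = P" using assms unfolding Min_Spec_def by blast
    ultimately show False by blast
  qed
  then have "krull_dim L \<le> 0" unfolding krull_dim_def by (intro Sup_least) (auto simp: zero_enat_def)
  then show ?thesis by simp
qed

lemma krull_dim_not_minimal:
  assumes "P \<notin> Min_Spec R"
  shows "krull_dim L \<ge> 1"
proof -
  obtain Q where Q: "Q \<in> Spec R" "Q \<subseteq> P" "Q \<noteq> P" using assms prime_P by (auto simp: Min_Spec_def)
  obtain a where a: "a \<in> P" "a \<notin> Q" using Q by blast
  have one: "\<one> \<in> carrier R - P" by (rule one_S)
  have ac: "a \<in> carrier R" using a Spec_subset[OF prime_P] by auto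
  have "extend Q \<subseteq> extend P" using Q(2) by (auto simp: extend_def)
  moreover have "frac a \<one> \<in> extend P" "frac a \<one> \<notin> extend Q"
    using a ac one frac_in_extend_iff[OF prime_P subset_refl] frac_in_extend_iff[OF Q(1,2)] by auto
  ultimately have "extend Q \<subset> extend P" by blast
  then have "enat 1 \<in> {enat n |n. \<exists>I. (\<forall>i\<le>n. I i \<in> Spec L) \<and> (\<forall>i<n. I i \<subset> I (Suc i))}"
    using extend_Spec[OF Q(1,2)] extend_Spec[OF prime_P subset_refl]
    by (intro CollectI exI[of _ 1] conjI refl exI[of _ "\<lambda>i. if i = 0 then extend Q else extend P"]) auto
  then show ?thesis unfolding krull_dim_def one_enat_def by (rule Sup_upper)
qed

lemma depth_pos_iff:
  assumes M: "module R M" and nz: "carrier (loc_module R (carrier R - P) M) \<noteq> {\<zero>\<^bsub>loc_module R (carrier R - P) M\<^esub>}"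
  shows "depth L (loc_module R (carrier R - P) M) \<ge> 1 \<longleftrightarrow>
    (\<exists>xs. xs \<noteq> [] \<and> regular_sequence L (loc_module R (carrier R - P) M) xs \<and> set xs \<subseteq> extend P)"
    (is "?d \<ge> 1 \<longleftrightarrow> ?r")
proof -
  let ?A = "{enat (length xs) |xs. regular_sequence L (loc_module R (carrier R - P) M) xs \<and> set xs \<subseteq> extend P}"
  have d: "?d = Sup ?A" using nz by (simp add: depth_def the_maximal_ideal)
  show ?thesis
  proof
    assume "?d \<ge> 1"
    then have "\<not> Sup ?A \<le> 0" unfolding d by auto
    show ?r
    proof (rule ccontr)
      assume "\<not> ?r"
      then have "Sup ?A \<le> 0" by (intro Sup_least) (auto simp: zero_enat_def)
      then show False using \<open>\<not> Sup ?A \<le> 0\<close> by blast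
    qed
  next
    assume ?r
    then obtain xs where xs: "xs \<noteq> []" "regular_sequence L (loc_module R (carrier R - P) M) xs"
      "set xs \<subseteq> extend P" by blast
    have "(1::enat) \<le> enat (length xs)" using xs(1) by (simp add: one_enat_def Suc_le_eq)
    also have "\<dots> \<le> Sup ?A" using xs by (intro Sup_upper) auto
    finally show "?d \<ge> 1" unfolding d .
  qed
qed

end

section \<open>Serre's condition in terms of associated primes\<close>

lemma seq_mult_Nil:
  assumes "abelian_group N"
  shows "seq_mult N [] = {\<zero>\<^bsub>N\<^esub>}"
proof -
  interpret abelian_group N by fact
  show ?thesis by (auto simp: seq_mult_def)
qed

lemma seq_mult_singleton:
  assumes "abelian_group N" and cl: "\<And>n. n \<in> carrier N \<Longrightarrow> y \<odot>\<^bsub>N\<^esub> n \<in> carrier N"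
  shows "seq_mult N [y] = (\<lambda>n. y \<odot>\<^bsub>N\<^esub> n) ` carrier N"
proof -
  interpret abelian_group N by fact
  have *: "(\<Oplus>\<^bsub>N\<^esub>i\<in>{..<length [y]}. ([y] ! i) \<odot>\<^bsub>N\<^esub> m i) = y \<odot>\<^bsub>N\<^esub> m 0"
    if "m 0 \<in> carrier N" for m
  proof -
    have "{..<length [y]} = {0}" by auto
    then show ?thesis using finsum_insert[of "{}" 0 "\<lambda>i. ([y] ! i) \<odot>\<^bsub>N\<^esub> m i"] that cl by simp
  qed
  show ?thesis
  proof
    show "seq_mult N [y] \<subseteq> (\<lambda>n. y \<odot>\<^bsub>N\<^esub> n) ` carrier N"
    proof
      fix x assume "x \<in> seq_mult N [y]"
      then obtain m where m: "m \<in> {..<length [y]} \<rightarrow> carrier N"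
        "x = (\<Oplus>\<^bsub>N\<^esub>i\<in>{..<length [y]}. ([y] ! i) \<odot>\<^bsub>N\<^esub> m i)" unfolding seq_mult_def by blast
      then have "m 0 \<in> carrier N" by auto
      then show "x \<in> (\<lambda>n. y \<odot>\<^bsub>N\<^esub> n) ` carrier N" using *[of m] m(2) by simp
    qed
    show "(\<lambda>n. y \<odot>\<^bsub>N\<^esub> n) ` carrier N \<subseteq> seq_mult N [y]"
    proof
      fix x assume "x \<in> (\<lambda>n. y \<odot>\<^bsub>N\<^esub> n) ` carrier N"
      then obtain n where n: "n \<in> carrier N" "x = y \<odot>\<^bsub>N\<^esub> n" by blast
      have "x = (\<Oplus>\<^bsub>N\<^esub>i\<in>{..<length [y]}. ([y] ! i) \<odot>\<^bsub>N\<^esub> (\<lambda>_. n) i)" using *[of "\<lambda>_. n"] n by simp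
      moreover have "(\<lambda>_. n) \<in> {..<length [y]} \<rightarrow> carrier N" using n by simp
      ultimately show "x \<in> seq_mult N [y]" 
        unfolding seq_mult_def by (intro CollectI exI[of _ "\<lambda>_. n"] conjI)
    qed
  qed
qed

context noetherian_cring begin

text \<open>Prime avoidance: if \<open>x \<in> P\<close> avoids the primes of \<open>F\<close> but lies in \<open>Q\<close>, add an element outside
  \<open>Q\<close> that lies in \<open>P\<close> and in all members of \<open>F\<close>.  It exists since the minimal prime \<open>Q\<close>
  contains none of these primes.\<close>

lemma avoid_minimal_primes:
  assumes P: "P \<in> Spec R" "P \<notin> Min_Spec R" and F: "finite F" "F \<subseteq> Min_Spec R"
  shows "\<exists>x\<in>P. \<forall>Q\<in>F. x \<notin> Q"
  using F
proof (induction F)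
  case empty
  then show ?case using Spec_zero P by auto
next
  case (insert Q F)
  then obtain x where x: "x \<in> P" "\<forall>Q\<in>F. x \<notin> Q" by auto
  have Q: "Q \<in> Spec R" "Q \<in> Min_Spec R" and FS: "F \<subseteq> Spec R" "F \<subseteq> Min_Spec R"
    using insert.prems by (auto simp: Min_Spec_def)
  show ?case
  proof (cases "x \<in> Q")
    case False
    then show ?thesis using x by blast
  next
    case True
    obtain y where y: "y \<in> carrier R" "y \<notin> Q" "\<forall>I\<in>insert P F. y \<in> I"
    proof (rule finite_Inter_not_subset_prime[OF Q(1), of "insert P F"])
      show "finite (insert P F)" using insert.hyps by simp
      show "ideal I R" if "I \<in> insert P F" for I using that FS P Spec_ideal by auto
      show "\<not> I \<subseteq> Q" if I: "I \<in> insert P F" for I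
      proof
        assume "I \<subseteq> Q"
        then have "I = Q" using Q(2) I FS P(1) unfolding Min_Spec_def by blast
        then show False using I Q(2) P(2) insert.hyps by auto
      qed
    qed
    have xc: "x \<in> carrier R" using x P Spec_subset by auto
    have "x \<oplus> y \<in> P" using Spec_add_iff[OF P(1) x(1) y(1)] y by simp
    moreover have "x \<oplus> y \<notin> Q" using Spec_add_iff[OF Q(1) True y(1)] y by simp
    moreover have "x \<oplus> y \<notin> Q'" if "Q' \<in> F" for Q'
    proof -
      have "Q' \<in> Spec R" using that FS by blast
      then have "y \<oplus> x \<in> Q' \<longleftrightarrow> x \<in> Q'" using Spec_add_iff[of Q' y x] xc y(3) that by blast
      then show ?thesis using x that xc y(1) by (simp add: a_comm)
    qed
    ultimately show ?thesis by blast
  qed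
qed

lemma nonzerodivisor_of_assoc_primes:
  assumes M: "module R M" and x: "x \<in> carrier R" "\<And>Q. Q \<in> ass R M \<Longrightarrow> x \<notin> Q"
    and m: "m \<in> carrier M" "x \<odot>\<^bsub>M\<^esub> m = \<zero>\<^bsub>M\<^esub>"
  shows "m = \<zero>\<^bsub>M\<^esub>"
proof (rule ccontr)
  interpret module R M by fact
  assume "m \<noteq> \<zero>\<^bsub>M\<^esub>"
  then obtain r where r: "r \<in> carrier R" "annih R M (r \<odot>\<^bsub>M\<^esub> m) \<in> ass R M"
    using assoc_prime_exists[OF M m(1)] by blast
  have "x \<in> annih R M m" using x m by (simp add: annih_def)
  then have "x \<in> annih R M (r \<odot>\<^bsub>M\<^esub> m)" using annih_smult_mono[OF M m(1) r(1)] by blast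
  then show False using x(2) r(2) by blast
qed

text \<open>Depth at least \<open>1\<close> of a nonzero \<open>M\<^sub>P\<close> means that \<open>P\<close> contains a nonzerodivisor on \<open>M\<^sub>P\<close>, and this is demanded
  exactly at the primes that are not minimal.  No such \<open>P\<close> can be associated, since it would kill a nonzero element of
  \<open>M\<^sub>P\<close>.  Conversely, if all associated primes are minimal, prime avoidance yields an \<open>x \<in> P\<close> in none of them, which
  is a nonzerodivisor, and \<open>x M\<^sub>P\<close> is proper by Nakayama's lemma.\<close>

lemma S1_cat_eq: "S1_cat R = {M \<in> mod_cat R. ass R M \<subseteq> Min_Spec R}"
proof (intro equalityI subsetI)
  fix M assume "M \<in> S1_cat R"
  then have Mc: "M \<in> mod_cat R" and S1: "\<And>P. P \<in> Spec R \<Longrightarrow>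
      depth (loc_ring R (carrier R - P)) (loc_module R (carrier R - P) M)
        \<ge> min 1 (krull_dim (loc_ring R (carrier R - P)))"
    by (auto simp: S1_cat_def)
  have M: "module R M" using mod_catD(2)[OF Mc] .
  have "P \<in> Min_Spec R" if P: "P \<in> ass R M" for P
  proof (rule ccontr)
    assume nmin: "P \<notin> Min_Spec R"
    have PS: "P \<in> Spec R" using P by (simp add: ass_def)
    interpret prime_localization R P using PS by unfold_locales
    interpret module R M by fact
    let ?S = "carrier R - P"
    let ?N = "loc_module R ?S M"
    interpret N: abelian_group ?N by (rule abelian_group_loc_module[OF M])
    obtain m where m: "m \<in> carrier M" "P = annih R M m" using P by (auto simp: ass_def)
    have one: "\<one> \<in> ?S" by (rule one_S)
    \<comment> \<open>\<open>m/1\<close> is a nonzero element killed by the whole maximal ideal, in particular by the first member of a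
    regular sequence\<close>
    have nz: "fraction ?S M m \<one> \<noteq> \<zero>\<^bsub>?N\<^esub>"
    proof
      assume "fraction ?S M m \<one> = \<zero>\<^bsub>?N\<^esub>"
      then obtain u where "u \<in> ?S" "u \<odot>\<^bsub>M\<^esub> m = \<zero>\<^bsub>M\<^esub>"
        using fraction_eq_zero_iff[OF M m(1) one] by blast
      then have "u \<in> annih R M m" "u \<notin> P" by (simp_all add: annih_def)
      then show False using m(2) by simp
    qed
    have mc: "fraction ?S M m \<one> \<in> carrier ?N" unfolding carrier_loc_module using m one by blast
    have nz': "carrier ?N \<noteq> {\<zero>\<^bsub>?N\<^esub>}" using nz mc by blast
    have "depth L ?N \<ge> 1" using S1[OF PS] krull_dim_not_minimal[OF nmin] by (simp add: min_def split: if_splits)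
    then have "\<exists>xs. xs \<noteq> [] \<and> regular_sequence L ?N xs \<and> set xs \<subseteq> extend P"
      by (rule iffD1[OF depth_pos_iff[OF M nz']])
    then obtain xs where xs: "xs \<noteq> []" "regular_sequence L ?N xs" "set xs \<subseteq> extend P"
      by (elim exE conjE)
    then have "xs ! 0 \<in> extend P" by auto
    then obtain a s where a: "a \<in> P" "s \<in> ?S" "xs ! 0 = frac a s" by (auto simp: extend_def)
    have "a \<in> annih R M m" using a(1) m(2) by simp
    then have ac: "a \<in> carrier R" "a \<odot>\<^bsub>M\<^esub> m = \<zero>\<^bsub>M\<^esub>" by (simp_all add: annih_def)
    have "(xs ! 0) \<odot>\<^bsub>?N\<^esub> fraction ?S M m \<one> = fraction ?S M (a \<odot>\<^bsub>M\<^esub> m) (s \<otimes> \<one>)"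
      unfolding a(3) by (rule fraction_smult[OF M ac(1) m(1) a(2) one])
    also have "\<dots> = \<zero>\<^bsub>?N\<^esub>"
      unfolding ac(2) using fraction_eq_zero_iff[OF M, of "\<zero>\<^bsub>M\<^esub>" "s \<otimes> \<one>"] a(2) one by auto
    finally have "(xs ! 0) \<odot>\<^bsub>?N\<^esub> fraction ?S M m \<one> \<in> seq_mult ?N (take 0 xs)"
      by (simp add: seq_mult_Nil[OF N.abelian_group_axioms])
    then have "fraction ?S M m \<one> \<in> seq_mult ?N (take 0 xs)"
      using xs mc unfolding regular_sequence_def by blast
    then show False using nz by (simp add: seq_mult_Nil[OF N.abelian_group_axioms])
  qed
  then show "M \<in> {M \<in> mod_cat R. ass R M \<subseteq> Min_Spec R}" using Mc by blast
next
  fix M assume "M \<in> {M \<in> mod_cat R. ass R M \<subseteq> Min_Spec R}"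
  then have Mc: "M \<in> mod_cat R" and ass: "ass R M \<subseteq> Min_Spec R" by auto
  have M: "module R M" using mod_catD(2)[OF Mc] .
  have "depth (loc_ring R (carrier R - P)) (loc_module R (carrier R - P) M)
        \<ge> min 1 (krull_dim (loc_ring R (carrier R - P)))" if PS: "P \<in> Spec R" for P
  proof -
    interpret prime_localization R P using PS by unfold_locales
    interpret module R M by fact
    let ?S = "carrier R - P"
    let ?N = "loc_module R ?S M"
    interpret N: abelian_group ?N by (rule abelian_group_loc_module[OF M])
    have one: "\<one> \<in> ?S" by (rule one_S)
    consider "P \<in> Min_Spec R" | "carrier ?N = {\<zero>\<^bsub>?N\<^esub>}" | "P \<notin> Min_Spec R" "carrier ?N \<noteq> {\<zero>\<^bsub>?N\<^esub>}"
      by blast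
    then show ?thesis
    proof cases
      case 1
      then show ?thesis using krull_dim_minimal by simp
    next
      case 2
      then show ?thesis by (simp add: depth_def)
    next
      case 3
      obtain x where x: "x \<in> P" "\<forall>Q\<in>Min_Spec R. x \<notin> Q"
        using avoid_minimal_primes[OF PS 3(1) finite_Min_Spec subset_refl] by blast
      have xc: "x \<in> carrier R" using x Spec_subset[OF PS] by auto
      have nzd: "m = \<zero>\<^bsub>M\<^esub>" if "m \<in> carrier M" "x \<odot>\<^bsub>M\<^esub> m = \<zero>\<^bsub>M\<^esub>" for m
        using nonzerodivisor_of_assoc_primes[OF M xc _ that] x(2) ass by blast
      have smult: "frac x \<one> \<odot>\<^bsub>?N\<^esub> fraction ?S M m s = fraction ?S M (x \<odot>\<^bsub>M\<^esub> m) s"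
        if "m \<in> carrier M" "s \<in> ?S" for m s
        using fraction_smult[OF M xc that(1) one that(2)] that by simp
      have carE: "\<exists>m s. m \<in> carrier M \<and> s \<in> ?S \<and> X = fraction ?S M m s" if "X \<in> carrier ?N" for X
        using that unfolding carrier_loc_module by blast
      have carI: "fraction ?S M m s \<in> carrier ?N" if "m \<in> carrier M" "s \<in> ?S" for m s
        using that unfolding carrier_loc_module by blast
      have cl: "frac x \<one> \<odot>\<^bsub>?N\<^esub> X \<in> carrier ?N" if X: "X \<in> carrier ?N" for X
      proof -
        obtain m s where "m \<in> carrier M" "s \<in> ?S" "X = fraction ?S M m s" using carE[OF X] by blast
        then show ?thesis using smult carI xc by simp
      qed
      have reg: "X = \<zero>\<^bsub>?N\<^esub>" if X: "X \<in> carrier ?N" "frac x \<one> \<odot>\<^bsub>?N\<^esub> X = \<zero>\<^bsub>?N\<^esub>" for X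
      proof -
        obtain m s where m: "m \<in> carrier M" "s \<in> ?S" "X = fraction ?S M m s" using carE[OF X(1)] by blast
        have "fraction ?S M (x \<odot>\<^bsub>M\<^esub> m) s = \<zero>\<^bsub>?N\<^esub>" using X(2) smult m by simp
        then obtain u where u: "u \<in> ?S" "u \<odot>\<^bsub>M\<^esub> (x \<odot>\<^bsub>M\<^esub> m) = \<zero>\<^bsub>M\<^esub>"
          using fraction_eq_zero_iff[OF M, of "x \<odot>\<^bsub>M\<^esub> m" s] m xc by auto
        then have "x \<odot>\<^bsub>M\<^esub> (u \<odot>\<^bsub>M\<^esub> m) = \<zero>\<^bsub>M\<^esub>" using smult_lcomm[of x u m] xc m by simp
        then have "u \<odot>\<^bsub>M\<^esub> m = \<zero>\<^bsub>M\<^esub>" using nzd u m by simp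
        then show ?thesis using fraction_eq_zero_iff[OF M m(1,2)] u m(3) by blast
      qed
      have "seq_mult ?N [frac x \<one>] \<noteq> carrier ?N"
      proof
        \<comment> \<open>Nakayama: \<open>x\<close> multiplies \<open>M\<close> into a proper saturated submodule \<open>K\<close>, so that no fraction
          \<open>y/1\<close> with \<open>y \<notin> K\<close> is a multiple of \<open>x/1\<close>.\<close>
        assume full: "seq_mult ?N [frac x \<one>] = carrier ?N"
        obtain X where X: "X \<in> carrier ?N" "X \<noteq> \<zero>\<^bsub>?N\<^esub>" using 3(2) N.zero_closed by blast
        obtain m s where m: "m \<in> carrier M" "s \<in> ?S" "X = fraction ?S M m s" using carE[OF X(1)] by blast
        have "annih R M m \<subseteq> P"
        proof
          fix u assume u: "u \<in> annih R M m"
          show "u \<in> P"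
          proof (rule ccontr)
            assume "u \<notin> P"
            then have "u \<in> ?S" "u \<odot>\<^bsub>M\<^esub> m = \<zero>\<^bsub>M\<^esub>" using u by (simp_all add: annih_def)
            then show False using X(2) m(3) fraction_eq_zero_iff[OF M m(1,2)] by blast
          qed
        qed
        then have "P \<in> supp R M" using PS m by (auto simp: supp_def)
        then obtain K where K: "submodule K R M" "K \<noteq> carrier M"
          "\<forall>s\<in>?S. \<forall>m\<in>carrier M. s \<odot>\<^bsub>M\<^esub> m \<in> K \<longrightarrow> m \<in> K" "\<forall>p\<in>P. \<forall>m\<in>carrier M. p \<odot>\<^bsub>M\<^esub> m \<in> K"
          by (rule maximal_saturated_submodule[OF mod_catD(1)[OF Mc]])
        obtain y where y: "y \<in> carrier M" "y \<notin> K" using K(1,2) unfolding submodule_iff by blast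
        have "fraction ?S M y \<one> \<in> seq_mult ?N [frac x \<one>]" using full carI[OF y(1) one] by simp
        also have "seq_mult ?N [frac x \<one>] = (\<lambda>X. frac x \<one> \<odot>\<^bsub>?N\<^esub> X) ` carrier ?N"
          by (rule seq_mult_singleton[OF N.abelian_group_axioms cl])
        finally obtain Y where Y: "Y \<in> carrier ?N" "fraction ?S M y \<one> = frac x \<one> \<odot>\<^bsub>?N\<^esub> Y" by blast
        obtain n t where n: "n \<in> carrier M" "t \<in> ?S" "Y = fraction ?S M n t" using carE[OF Y(1)] by blast
        have "fraction ?S M y \<one> = fraction ?S M (x \<odot>\<^bsub>M\<^esub> n) t" using Y(2) smult n by simp
        then obtain u where u: "u \<in> ?S" "u \<odot>\<^bsub>M\<^esub> (t \<odot>\<^bsub>M\<^esub> y) = u \<odot>\<^bsub>M\<^esub> (\<one> \<odot>\<^bsub>M\<^esub> (x \<odot>\<^bsub>M\<^esub> n))"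
          using fraction_eq_iff[OF M y(1) _ one n(2), of "x \<odot>\<^bsub>M\<^esub> n"] n xc by auto
        have "u \<odot>\<^bsub>M\<^esub> (\<one> \<odot>\<^bsub>M\<^esub> (x \<odot>\<^bsub>M\<^esub> n)) \<in> K"
          using K(1,4) x(1) n u(1) xc by (simp add: submodule_iff)
        then have "(u \<otimes> t) \<odot>\<^bsub>M\<^esub> y \<in> K" using u n y by (simp add: smult_assoc1)
        moreover have "u \<otimes> t \<in> ?S" using u n mult_S by blast
        ultimately show False using K(3) y by blast
      qed
      then have "regular_sequence L ?N [frac x \<one>]"
        using reg xc one by (simp add: regular_sequence_def seq_mult_Nil[OF N.abelian_group_axioms])
      moreover have "frac x \<one> \<in> extend P" using x one by (auto simp: extend_def)
      ultimately have "depth L ?N \<ge> 1"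
        unfolding depth_pos_iff[OF M 3(2)] by (intro exI[of _ "[frac x \<one>]"]) simp
      then show ?thesis by (meson min.coboundedI1)
    qed
  qed
  then show "M \<in> S1_cat R" using Mc by (simp add: S1_cat_def)
qed

section \<open>Torsion pairs under Serre's condition\<close>

lemma S1_cat_subset: "S1_cat R \<subseteq> mod_cat R"
  by (auto simp: S1_cat_def)

lemma is_subcategory_S1_cat: "is_subcategory R (S1_cat R)"
  unfolding S1_cat_eq by (rule is_subcategoryI) auto

lemma extension_closed_S1_cat: "extension_closed R (S1_cat R)"
  unfolding extension_closed_def
proof (intro ballI impI)
  fix L N M assume LN: "L \<in> S1_cat R" "N \<in> S1_cat R" and M: "M \<in> mod_cat R"
    and "\<exists>f g. short_exact R L f M g N"
  then obtain f g where e: "short_exact R L f M g N" by blast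
  have "module R L" "module R M" "module R N" using LN M S1_cat_subset mod_catD(2) by blast+
  then have "ass R M \<subseteq> ass R L \<union> ass R N" using ass_short_exact e by blast
  then show "M \<in> S1_cat R" using LN M unfolding S1_cat_eq by blast
qed

lemma submodule_S1_cat:
  assumes X: "X \<in> S1_cat R" and N: "submodule N R X"
  shows "X\<lparr>carrier := N\<rparr> \<in> S1_cat R"
proof -
  have Xm: "X \<in> mod_cat R" using X S1_cat_subset by blast
  have Nm: "X\<lparr>carrier := N\<rparr> \<in> mod_cat R" using submodule_mod_cat[OF Xm N] .
  have XM: "module R X" and NM: "module R (X\<lparr>carrier := N\<rparr>)" using Xm Nm mod_catD(2) by blast+
  have "N \<subseteq> carrier X" using N unfolding module.submodule_iff[OF XM] by blast
  then have "ass R (X\<lparr>carrier := N\<rparr>) \<subseteq> ass R X"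
    using ass_inj_hom[OF NM XM inclusion_hom] by (simp add: inj_on_def)
  then show ?thesis using X Nm unfolding S1_cat_eq by blast
qed

text \<open>The complement \<open>Z\<close> of a set \<open>B\<close> of minimal primes is closed under specialization, and a module without associated
  primes in \<open>Z\<close> automatically satisfies \<open>(S\<^sub>1)\<close>.  So the torsion sequence for \<open>Z\<close> of a module in \<open>S1_cat\<close> stays in
  \<open>S1_cat\<close>.\<close>

lemma torsion_pair_S1_cat:
  assumes B: "B \<subseteq> Min_Spec R"
  shows "(supported_cat (Spec R - B) \<inter> S1_cat R, torsionfree_cat (Spec R - B)) \<in> basic_torsion_pairs R (S1_cat R)"
proof -
  have MS: "Min_Spec R \<subseteq> Spec R" by (auto simp: Min_Spec_def)
  have as: "ass R X \<subseteq> Spec R" "supp R X \<subseteq> Spec R" for X :: "'a fgmod" by (auto simp: ass_def supp_def)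
  define A where "A = Min_Spec R - B"
  have uc: "upward_closed (Spec R - B)" using B unfolding upward_closed_def Min_Spec_def by blast
  have tf: "torsionfree_cat (Spec R - B) = {X \<in> S1_cat R. ass R X \<subseteq> B}"
    unfolding torsionfree_cat_def S1_cat_eq using as B by blast
  then have "torsionfree_cat (Spec R - B) \<subseteq> S1_cat R" by blast
  then have tors: "(supported_cat (Spec R - B) \<inter> S1_cat R, torsionfree_cat (Spec R - B))
      \<in> torsion_pairs R (S1_cat R)"
    using torsion_pairI[OF S1_cat_subset is_subcategory_S1_cat extension_closed_S1_cat _ uc]
      submodule_S1_cat by blast
  have s1: "\<not> loc_kernel A \<subseteq> P" if "P \<in> B" for P
    using loc_kernel_Min[of A P] that B by (auto simp: A_def)
  have s2: "\<not> loc_kernel B \<subseteq> P" if "P \<in> A" for P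
    using loc_kernel_Min[of B P] that B by (auto simp: A_def)
  have cov: "ass R X \<subseteq> A \<union> B" if "X \<in> S1_cat R" for X
    using that by (auto simp: S1_cat_eq A_def)
  have AB: "A \<subseteq> Spec R" "B \<subseteq> Spec R" using MS B by (auto simp: A_def)
  note ann = annihilated_by_loc_kernel[OF S1_cat_subset AB cov s1 s2]
  have "supported_cat (Spec R - B) \<inter> S1_cat R = {X \<in> S1_cat R. supp R X \<inter> B = {}}"
    unfolding supported_cat_def using as S1_cat_subset by blast
  then have "supported_cat (Spec R - B) \<inter> S1_cat R = annihilated_by (S1_cat R) (loc_kernel A)"
    "torsionfree_cat (Spec R - B) = annihilated_by (S1_cat R) (loc_kernel B)"
    using ann tf by simp_all
  then show ?thesis
    unfolding basic_torsion_pairs_def using tors ideal_loc_kernel[OF AB(1)] ideal_loc_kernel[OF AB(2)]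
    by blast
qed

lemma torsion_pairs_S1_cat:
  shows "weak_torsion_pairs R (S1_cat R) = torsion_pairs R (S1_cat R)"
    and "torsion_pairs R (S1_cat R) = basic_torsion_pairs R (S1_cat R)"
    and "basic_torsion_pairs R (S1_cat R) =
      (\<lambda>B. (supported_cat (Spec R - B) \<inter> S1_cat R, torsionfree_cat (Spec R - B))) ` Pow (Min_Spec R)"
      (is "_ = ?im")
proof -
  have bt: "basic_torsion_pairs R (S1_cat R) \<subseteq> torsion_pairs R (S1_cat R)"
    by (auto simp: basic_torsion_pairs_def)
  have weak: "p \<in> ?im" if p: "p \<in> weak_torsion_pairs R (S1_cat R)" for p
  proof -
    obtain T F where TF: "p = (T, F)" by fastforce
    define Z where "Z = {Q \<in> Spec R. \<forall>X\<in>F. \<forall>P\<in>ass R X. \<not> Q \<subseteq> P}"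
    have T: "T = supported_cat Z \<inter> S1_cat R"
      using weak_torsion_class_supported(2)[OF S1_cat_subset p[unfolded TF] Z_def] .
    have "F \<subseteq> S1_cat R" using p unfolding TF weak_torsion_pairs_iff by blast
    \<comment> \<open>the primes in question are minimal, so that \<open>Z\<close> is simply their complement\<close>
    then have FM: "\<Union>(ass R ` F) \<subseteq> Min_Spec R" unfolding S1_cat_eq by blast
    then have Z: "Z = Spec R - \<Union>(ass R ` F)" unfolding Z_def Min_Spec_def by blast
    have "(supported_cat Z \<inter> S1_cat R, torsionfree_cat Z) \<in> torsion_pairs R (S1_cat R)"
      using torsion_pair_S1_cat[OF FM] bt unfolding Z by blast
    then have "(T, torsionfree_cat Z) \<in> weak_torsion_pairs R (S1_cat R)"
      using torsion_pairs_subset_weak[OF S1_cat_subset] T by blast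
    then have "F = torsionfree_cat Z" using weak_torsion_pair_eq[OF p[unfolded TF]] by simp
    with TF T have "p = (supported_cat Z \<inter> S1_cat R, torsionfree_cat Z)" by simp
    with FM show ?thesis unfolding Z by (intro image_eqI[of _ _ "\<Union>(ass R ` F)"]) auto
  qed
  have im: "?im \<subseteq> basic_torsion_pairs R (S1_cat R)" using torsion_pair_S1_cat by blast
  have tw: "torsion_pairs R (S1_cat R) \<subseteq> weak_torsion_pairs R (S1_cat R)"
    by (rule torsion_pairs_subset_weak[OF S1_cat_subset])
  show "weak_torsion_pairs R (S1_cat R) = torsion_pairs R (S1_cat R)"
    "torsion_pairs R (S1_cat R) = basic_torsion_pairs R (S1_cat R)"
    "basic_torsion_pairs R (S1_cat R) = ?im"
    using weak im bt tw by blast+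
qed

lemma bij_basic_torsion_pairs_S1_cat:
  "bij_betw (\<lambda>B. (supported_cat (Spec R - B) \<inter> S1_cat R, torsionfree_cat (Spec R - B)))
     (Pow (Min_Spec R)) (basic_torsion_pairs R (S1_cat R))"
proof -
  have sub: "B \<subseteq> B'" if B: "B \<subseteq> Min_Spec R" and eq: "torsionfree_cat (Spec R - B) = torsionfree_cat (Spec R - B')"
    for B B'
  proof
    fix P assume P: "P \<in> B"
    then have PS: "P \<in> Spec R" using B by (auto simp: Min_Spec_def)
    obtain X where X: "X \<in> mod_cat R" "ass R X = {P}" by (rule residue_module_exists[OF PS])
    have "X \<in> torsionfree_cat (Spec R - B)" using X P by (simp add: torsionfree_cat_def)
    then have "X \<in> torsionfree_cat (Spec R - B')" using eq by simp
    then show "P \<in> B'" using X(2) PS by (simp add: torsionfree_cat_def)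
  qed
  have "inj_on (\<lambda>B. (supported_cat (Spec R - B) \<inter> S1_cat R, torsionfree_cat (Spec R - B))) (Pow (Min_Spec R))"
  proof (rule inj_onI)
    fix B B' assume *: "B \<in> Pow (Min_Spec R)" "B' \<in> Pow (Min_Spec R)"
      "(supported_cat (Spec R - B) \<inter> S1_cat R, torsionfree_cat (Spec R - B)) =
       (supported_cat (Spec R - B') \<inter> S1_cat R, torsionfree_cat (Spec R - B'))"
    then have "torsionfree_cat (Spec R - B) = torsionfree_cat (Spec R - B')" by simp
    then show "B = B'" using sub[of B B'] sub[of B' B] *(1,2) by auto
  qed
  then show ?thesis unfolding bij_betw_def torsion_pairs_S1_cat(3) by simp
qed

lemma bij_basic_torsion_pairs_mod_cat:
  "bij_betw (\<lambda>(C, C'). (supported_cat C, torsionfree_cat C))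
     {(C, C'). closedin (zariski_topology R) C \<and> closedin (zariski_topology R) C' \<and>
        C \<inter> C' = {} \<and> C \<union> C' = Spec R}
     (basic_torsion_pairs R (mod_cat R))" (is "bij_betw ?\<phi> ?D _")
proof -
  have uc: "upward_closed C" if "closedin (zariski_topology R) C" for C
    using that unfolding closedin_zariski[OF is_cring] upward_closed_def by blast
  have D: "C' = Spec R - C \<and> closedin (zariski_topology R) C \<and> closedin (zariski_topology R) (Spec R - C)"
    if "(C, C') \<in> ?D" for C C'
  proof -
    have "C' = Spec R - C" using that by blast
    then show ?thesis using that by blast
  qed
  have "inj_on ?\<phi> ?D"
  proof (rule inj_onI)
    fix p q assume p: "p \<in> ?D" and q: "q \<in> ?D" and eq: "?\<phi> p = ?\<phi> q"
    obtain C C' E E' where pq: "p = (C, C')" "q = (E, E')" by fastforce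
    have "supported_cat C = supported_cat E" using eq by (simp add: pq)
    moreover have "upward_closed C" "upward_closed E"
      using p q by (simp_all add: pq uc)
    ultimately have "C = E" by (rule supported_cat_inj[rotated 2])
    moreover have "C' = Spec R - C" "E' = Spec R - E"
      using D[OF p[unfolded pq(1)]] D[OF q[unfolded pq(2)]] by simp_all
    ultimately show "p = q" by (simp add: pq)
  qed
  moreover have "?\<phi> ` ?D = basic_torsion_pairs R (mod_cat R)"
  proof (intro equalityI subsetI)
    fix t assume "t \<in> ?\<phi> ` ?D"
    then obtain C C' where C: "(C, C') \<in> ?D" "t = (supported_cat C, torsionfree_cat C)" by auto
    then show "t \<in> basic_torsion_pairs R (mod_cat R)"
      using D[OF C(1)] uc basic_torsion_pair_mod_cat_iff by simp
  next
    fix t assume t: "t \<in> basic_torsion_pairs R (mod_cat R)"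
    then have "t \<in> torsion_pairs R (mod_cat R)" by (auto simp: basic_torsion_pairs_def)
    then obtain Z where Z: "upward_closed Z" "t = (supported_cat Z, torsionfree_cat Z)"
      unfolding torsion_pairs_mod_cat(1) by blast
    have ZS: "Z \<subseteq> Spec R" using Z by (simp add: upward_closed_def)
    have "closedin (zariski_topology R) Z \<and> closedin (zariski_topology R) (Spec R - Z)"
      using basic_torsion_pair_mod_cat_iff[OF Z(1)] t Z(2) by simp
    then have "(Z, Spec R - Z) \<in> ?D" using ZS by auto
    then show "t \<in> ?\<phi> ` ?D" using Z(2) by force
  qed
  ultimately show ?thesis by (simp add: bij_betw_def)
qed

end

theorem corollary1p2:
  fixes R :: "('a, 'm) ring_scheme"
  assumes "cring R" and "noetherian_ring R"
  shows
    "(weak_torsion_pairs R (mod_cat R) = torsion_pairs R (mod_cat R) \<and>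
      (\<exists>\<phi>. bij_betw \<phi> (torsion_pairs R (mod_cat R)) {Z. specialization_closed R Z})) \<and>
     (\<exists>\<phi>. bij_betw \<phi> (basic_torsion_pairs R (mod_cat R))
        {(C, C'). closedin (zariski_topology R) C \<and> closedin (zariski_topology R) C' \<and>
           C \<inter> C' = {} \<and> C \<union> C' = Spec R}) \<and>
     (weak_torsion_pairs R (S1_cat R) = torsion_pairs R (S1_cat R) \<and>
      torsion_pairs R (S1_cat R) = basic_torsion_pairs R (S1_cat R) \<and>
      (\<exists>\<phi>. bij_betw \<phi> (basic_torsion_pairs R (S1_cat R)) (Pow (Min_Spec R))))"
proof -
  interpret noetherian_cring R using assms by (simp add: noetherian_cring_def)
  show ?thesis
    using torsion_pairs_mod_cat(2) torsion_pairs_S1_cat(1,2)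
      bij_betw_inv_into[OF bij_torsion_pairs_mod_cat]
      bij_betw_inv_into[OF bij_basic_torsion_pairs_mod_cat]
      bij_betw_inv_into[OF bij_basic_torsion_pairs_S1_cat]
    by (intro conjI exI)
qed

end
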